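(* Let $\mathbb{D}_2=\{(x,y)\in\mathbb{D}: x>0,\ y>0\}$ be the first quadrant of the unit disc, and let $\mathtt{S}_x$, $\mathtt{S}_y$ be the reflections with respect to the horizontal and the vertical axis, respectively. Then: 1. The (convex) domain $\mathbb{D}_2$ has a Robin function whose unique critical point is $$\xi_0=\tfrac1{\sqrt2}\big(4+\sqrt{17}\big)^{-\frac14}(1+\mathrm{i}),$$ and a conformal bijection $F:\mathbb{D}\to\mathbb{D}_2$ with $F(0)=\xi_0$ satisfies $$\left|\frac{F^{(3)}(0)}{F'(0)}\right|\notin\Big\{2\sqrt{1-\tfrac1{n^2}}\,:\ n\in\mathbb{N}^*\cup\{\infty\}\Big\}.$$ 2. Let $\mathcal{E}_\lambda\subset\mathbb{D}_2$ be a point vortex periodic orbit that can be desingularized into a periodic vortex patch motion $\mathbf{1}_{D_t}\in L^\infty(\mathbb{R};L^\infty_c(\mathbb{D}_2))$, i.e. $\mathbf{1}_{D_t}$ is a time periodic weak solution of the Euler equations in $\mathbb{D}_2$ concentrated around a point vortex moving along $\mathcal{E}_\lambda$. Then the function $$\omega^\star=\mathbf{1}_{D_t}-\mathbf{1}_{\mathtt{S}_xD_t}-\mathbf{1}_{\mathtt{S}_yD_t}+\mathbf{1}_{-D_t}\in L^\infty(\mathbb{R};L^\infty_c(\mathbb{D}))$$ is a time periodic solution of the Euler equations in the unit disc $\mathbb{D}$.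
   Context: $\mathbb{D}$ is the open unit disc of $\mathbb{C}\cong\mathbb{R}^2$, $\mathbb{N}^*=\{1,2,\dots\}$, and for $n=\infty$ the value $2\sqrt{1-1/n^2}$ is $2$. The Robin function of a simply connected bounded domain $\mathbf{D}$ is $\mathcal{R}_{\mathbf{D}}(z)=\log\frac{|\Phi'(z)|}{1-|\Phi(z)|^2}$ for any conformal bijection $\Phi:\mathbf{D}\to\mathbb{D}$. Point vortex orbits in $\mathbf{D}$ are the trajectories of $\dot\xi=\frac{\mathrm{i}}2\partial_{\bar z}\mathcal{R}_{\mathbf{D}}(\xi)$, $\partial_{\bar z}=\frac12(\partial_x+\mathrm{i}\partial_y)$; $\mathcal{E}_\lambda$ is such an orbit on the level $\{\frac14\mathcal{R}_{\mathbf{D}}=\lambda\}$. Euler equations in a bounded domain $U$ (weak sense): $\partial_t\omega+u\cdot\nabla\omega=0$, $u=\nabla^\perp\psi$, $\nabla^\perp=(-\partial_y,\partial_x)$, with $\Delta\psi=\omega$ in $U$, $\psi=0$ on $\partial U$. $L^\infty_c(U)$ denotes the bounded functions with compact support in $U$; $-D_t=\{-x:x\in D_t\}$. *)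

theory Defs
  imports "HOL-Analysis.Analysis" "HOL-Complex_Analysis.Complex_Analysis"
begin

text \<open>The plane is identified with \<^typ>\<open>complex\<close>; the partial derivatives in x and y are the
  Frechet derivative in the directions \<^term>\<open>1::complex\<close> and \<^term>\<open>\<i>\<close>.\<close>

definition grad :: "(complex \<Rightarrow> real) \<Rightarrow> complex \<Rightarrow> complex" where
  "grad f z = Complex (frechet_derivative f (at z) 1) (frechet_derivative f (at z) \<i>)"

definition grad_perp :: "(complex \<Rightarrow> real) \<Rightarrow> complex \<Rightarrow> complex" where
  "grad_perp f z = Complex (- frechet_derivative f (at z) \<i>) (frechet_derivative f (at z) 1)"

definition dbar :: "(complex \<Rightarrow> real) \<Rightarrow> complex \<Rightarrow> complex" where
  "dbar f z = 1 / 2 * (of_real (frechet_derivative f (at z) 1)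
                        + \<i> * of_real (frechet_derivative f (at z) \<i>))"

definition laplacian :: "(complex \<Rightarrow> real) \<Rightarrow> complex \<Rightarrow> real" where
  "laplacian f z =
     frechet_derivative (\<lambda>w. frechet_derivative f (at w) 1) (at z) 1
   + frechet_derivative (\<lambda>w. frechet_derivative f (at w) \<i>) (at z) \<i>"


section \<open>Conformal bijections and the Robin function\<close>

definition conformal_bijection :: "(complex \<Rightarrow> complex) \<Rightarrow> complex set \<Rightarrow> complex set \<Rightarrow> bool" where
  "conformal_bijection f A B \<longleftrightarrow> f holomorphic_on A \<and> bij_betw f A B"

text \<open>The choice of the conformal bijection is immaterial: see \<open>robin_eq\<close> below.\<close>

definition robin :: "complex set \<Rightarrow> complex \<Rightarrow> real" where
  "robin D z =
     (let \<Phi> = (SOME \<Phi>. conformal_bijection \<Phi> D (ball 0 1))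
      in ln (cmod (deriv \<Phi> z) / (1 - (cmod (\<Phi> z))\<^sup>2)))"

lemma deriv_Moebius_function:
  assumes "1 - cnj w * z \<noteq> 0"
  shows "(Moebius_function 0 w has_field_derivative
           (1 - cnj w * w) / (1 - cnj w * z)\<^sup>2) (at z)"
  using assms unfolding Moebius_function_def
  by (auto intro!: derivative_eq_intros simp: power2_eq_square algebra_simps)

lemma conformal_density_le:
  assumes "open D" "z \<in> D"
    and \<Phi>: "conformal_bijection \<Phi> D (ball 0 1)" and \<Psi>: "conformal_bijection \<Psi> D (ball 0 1)"
  shows "cmod (deriv \<Psi> z) / (1 - (cmod (\<Psi> z))\<^sup>2) \<le> cmod (deriv \<Phi> z) / (1 - (cmod (\<Phi> z))\<^sup>2)"
proof -
  have hol\<Phi>: "\<Phi> holomorphic_on D" and inj: "inj_on \<Phi> D" and im\<Phi>: "\<Phi> ` D = ball 0 1"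
    and hol\<Psi>: "\<Psi> holomorphic_on D" and im\<Psi>: "\<Psi> ` D = ball 0 1"
    using \<Phi> \<Psi> by (auto simp: conformal_bijection_def bij_betw_def)
  obtain g where g: "g holomorphic_on ball 0 1"
      and dg: "\<And>z. z \<in> D \<Longrightarrow> deriv \<Phi> z * deriv g (\<Phi> z) = 1"
      and g\<Phi>: "\<And>z. z \<in> D \<Longrightarrow> g (\<Phi> z) = z"
    using holomorphic_has_inverse [OF hol\<Phi> \<open>open D\<close> inj] im\<Phi> by metis
  define w v where "w = \<Phi> z" and "v = \<Psi> z"
  have w: "cmod w < 1" and v: "cmod v < 1"
    using im\<Phi> im\<Psi> \<open>z \<in> D\<close> by (force simp: w_def v_def)+
  have gD: "g ` ball 0 1 \<subseteq> D" unfolding im\<Phi>[symmetric] using g\<Phi> by auto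
  define h where "h = Moebius_function 0 v \<circ> (\<Psi> \<circ> (g \<circ> Moebius_function 0 (- w)))"
  have imw: "Moebius_function 0 (- w) ` ball 0 1 \<subseteq> ball 0 1"
    using Moebius_function_norm_lt_1[of "- w"] w by auto
  have maps: "\<Psi> (g (Moebius_function 0 (- w) x)) \<in> ball 0 1" if "x \<in> ball 0 1" for x
    using that imw gD im\<Psi> by blast
  have holh: "h holomorphic_on ball 0 1"
    unfolding h_def
  proof (rule holomorphic_on_compose_gen[where t = "ball 0 1"])
    show "\<Psi> \<circ> (g \<circ> Moebius_function 0 (- w)) holomorphic_on ball 0 1"
    proof (rule holomorphic_on_compose_gen[where t = D])
      show "g \<circ> Moebius_function 0 (- w) holomorphic_on ball 0 1"
        using imw g Moebius_function_holomorphic[of "- w" 0] w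
        by (intro holomorphic_on_compose_gen[where t = "ball 0 1"]) auto
    qed (use hol\<Psi> gD imw in auto)
    show "Moebius_function 0 v holomorphic_on ball 0 1"
      using Moebius_function_holomorphic v by simp
    show "(\<Psi> \<circ> (g \<circ> Moebius_function 0 (- w))) ` ball 0 1 \<subseteq> ball 0 1"
      using maps by (auto simp del: mem_ball mem_ball_0)
  qed
  have m0: "Moebius_function 0 (- w) 0 = w" by (simp add: Moebius_function_def)
  have h0: "h 0 = 0"
    using g\<Phi>[OF \<open>z \<in> D\<close>] by (simp add: h_def m0 flip: w_def) (simp add: v_def Moebius_function_def)
  have hlt: "cmod (h x) < 1" if "cmod x < 1" for x
    using Moebius_function_norm_lt_1[OF v] maps[of x] that by (simp add: h_def)
  have cw: "1 - cnj w * w = of_real (1 - (cmod w)\<^sup>2)" and cv: "1 - cnj v * v = of_real (1 - (cmod v)\<^sup>2)"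
    by (simp_all add: complex_norm_square mult.commute del: of_real_power)
  have pw: "1 - (cmod w)\<^sup>2 > 0" and pv: "1 - (cmod v)\<^sup>2 > 0"
    using w v by (simp_all add: abs_square_less_1)
  have d1: "(Moebius_function 0 (- w) has_field_derivative of_real (1 - (cmod w)\<^sup>2)) (at 0)"
    using deriv_Moebius_function[of "- w" 0] cw by simp
  have d2: "(g has_field_derivative deriv g w) (at w)"
    using g w by (simp add: holomorphic_derivI)
  have d3: "(\<Psi> has_field_derivative deriv \<Psi> z) (at z)"
    using hol\<Psi> \<open>open D\<close> \<open>z \<in> D\<close> by (simp add: holomorphic_derivI)
  have nz: "1 - cnj v * v \<noteq> 0" using cv pv by (metis of_real_eq_0_iff less_irrefl)
  have d4: "(Moebius_function 0 v has_field_derivative 1 / of_real (1 - (cmod v)\<^sup>2)) (at v)"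
    using deriv_Moebius_function[of v v] nz by (simp add: cv power2_eq_square)
  have gw: "g w = z" using g\<Phi>[OF \<open>z \<in> D\<close>] by (simp add: w_def)
  have "(h has_field_derivative
      1 / of_real (1 - (cmod v)\<^sup>2) * (deriv \<Psi> z * (deriv g w * of_real (1 - (cmod w)\<^sup>2)))) (at 0)"
    unfolding h_def
    by (intro DERIV_chain) (use d1 d2 d3 d4 gw m0 in \<open>simp_all flip: v_def\<close>)
  then have "deriv h 0 =
      1 / of_real (1 - (cmod v)\<^sup>2) * (deriv \<Psi> z * (deriv g w * of_real (1 - (cmod w)\<^sup>2)))"
    by (rule DERIV_imp_deriv)
  moreover have "cmod (deriv h 0) \<le> 1"
    using Schwarz_Lemma(2)[OF holh h0 hlt, of 0] by simp
  ultimately have "cmod (deriv \<Psi> z) * cmod (deriv g w) * (1 - (cmod w)\<^sup>2) / (1 - (cmod v)\<^sup>2) \<le> 1"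
    using pw pv by (simp add: norm_mult norm_divide del: of_real_diff of_real_power)
  moreover have "cmod (deriv \<Phi> z) * cmod (deriv g w) = 1"
    using dg[OF \<open>z \<in> D\<close>] by (metis norm_mult norm_one w_def)
  moreover have "cmod (deriv \<Phi> z) > 0" using calculation(2) by (metis mult_zero_left zero_less_norm_iff norm_zero zero_neq_one)
  ultimately have "cmod (deriv \<Psi> z) / (1 - (cmod v)\<^sup>2) \<le> cmod (deriv \<Phi> z) / (1 - (cmod w)\<^sup>2)"
  proof -
    assume le: "cmod (deriv \<Psi> z) * cmod (deriv g w) * (1 - (cmod w)\<^sup>2) / (1 - (cmod v)\<^sup>2) \<le> 1"
      and e: "cmod (deriv \<Phi> z) * cmod (deriv g w) = 1" and p: "cmod (deriv \<Phi> z) > 0"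
    have "cmod (deriv g w) = 1 / cmod (deriv \<Phi> z)" using e p by (simp add: field_simps)
    then show ?thesis using le p pw pv by (simp add: field_simps)
  qed
  then show ?thesis by (simp add: w_def v_def)
qed

lemma robin_eq:
  assumes "open D" "z \<in> D" "conformal_bijection \<Phi> D (ball 0 1)"
  shows "robin D z = ln (cmod (deriv \<Phi> z) / (1 - (cmod (\<Phi> z))\<^sup>2))"
proof -
  have "conformal_bijection (SOME \<Phi>. conformal_bijection \<Phi> D (ball 0 1)) D (ball 0 1)"
    using assms(3) by (metis someI)
  then show ?thesis
    unfolding robin_def Let_def using assms
    by (metis conformal_density_le order_antisym)
qed


section \<open>Point vortex orbits\<close>

definition point_vortex_trajectory :: "complex set \<Rightarrow> (real \<Rightarrow> complex) \<Rightarrow> bool" where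
  "point_vortex_trajectory D \<xi> \<longleftrightarrow>
     (\<forall>t. \<xi> t \<in> D \<and> (\<xi> has_vector_derivative \<i> / 2 * dbar (robin D) (\<xi> t)) (at t))"

definition point_vortex_periodic_orbit :: "complex set \<Rightarrow> real \<Rightarrow> complex set \<Rightarrow> bool" where
  "point_vortex_periodic_orbit D lam \<E> \<longleftrightarrow>
     (\<exists>\<xi>. point_vortex_trajectory D \<xi> \<and> (\<exists>T>0. \<forall>t. \<xi> (t + T) = \<xi> t) \<and> \<E> = range \<xi>)
     \<and> \<E> \<subseteq> {z \<in> D. 1 / 4 * robin D z = lam}"

text \<open>The set \<open>S t\<close> stays within distance \<open>\<epsilon>\<close> of a point vortex moving along \<open>\<E>\<close>.  The equation
  \<^const>\<open>point_vortex_trajectory\<close> is that of a vortex of circulation pi; a vortex of circulation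
  \<open>pi * c\<close> (a patch of unit vorticity has circulation equal to its area) runs through the same
  orbit with its speed multiplied by \<open>c\<close>.\<close>

definition concentrated_along ::
    "complex set \<Rightarrow> complex set \<Rightarrow> real \<Rightarrow> (real \<Rightarrow> complex set) \<Rightarrow> bool" where
  "concentrated_along D \<E> \<epsilon> S \<longleftrightarrow>
     (\<exists>\<xi> c. point_vortex_trajectory D \<xi> \<and> range \<xi> = \<E> \<and> c > 0 \<and> (\<forall>t. S t \<subseteq> ball (\<xi> (c * t)) \<epsilon>))"


section \<open>Weak solutions of the Euler equations\<close>

fun C_k :: "nat \<Rightarrow> ('a::euclidean_space \<Rightarrow> real) \<Rightarrow> bool" where
  "C_k 0 f \<longleftrightarrow> continuous_on UNIV f"
| "C_k (Suc k) f \<longleftrightarrow>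
     (\<forall>x. f differentiable (at x)) \<and> (\<forall>v. C_k k (\<lambda>x. frechet_derivative f (at x) v))"

text \<open>Smooth functions with compact support in \<open>\<Omega>\<close>, extended by zero.\<close>

definition test_function :: "'a::euclidean_space set \<Rightarrow> ('a \<Rightarrow> real) \<Rightarrow> bool" where
  "test_function \<Omega> \<phi> \<longleftrightarrow>
     (\<forall>k. C_k k \<phi>) \<and> (\<exists>K. compact K \<and> K \<subseteq> \<Omega> \<and> (\<forall>x. x \<notin> K \<longrightarrow> \<phi> x = 0))"

text \<open>The space of bounded functions of time with values in the bounded compactly supported
  functions on \<open>U\<close>.  As for bounded subsets of the inductive limit of the spaces of functions
  supported in a given compact set, one compact set contains the supports at all times.\<close>

definition Linf_Linfc :: "complex set \<Rightarrow> (real \<Rightarrow> complex \<Rightarrow> real) \<Rightarrow> bool" where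
  "Linf_Linfc U \<omega> \<longleftrightarrow>
     (\<lambda>(t, z). \<omega> t z) \<in> borel_measurable lebesgue \<and>
     (\<forall>t. \<omega> t \<in> borel_measurable lebesgue) \<and>
     (\<exists>M. \<forall>t z. \<bar>\<omega> t z\<bar> \<le> M) \<and>
     (\<exists>K. compact K \<and> K \<subseteq> U \<and> (\<forall>t z. z \<notin> K \<longrightarrow> \<omega> t z = 0))"

text \<open>The Poisson equation holds in the sense of distributions, the boundary condition pointwise;
  by Weyl's lemma and the maximum principle, \<open>\<psi>\<close> is unique on the closure of a bounded \<open>U\<close>.\<close>

definition stream_function :: "complex set \<Rightarrow> (complex \<Rightarrow> real) \<Rightarrow> (complex \<Rightarrow> real) \<Rightarrow> bool" where
  "stream_function U \<omega> \<psi> \<longleftrightarrow>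
     continuous_on (closure U) \<psi> \<and>
     (\<forall>z \<in> frontier U. \<psi> z = 0) \<and>
     (\<forall>z \<in> U. \<psi> differentiable (at z)) \<and> continuous_on U (grad \<psi>) \<and>
     (\<forall>\<phi>. test_function U \<phi> \<longrightarrow>
        (LINT z|lebesgue. \<psi> z * laplacian \<phi> z) = (LINT z|lebesgue. \<omega> z * \<phi> z))"

text \<open>Since the velocity \<open>grad_perp (\<psi> t)\<close> is divergence free, testing the transport equation
  against \<open>\<phi>\<close> and integrating by parts leads to the identity below.\<close>

definition euler_weak_solution :: "complex set \<Rightarrow> (real \<Rightarrow> complex \<Rightarrow> real) \<Rightarrow> bool" where
  "euler_weak_solution U \<omega> \<longleftrightarrow>
     Linf_Linfc U \<omega> \<and>
     (\<exists>\<psi>. (\<forall>t. stream_function U (\<omega> t) (\<psi> t)) \<and>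
        (\<forall>\<phi>. test_function (UNIV \<times> U) \<phi> \<longrightarrow>
           has_bochner_integral lebesgue
             (\<lambda>(t, z). \<omega> t z * (deriv (\<lambda>s. \<phi> (s, z)) t
                                + grad_perp (\<psi> t) z \<bullet> grad (\<lambda>w. \<phi> (t, w)) z)) 0))"

definition time_periodic :: "(real \<Rightarrow> 'a) \<Rightarrow> bool" where
  "time_periodic f \<longleftrightarrow> (\<exists>T>0. \<forall>t. f (t + T) = f t)"


section \<open>The quarter disc\<close>

definition quarter_disc :: "complex set" where
  "quarter_disc = {z \<in> ball 0 1. Re z > 0 \<and> Im z > 0}"

definition \<xi>\<^sub>0 :: complex where
  "\<xi>\<^sub>0 = of_real (1 / sqrt 2 * (4 + sqrt 17) powr (- 1 / 4)) * (1 + \<i>)"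

definition refl_x :: "complex \<Rightarrow> complex" where
  "refl_x z = Complex (Re z) (- Im z)"

definition refl_y :: "complex \<Rightarrow> complex" where
  "refl_y z = Complex (- Re z) (Im z)"

end

(*
  Since z^2 maps the quarter disc onto the upper half disc, h(z) = ((1 + z^2) / (1 - z^2))^2 maps it onto the
  upper half plane, and the square of the conformal density |h'| / (2 Im h) simplifies to
  (1/x^2 + 1/y^2) / 4 + 4 q / (1 - q^2)^2 with q = x^2 + y^2.  At a critical point x = y, and p = q^2 solves
  (p + 1) (p^2 + 8 p - 1) = 0, so p = sqrt 17 - 4.  By the Schwarz lemma h o F is a Moebius map for every
  conformal F with F(0) = xi_0.  Differentiating this identity shows that the second derivative of F vanishes
  at 0 and that the ratio of the third to the first is minus the Schwarzian of h at xi_0 times F'(0)^2; its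
  modulus lies strictly between 0 and 3/2, hence between the values of 2 sqrt (1 - 1/n^2) for n = 1 and n = 2.

  For the Euler equations, vorticity and stream function are extended oddly across both axes.  Testing the
  Poisson equation in the disc against phi amounts to testing it in the quarter disc against the odd
  symmetrization of phi, which vanishes on the axes; so does the stream function, and a cutoff near the axes is
  therefore harmless in the limit.  The extended stream function is thus weakly harmonic off the reflected
  supports of the vorticity, and Weyl's lemma makes it C^1 across the axes.  The transport identity only sees
  the four reflected copies of the support, each of which is handled by the equation in the quarter disc.
*)

theory Submission
  imports Defs
begin

section \<open>The Robin function of the quarter disc\<close>

text \<open>For a conformal F from the unit disc the Robin function R satisfies R(F(z)) = - log
  (|F'(z)| (1 - |z|^2)), so F(0) is a critical point exactly when the second derivative of F
  vanishes at 0. Hence the relation p^2 = 1 - 8 p for p = sqrt 17 - 4 serves twice: it locates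
  \<open>\<xi>\<^sub>0\<close>, and it removes the second derivative from the formula for the third,
  so that only the Schwarzian survives. The obstacle in the Euler part is regularity. A stream
  function in the quarter disc is C^1 inside and merely continuous up to the boundary, whereas in
  the disc C^1 is required across the axes and at the corner 0. No decay rate is available either:
  the error of the cutoff is only bounded in L^1, and uniform continuity of the stream function
  makes its contribution tend to 0. Weyl's lemma rests on a reproducing formula: locally the
  function is its own convolution with a smooth kernel of small support. This kernel arises from
  testing with a cutoff times a regularized logarithm.\<close>

lemma bij_betw_square_quadrant:
  "bij_betw (\<lambda>z::complex. z\<^sup>2) {z. Re z > 0 \<and> Im z > 0} {z. Im z > 0}"
  unfolding bij_betw_def
proof
  show "inj_on (\<lambda>z::complex. z\<^sup>2) {z. Re z > 0 \<and> Im z > 0}"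
    by (auto simp: inj_on_def power2_eq_iff)
  have "w \<in> (\<lambda>z. z\<^sup>2) ` {z. Re z > 0 \<and> Im z > 0}" if "Im w > 0" for w
  proof -
    have "Im ((csqrt w)\<^sup>2) > 0" using that by simp
    then have "Re (csqrt w) * Im (csqrt w) > 0" by (simp only: Im_power2)
    moreover have "Re (csqrt w) \<ge> 0" using csqrt_principal[of w] by linarith
    ultimately have "Re (csqrt w) > 0 \<and> Im (csqrt w) > 0"
      by (smt (verit) zero_less_mult_iff)
    then show ?thesis
      by (intro image_eqI[of _ _ "csqrt w"]) auto
  qed
  then show "(\<lambda>z::complex. z\<^sup>2) ` {z. Re z > 0 \<and> Im z > 0} = {z. Im z > 0}"
    by (auto simp: Im_power2)
qed

text \<open>The numerators show that the Cayley map turns \<open>cmod w < 1\<close> into a positive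
  real part and keeps the sign of the imaginary part. The exact values enter again in the
  computation of the Robin function.\<close>

lemma Re_Moebius_plane:
  assumes "w \<noteq> 1"
  shows "Re ((1 + w) / (1 - w)) = (1 - (cmod w)\<^sup>2) / (cmod (1 - w))\<^sup>2"
    and "Im ((1 + w) / (1 - w)) = 2 * Im w / (cmod (1 - w))\<^sup>2"
  unfolding Re_divide Im_divide cmod_power2
  by (simp_all add: power2_eq_square algebra_simps)

lemma bij_betw_half_disc_quadrant:
  "bij_betw (\<lambda>w::complex. (1 + w) / (1 - w)) {w \<in> ball 0 1. Im w > 0} {z. Re z > 0 \<and> Im z > 0}"
proof (rule bij_betw_byWitness[where f' = "\<lambda>g. (g - 1) / (g + 1)"])
  show "\<forall>w\<in>{w \<in> ball 0 1. Im w > 0}. ((1 + w) / (1 - w) - 1) / ((1 + w) / (1 - w) + 1) = w"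
  proof
    fix w :: complex assume "w \<in> {w \<in> ball 0 1. Im w > 0}"
    then have w: "1 - w \<noteq> 0" by auto
    have "(1 + w) / (1 - w) - 1 = 2 * w / (1 - w)" "(1 + w) / (1 - w) + 1 = 2 / (1 - w)"
      using w by (simp_all add: divide_simps)
    then show "((1 + w) / (1 - w) - 1) / ((1 + w) / (1 - w) + 1) = w"
      using w by simp
  qed
  have ne: "g + 1 \<noteq> 0" if "Re g > 0" for g
    using that by (auto simp: complex_eq_iff)
  show "\<forall>g\<in>{z. Re z > 0 \<and> Im z > 0}. (1 + (g - 1) / (g + 1)) / (1 - (g - 1) / (g + 1)) = g"
  proof
    fix g :: complex assume "g \<in> {z. Re z > 0 \<and> Im z > 0}"
    then have g: "g + 1 \<noteq> 0" using ne by auto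
    have "1 + (g - 1) / (g + 1) = 2 * g / (g + 1)" "1 - (g - 1) / (g + 1) = 2 / (g + 1)"
      using g by (simp_all add: divide_simps)
    then show "(1 + (g - 1) / (g + 1)) / (1 - (g - 1) / (g + 1)) = g"
      using g by simp
  qed
  show "(\<lambda>w. (1 + w) / (1 - w)) ` {w \<in> ball 0 1. Im w > 0} \<subseteq> {z. Re z > 0 \<and> Im z > 0}"
  proof clarsimp
    fix w assume w: "cmod w < 1" "Im w > 0"
    then have "w \<noteq> 1" by auto
    then have "(cmod (1 - w))\<^sup>2 > 0" by simp
    moreover have "(cmod w)\<^sup>2 < 1" using w by (simp add: abs_square_less_1)
    ultimately show "Re ((1 + w) / (1 - w)) > 0 \<and> Im ((1 + w) / (1 - w)) > 0"
      unfolding Re_Moebius_plane[OF \<open>w \<noteq> 1\<close>] using w by simp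
  qed
  show "(\<lambda>g. (g - 1) / (g + 1)) ` {z. Re z > 0 \<and> Im z > 0} \<subseteq> {w \<in> ball 0 1. Im w > 0}"
  proof clarsimp
    fix g assume g: "Re g > 0" "Im g > 0"
    have "cmod (g - 1) < cmod (g + 1)"
      unfolding cmod_def using g by (intro real_sqrt_less_mono) (simp add: power2_eq_square algebra_simps)
    moreover have "Im ((g - 1) / (g + 1)) = 2 * Im g / (cmod (g + 1))\<^sup>2"
      unfolding Im_divide cmod_power2 by (simp add: power2_eq_square algebra_simps)
    moreover have "(cmod (g + 1))\<^sup>2 > 0" using ne[OF g(1)] by simp
    ultimately show "cmod ((g - 1) / (g + 1)) < 1 \<and> Im ((g - 1) / (g + 1)) > 0"
      using ne[OF g(1)] g by (simp add: norm_divide)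
  qed
qed

text \<open>The inner square opens the right angle at 0 and gives the upper half disc; the Cayley
  map sends the corners -1 and 1 of the half disc to 0 and infinity, which makes it a quadrant; the
  outer square opens this quadrant to a half plane.\<close>

definition quarter_to_plane :: "complex \<Rightarrow> complex" where
  "quarter_to_plane z = ((1 + z\<^sup>2) / (1 - z\<^sup>2))\<^sup>2"

lemma bij_betw_quarter_to_plane: "bij_betw quarter_to_plane quarter_disc {u. Im u > 0}"
proof -
  have "(\<lambda>z. z\<^sup>2) ` quarter_disc = {w \<in> ball 0 1. Im w > 0}"
  proof
    show "(\<lambda>z. z\<^sup>2) ` quarter_disc \<subseteq> {w \<in> ball 0 1. Im w > 0}"
      by (auto simp: quarter_disc_def norm_power abs_square_less_1 Im_power2)
    show "{w \<in> ball 0 1. Im w > 0} \<subseteq> (\<lambda>z. z\<^sup>2) ` quarter_disc"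
    proof clarify
      fix w :: complex assume w: "w \<in> ball 0 1" "Im w > 0"
      then obtain z where z: "w = z\<^sup>2" "Re z > 0" "Im z > 0"
        using bij_betw_square_quadrant by (auto simp: bij_betw_def)
      then have "cmod z < 1" using w by (simp add: norm_power abs_square_less_1)
      then show "w \<in> (\<lambda>z. z\<^sup>2) ` quarter_disc" using z by (auto simp: quarter_disc_def)
    qed
  qed
  moreover have "inj_on (\<lambda>z::complex. z\<^sup>2) quarter_disc"
    by (auto simp: inj_on_def power2_eq_iff quarter_disc_def)
  ultimately have 1: "bij_betw (\<lambda>z. z\<^sup>2) quarter_disc {w \<in> ball 0 1. Im w > 0}"
    by (simp add: bij_betw_def)
  show ?thesis
    using bij_betw_trans[OF bij_betw_trans[OF 1 bij_betw_half_disc_quadrant] bij_betw_square_quadrant]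
    by (simp add: o_def quarter_to_plane_def[abs_def])
qed

lemma bij_betw_half_plane_disc:
  assumes "Im h > 0"
  shows "bij_betw (\<lambda>u. (u - h) / (u - cnj h)) {u. Im u > 0} (ball 0 1)"
proof (rule bij_betw_byWitness[where f' = "\<lambda>\<zeta>. (h - \<zeta> * cnj h) / (1 - \<zeta>)"])
  have ne: "u - cnj h \<noteq> 0" if "Im u > 0" for u
    using that assms by (auto simp: complex_eq_iff)
  have hh: "h - cnj h \<noteq> 0" using assms by (auto simp: complex_eq_iff)
  show "\<forall>u\<in>{u. Im u > 0}. (h - (u - h) / (u - cnj h) * cnj h) / (1 - (u - h) / (u - cnj h)) = u"
  proof clarsimp
    fix u assume u: "Im u > 0"
    have "1 - (u - h) / (u - cnj h) = (h - cnj h) / (u - cnj h)"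
      using ne[OF u] by (simp add: field_simps)
    moreover have "h - (u - h) * cnj h / (u - cnj h) = u * (h - cnj h) / (u - cnj h)"
      using ne[OF u] by (simp add: field_simps)
    ultimately show "(h - (u - h) * cnj h / (u - cnj h)) / (1 - (u - h) / (u - cnj h)) = u"
      using ne[OF u] hh by simp
  qed
  show "\<forall>\<zeta>\<in>ball 0 1. ((h - \<zeta> * cnj h) / (1 - \<zeta>) - h) / ((h - \<zeta> * cnj h) / (1 - \<zeta>) - cnj h) = \<zeta>"
  proof
    fix \<zeta> :: complex assume "\<zeta> \<in> ball 0 1"
    then have z: "1 - \<zeta> \<noteq> 0" by auto
    have "(h - \<zeta> * cnj h) / (1 - \<zeta>) - h = \<zeta> * (h - cnj h) / (1 - \<zeta>)"
      "(h - \<zeta> * cnj h) / (1 - \<zeta>) - cnj h = (h - cnj h) / (1 - \<zeta>)"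
      using z by (simp_all add: divide_simps) (simp_all add: algebra_simps)
    then show "((h - \<zeta> * cnj h) / (1 - \<zeta>) - h) / ((h - \<zeta> * cnj h) / (1 - \<zeta>) - cnj h) = \<zeta>"
      using z hh by simp
  qed
  show "(\<lambda>u. (u - h) / (u - cnj h)) ` {u. Im u > 0} \<subseteq> ball 0 1"
  proof clarsimp
    fix u assume u: "Im u > 0"
    have "0 < Im u * Im h" using u assms by simp
    then have "cmod (u - h) < cmod (u - cnj h)"
      unfolding cmod_def
      by (intro real_sqrt_less_mono) (simp add: power2_eq_square algebra_simps)
    then show "cmod ((u - h) / (u - cnj h)) < 1"
      using ne[OF u] by (simp add: norm_divide)
  qed
  show "(\<lambda>\<zeta>. (h - \<zeta> * cnj h) / (1 - \<zeta>)) ` ball 0 1 \<subseteq> {u. Im u > 0}"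
  proof clarsimp
    fix \<zeta> assume z: "cmod \<zeta> < 1"
    then have "(cmod (1 - \<zeta>))\<^sup>2 > 0" by auto
    moreover have "(cmod \<zeta>)\<^sup>2 < 1" using z by (simp add: abs_square_less_1)
    moreover have "Im ((h - \<zeta> * cnj h) / (1 - \<zeta>)) = Im h * (1 - (cmod \<zeta>)\<^sup>2) / (cmod (1 - \<zeta>))\<^sup>2"
      unfolding Im_divide cmod_power2 by (simp add: power2_eq_square algebra_simps)
    ultimately show "Im ((h - \<zeta> * cnj h) / (1 - \<zeta>)) > 0"
      using assms by simp
  qed
qed

text \<open>The parameter \<open>h\<close> is the point of the half plane that goes to 0. The Robin
  function is computed with \<open>h = \<i>\<close>, the maps \<open>F\<close> are studied with
  \<open>h\<close> the image of \<open>\<xi>\<^sub>0\<close>.\<close>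

definition quarter_to_disc :: "complex \<Rightarrow> complex \<Rightarrow> complex" where
  "quarter_to_disc h z = (quarter_to_plane z - h) / (quarter_to_plane z - cnj h)"

lemma quarter_disc_nonzero:
  assumes "z \<in> quarter_disc"
  shows "z \<noteq> 0" "1 - z\<^sup>2 \<noteq> 0" "1 + z\<^sup>2 \<noteq> 0"
proof -
  have "cmod (z\<^sup>2) < 1"
    using assms by (simp add: quarter_disc_def norm_power abs_square_less_1)
  then show "1 - z\<^sup>2 \<noteq> 0" "1 + z\<^sup>2 \<noteq> 0"
    by (auto simp: add_eq_0_iff norm_power)
       (metis add.inverse_inverse less_irrefl norm_minus_cancel norm_one norm_power)+
  show "z \<noteq> 0" using assms by (auto simp: quarter_disc_def)
qed

lemma quarter_to_plane_deriv:
  assumes "1 - z\<^sup>2 \<noteq> 0"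
  shows "(quarter_to_plane has_field_derivative 8 * z * (1 + z\<^sup>2) / (1 - z\<^sup>2) ^ 3) (at z)"
  unfolding quarter_to_plane_def[abs_def] using assms
  by (auto intro!: derivative_eq_intros)
    (simp add: divide_simps power2_eq_square power3_eq_cube, simp add: algebra_simps)

lemma open_quarter_disc: "open quarter_disc"
proof -
  have "quarter_disc = ball 0 1 \<inter> {z. Re z > 0} \<inter> {z. Im z > 0}"
    by (auto simp: quarter_disc_def)
  then show ?thesis
    by (metis open_Int open_ball open_halfspace_Re_gt open_halfspace_Im_gt)
qed

lemma convex_quarter_disc: "convex quarter_disc"
proof -
  have "quarter_disc = ball 0 1 \<inter> {z. Re z > 0} \<inter> {z. Im z > 0}"
    by (auto simp: quarter_disc_def)
  then show ?thesis
    by (metis convex_Int convex_ball convex_halfspace_Re_gt convex_halfspace_Im_gt)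
qed

lemma conformal_bijection_quarter_to_disc:
  assumes "Im h > 0"
  shows "conformal_bijection (quarter_to_disc h) quarter_disc (ball 0 1)"
proof -
  have pos: "Im (quarter_to_plane z) > 0" if "z \<in> quarter_disc" for z
    using bij_betw_quarter_to_plane that by (auto simp: bij_betw_def)
  have "quarter_to_plane holomorphic_on quarter_disc"
    using quarter_to_plane_deriv quarter_disc_nonzero(2) open_quarter_disc
    by (meson holomorphic_on_open)
  then have "quarter_to_disc h holomorphic_on quarter_disc"
    unfolding quarter_to_disc_def[abs_def] using pos assms
    by (intro holomorphic_intros) (auto simp: complex_eq_iff, force)
  moreover have "bij_betw (quarter_to_disc h) quarter_disc (ball 0 1)"
    using bij_betw_trans[OF bij_betw_quarter_to_plane bij_betw_half_plane_disc[OF assms]]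
    by (simp add: o_def quarter_to_disc_def[abs_def])
  ultimately show ?thesis by (simp add: conformal_bijection_def)
qed


text \<open>Twice the Robin function is the logarithm of this expression. The squared conformal
  density is preferred because it is rational in the coordinates: \<open>cmod\<close> enters only
  through even powers.\<close>

definition robin_density :: "complex \<Rightarrow> real" where
  "robin_density z = (1 / (Re z)\<^sup>2 + 1 / (Im z)\<^sup>2) / 4 + 4 * (cmod z)\<^sup>2 / (1 - (cmod z) ^ 4)\<^sup>2"

text \<open>The denominator \<open>(cmod (u - cnj h))\<^sup>2\<close> also appears in the derivative
  of the Moebius map and cancels, which leaves the density \<open>1 / (2 * Im u)\<close> of the half
  plane, independent of \<open>h\<close>.\<close>

lemma half_plane_disc_density:
  assumes "Im h > 0" "Im u > 0"
  shows "1 - (cmod ((u - h) / (u - cnj h)))\<^sup>2 = 4 * Im u * Im h / (cmod (u - cnj h))\<^sup>2"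
proof -
  have "u - cnj h \<noteq> 0" using assms by (auto simp: complex_eq_iff)
  then have "(cmod (u - cnj h))\<^sup>2 \<noteq> 0" by simp
  moreover have "(cmod (u - cnj h))\<^sup>2 - (cmod (u - h))\<^sup>2 = 4 * Im u * Im h"
    unfolding cmod_power2 by (simp add: power2_eq_square algebra_simps)
  moreover have "1 - a / b = (b - a) / b" if "b \<noteq> 0" for a b :: real
    using that by (simp add: diff_divide_distrib)
  ultimately show ?thesis unfolding norm_divide power_divide by metis
qed

lemma robin_quarter_disc:
  assumes z: "z \<in> quarter_disc"
  shows "robin_density z > 0" and "robin quarter_disc z = ln (robin_density z) / 2"
proof -
  define u where "u = quarter_to_plane z"
  define d where "d = 8 * z * (1 + z\<^sup>2) / (1 - z\<^sup>2) ^ 3"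
  define w where "w = z\<^sup>2"
  have xy: "Re z > 0" "Im z > 0" "cmod z < 1" using z by (auto simp: quarter_disc_def)
  then have c4: "cmod z ^ 4 < 1" by (simp add: power_less_one_iff)
  then show "robin_density z > 0"
    using xy by (auto simp: robin_density_def intro!: add_pos_nonneg)
  have u: "Im u > 0" using z bij_betw_quarter_to_plane by (auto simp: u_def bij_betw_def)
  have d: "(quarter_to_plane has_field_derivative d) (at z)"
    unfolding d_def by (rule quarter_to_plane_deriv[OF quarter_disc_nonzero(2)[OF z]])
  have ni: "u + \<i> \<noteq> 0" using u by (auto simp: complex_eq_iff)
  then have "(quarter_to_disc \<i> has_field_derivative (2 * \<i> * d / (u + \<i>)\<^sup>2)) (at z)"
    unfolding quarter_to_disc_def[abs_def] using d
    by (auto intro!: derivative_eq_intros simp: u_def power2_eq_square field_simps)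
  then have "deriv (quarter_to_disc \<i>) z = 2 * \<i> * d / (u + \<i>)\<^sup>2" by (rule DERIV_imp_deriv)
  moreover have "1 - (cmod (quarter_to_disc \<i> z))\<^sup>2 = 4 * Im u / (cmod (u + \<i>))\<^sup>2"
    using half_plane_disc_density[of \<i> u] u by (simp add: quarter_to_disc_def u_def)
  ultimately have "robin quarter_disc z = ln ((cmod (2 * \<i> * d / (u + \<i>)\<^sup>2)) / (4 * Im u / (cmod (u + \<i>))\<^sup>2))"
    using robin_eq[OF open_quarter_disc z conformal_bijection_quarter_to_disc[of \<i>]] by simp
  also have "(cmod (2 * \<i> * d / (u + \<i>)\<^sup>2)) / (4 * Im u / (cmod (u + \<i>))\<^sup>2) = cmod d / (2 * Im u)"
    using ni u by (simp add: norm_mult norm_divide norm_power field_simps)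
  finally have rob: "robin quarter_disc z = ln (cmod d / (2 * Im u))" .
  have w1: "w \<noteq> 1" "1 - w \<noteq> 0" "1 + w \<noteq> 0" using quarter_disc_nonzero[OF z] by (auto simp: w_def)
  have Imu: "Im u = 4 * (1 - cmod z ^ 4) * Im w / (cmod (1 - w)) ^ 4"
    unfolding u_def quarter_to_plane_def w_def[symmetric] Im_power2 Re_Moebius_plane[OF w1(1)]
    by (simp add: w_def norm_power power_mult[symmetric])
  have Imw: "Im w = 2 * Re z * Im z" by (simp add: w_def Im_power2)
  have cd: "cmod d = 8 * cmod z * cmod (1 + w) / cmod (1 - w) ^ 3"
    by (simp add: d_def w_def norm_mult norm_divide norm_power)
  have q: "cmod d / (2 * Im u) = cmod z * (cmod (1 + w) * cmod (1 - w)) / ((1 - cmod z ^ 4) * (2 * Re z * Im z))"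
    unfolding cd Imu Imw using xy c4 w1 by (simp add: field_simps power3_eq_cube power4_eq_xxxx)
  \<comment> \<open>This is |1 - w^2|^2 = (1 - |w|^2)^2 + 4 (Im w)^2. After division the first
    summand yields the inverse squares of the coordinates in \<open>robin_density\<close>, the
    second one the term with the fourth power of \<open>cmod z\<close>.\<close>
  have prod: "(cmod (1 + w) * cmod (1 - w))\<^sup>2 = (1 - cmod z ^ 4)\<^sup>2 + 16 * (Re z)\<^sup>2 * (Im z)\<^sup>2"
  proof -
    have "cmod z ^ 4 = (cmod w)\<^sup>2" by (simp add: w_def norm_power power_mult[symmetric])
    then have "(cmod (1 + w) * cmod (1 - w))\<^sup>2 = (1 - cmod z ^ 4)\<^sup>2 + 4 * (Im w)\<^sup>2"
      unfolding power_mult_distrib cmod_power2 by (simp add: power2_eq_square algebra_simps)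
    then show ?thesis by (simp add: Imw power_mult_distrib)
  qed
  have cz: "(cmod z)\<^sup>2 = (Re z)\<^sup>2 + (Im z)\<^sup>2" by (rule cmod_power2)
  define c where "c = 1 - cmod z ^ 4"
  have "c > 0" using c4 by (simp add: c_def)
  have "(cmod d / (2 * Im u))\<^sup>2 = (cmod z)\<^sup>2 * (c\<^sup>2 + 16 * (Re z)\<^sup>2 * (Im z)\<^sup>2) / (c\<^sup>2 * (4 * (Re z)\<^sup>2 * (Im z)\<^sup>2))"
    unfolding q power_divide power_mult_distrib prod[unfolded power_mult_distrib] c_def[symmetric] by simp
  also have "\<dots> = robin_density z"
    unfolding robin_density_def c_def[symmetric] using xy \<open>c > 0\<close>
    by (simp add: divide_simps cz) (simp add: algebra_simps)
  finally have "robin_density z = (cmod d / (2 * Im u))\<^sup>2" ..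
  moreover have "cmod d / (2 * Im u) > 0"
    unfolding q using xy c4 w1 quarter_disc_nonzero[OF z] by simp
  ultimately show "robin quarter_disc z = ln (robin_density z) / 2"
    unfolding rob by (simp add: ln_realpow)
qed

text \<open>The constant \<open>k\<close> is the derivative of 4 q / (1 - q^2)^2 with respect to q =
  |z|^2; the factors \<open>2 * Re z\<close> and \<open>2 * Im z\<close> come from the chain rule
  through q.\<close>

lemma robin_density_has_derivative:
  assumes z: "z \<in> quarter_disc"
  defines "k \<equiv> 4 * (1 + 3 * cmod z ^ 4) / (1 - cmod z ^ 4) ^ 3"
  shows "(robin_density has_derivative
           (\<lambda>h. (2 * Re z * k - 1 / (2 * Re z ^ 3)) * Re h + (2 * Im z * k - 1 / (2 * Im z ^ 3)) * Im h)) (at z)"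
proof -
  have xy: "Re z > 0" "Im z > 0" "cmod z < 1" using z by (auto simp: quarter_disc_def)
  then have c4: "cmod z ^ 4 < 1" by (simp add: power_less_one_iff)
  have eq: "cmod z ^ 4 = ((Re z)\<^sup>2 + (Im z)\<^sup>2)\<^sup>2" for z
    by (simp flip: cmod_power2 power_mult)
  define q where "q = (Re z)\<^sup>2 + (Im z)\<^sup>2"
  have q: "1 - q\<^sup>2 \<noteq> 0" using c4 by (simp add: eq q_def)
  have dq: "((\<lambda>z. (Re z)\<^sup>2 + (Im z)\<^sup>2) has_derivative (\<lambda>h. 2 * Re z * Re h + 2 * Im z * Im h)) (at z)"
    by (auto intro!: derivative_eq_intros)
  have "((\<lambda>q::real. 4 * q / (1 - q\<^sup>2)\<^sup>2) has_field_derivative 4 * (1 + 3 * q\<^sup>2) / (1 - q\<^sup>2) ^ 3) (at q)"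
  proof -
    define r where "r = 1 - q\<^sup>2"
    have "((\<lambda>q::real. 4 * q / (1 - q\<^sup>2)\<^sup>2) has_field_derivative
        (4 * r\<^sup>2 + 16 * q\<^sup>2 * r) / (r\<^sup>2 * r\<^sup>2)) (at q)"
      unfolding r_def using q
      by (auto intro!: derivative_eq_intros simp: power2_eq_square)
    also have "(4 * r\<^sup>2 + 16 * q\<^sup>2 * r) / (r\<^sup>2 * r\<^sup>2) = (4 * r + 16 * q\<^sup>2) / r ^ 3"
      using q by (simp add: r_def[symmetric] divide_simps) (simp add: power2_eq_square power3_eq_cube power4_eq_xxxx algebra_simps)
    also have "4 * r + 16 * q\<^sup>2 = 4 * (1 + 3 * q\<^sup>2)" by (simp add: r_def)
    finally show ?thesis by (simp add: r_def)
  qed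
  then have "((\<lambda>q::real. 4 * q / (1 - q\<^sup>2)\<^sup>2) has_derivative (\<lambda>h. k * h)) (at q)"
    by (simp only: k_def has_field_derivative_def eq q_def)
  from has_derivative_compose[OF dq this[unfolded q_def]]
  have 1: "((\<lambda>z. 4 * ((Re z)\<^sup>2 + (Im z)\<^sup>2) / (1 - ((Re z)\<^sup>2 + (Im z)\<^sup>2)\<^sup>2)\<^sup>2) has_derivative
      (\<lambda>h. k * (2 * Re z * Re h + 2 * Im z * Im h))) (at z)" .
  have p0: "((\<lambda>t::real. 1 / t\<^sup>2) has_field_derivative - 2 / t ^ 3) (at t)" if "t \<noteq> 0" for t
    using that by (auto intro!: derivative_eq_intros simp: divide_simps power2_eq_square power3_eq_cube)
  have p: "((\<lambda>t::real. 1 / t\<^sup>2) has_derivative (\<lambda>h. - 2 / t ^ 3 * h)) (at t)" if "t \<noteq> 0" for t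
    using p0[OF that] by (simp only: has_field_derivative_def)
  have 2: "((\<lambda>z. 1 / (Re z)\<^sup>2) has_derivative (\<lambda>h. - 2 / (Re z) ^ 3 * Re h)) (at z)"
    by (rule has_derivative_compose[OF bounded_linear_imp_has_derivative[OF bounded_linear_Re] p]) (use xy in simp)
  have 3: "((\<lambda>z. 1 / (Im z)\<^sup>2) has_derivative (\<lambda>h. - 2 / (Im z) ^ 3 * Im h)) (at z)"
    by (rule has_derivative_compose[OF bounded_linear_imp_has_derivative[OF bounded_linear_Im] p]) (use xy in simp)
  have "robin_density = (\<lambda>z. 1 / 4 * (1 / (Re z)\<^sup>2 + 1 / (Im z)\<^sup>2)
      + 4 * ((Re z)\<^sup>2 + (Im z)\<^sup>2) / (1 - ((Re z)\<^sup>2 + (Im z)\<^sup>2)\<^sup>2)\<^sup>2)"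
    by (simp add: fun_eq_iff robin_density_def eq cmod_power2)
  moreover have "(\<dots> has_derivative (\<lambda>h. 1 / 4 * (- 2 / (Re z) ^ 3 * Re h + - 2 / (Im z) ^ 3 * Im h)
      + k * (2 * Re z * Re h + 2 * Im z * Im h))) (at z)"
    by (intro has_derivative_add has_derivative_mult_right 1 2 3)
  moreover have "(\<lambda>h. 1 / 4 * (- 2 / (Re z) ^ 3 * Re h + - 2 / (Im z) ^ 3 * Im h)
      + k * (2 * Re z * Re h + 2 * Im z * Im h)) =
      (\<lambda>h. (2 * Re z * k - 1 / (2 * Re z ^ 3)) * Re h + (2 * Im z * k - 1 / (2 * Im z ^ 3)) * Im h)"
    by (simp add: fun_eq_iff algebra_simps)
  ultimately show ?thesis by simp
qed

text \<open>The logarithm multiplies the gradient of \<open>robin_density\<close> by a positive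
  number, so the zeros are the same. Clearing the cubes in the denominators leaves two equations
  with the same \<open>k\<close>, which later forces equal coordinates.\<close>

lemma robin_quarter_disc_critical_iff:
  assumes z: "z \<in> quarter_disc"
  defines "k \<equiv> 4 * (1 + 3 * cmod z ^ 4) / (1 - cmod z ^ 4) ^ 3"
  shows "(robin quarter_disc has_derivative (\<lambda>h. 0)) (at z) \<longleftrightarrow>
           4 * Re z ^ 4 * k = 1 \<and> 4 * Im z ^ 4 * k = 1"
proof -
  define A where "A = 2 * Re z * k - 1 / (2 * Re z ^ 3)"
  define B where "B = 2 * Im z * k - 1 / (2 * Im z ^ 3)"
  have xy: "Re z > 0" "Im z > 0" using z by (auto simp: quarter_disc_def)
  note pos = robin_quarter_disc(1)[OF z]
  have "(robin_density has_derivative (\<lambda>h. A * Re h + B * Im h)) (at z)"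
    using robin_density_has_derivative[OF z] by (simp add: A_def B_def k_def)
  then have "((\<lambda>z. ln (robin_density z) / 2) has_derivative
      (\<lambda>h. (A * Re h + B * Im h) / (2 * robin_density z))) (at z)"
    using pos by (auto intro!: derivative_eq_intros simp: field_simps)
  then have d: "(robin quarter_disc has_derivative
      (\<lambda>h. (A * Re h + B * Im h) / (2 * robin_density z))) (at z)"
    by (rule has_derivative_transform_within_open[OF _ open_quarter_disc z])
       (simp add: robin_quarter_disc(2))
  have "(robin quarter_disc has_derivative (\<lambda>h. 0)) (at z) \<longleftrightarrow>
      (\<lambda>h. (A * Re h + B * Im h) / (2 * robin_density z)) = (\<lambda>h. 0)"
    using d has_derivative_unique by metis
  also have "\<dots> \<longleftrightarrow> A = 0 \<and> B = 0"
  proof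
    assume *: "(\<lambda>h. (A * Re h + B * Im h) / (2 * robin_density z)) = (\<lambda>h. 0)"
    show "A = 0 \<and> B = 0" using fun_cong[OF *, of 1] fun_cong[OF *, of \<i>] pos by simp
  qed simp
  also have "\<dots> \<longleftrightarrow> 4 * Re z ^ 4 * k = 1 \<and> 4 * Im z ^ 4 * k = 1"
    using xy by (simp add: A_def B_def field_simps power4_eq_xxxx power3_eq_cube)
  finally show ?thesis .
qed

text \<open>Since \<open>4 + sqrt 17\<close> and \<open>sqrt 17 - 4\<close> are inverse to each
  other, the fourth power of the radical in \<open>\<xi>\<^sub>0\<close> is
  \<open>sqrt 17 - 4\<close>. The number \<open>4 * s ^ 4\<close> is the fourth power of the
  modulus, the unknown p of the critical point equation.\<close>

lemma \<xi>\<^sub>0_coords: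
  obtains s where "\<xi>\<^sub>0 = Complex s s" "s > 0" "4 * s ^ 4 = sqrt 17 - 4"
proof
  define s where "s = 1 / sqrt 2 * (4 + sqrt 17) powr (- 1 / 4)"
  show "\<xi>\<^sub>0 = Complex s s" by (simp add: \<xi>\<^sub>0_def s_def complex_eq_iff)
  have p: "4 + sqrt 17 > 0" by (simp add: add_pos_pos)
  show "s > 0" using p by (simp add: s_def)
  have "((4 + sqrt 17) powr (- 1 / 4)) ^ 4 = (4 + sqrt 17) powr (- 1)"
    using p by (simp flip: powr_realpow add: powr_powr)
  also have "\<dots> = sqrt 17 - 4"
    using p by (simp add: powr_minus_divide field_simps)
  finally have "((4 + sqrt 17) powr (- 1 / 4)) ^ 4 = sqrt 17 - 4" .
  moreover have "(1 / sqrt 2) ^ 4 = 1 / (4::real)"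
    by (simp add: power_divide power4_eq_xxxx)
  ultimately show "4 * s ^ 4 = sqrt 17 - 4"
    unfolding s_def power_mult_distrib by simp
qed

text \<open>For p = sqrt 17 - 4 these are the bounds 3/25 and 1/8. The lower one exceeds 1/11, so
  that 22 p - 2 is positive; the upper one keeps 22 p - 2 below 1.\<close>

lemma sqrt17_bounds: "sqrt 17 > 4.12" "sqrt 17 < 4.125"
  by (rule real_less_rsqrt; simp add: power2_eq_square) (rule real_less_lsqrt; simp add: power2_eq_square)

lemma cmod_diagonal_power4: "cmod (Complex s s) ^ 4 = 4 * s ^ 4"
proof -
  have "cmod (Complex s s) ^ 4 = ((cmod (Complex s s))\<^sup>2)\<^sup>2" by simp
  then show ?thesis unfolding cmod_power2 by (simp add: power_mult_distrib flip: power_mult)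
qed

lemma \<xi>\<^sub>0_in_quarter_disc: "\<xi>\<^sub>0 \<in> quarter_disc"
proof -
  obtain s where s: "\<xi>\<^sub>0 = Complex s s" "s > 0" "4 * s ^ 4 = sqrt 17 - 4" by (rule \<xi>\<^sub>0_coords)
  have "cmod \<xi>\<^sub>0 ^ 4 < 1 ^ 4" unfolding s(1) cmod_diagonal_power4 using s sqrt17_bounds by simp
  then have "cmod \<xi>\<^sub>0 < 1" by (rule power_less_imp_less_base) simp
  then show ?thesis unfolding s(1) quarter_disc_def using s(2) by simp
qed

lemma robin_quarter_disc_critical_points:
  "{z \<in> quarter_disc. (robin quarter_disc has_derivative (\<lambda>h. 0)) (at z)} = {\<xi>\<^sub>0}"
proof -
  obtain s where s: "\<xi>\<^sub>0 = Complex s s" "s > 0" "4 * s ^ 4 = sqrt 17 - 4" by (rule \<xi>\<^sub>0_coords)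
  have "4 * Re z ^ 4 * (4 * (1 + 3 * cmod z ^ 4) / (1 - cmod z ^ 4) ^ 3) = 1 \<and>
        4 * Im z ^ 4 * (4 * (1 + 3 * cmod z ^ 4) / (1 - cmod z ^ 4) ^ 3) = 1 \<longleftrightarrow> z = \<xi>\<^sub>0"
    (is "?P \<longleftrightarrow> _") if z: "z \<in> quarter_disc" for z
  proof
    define p where "p = cmod z ^ 4"
    define k where "k = 4 * (1 + 3 * p) / (1 - p) ^ 3"
    have xy: "Re z > 0" "Im z > 0" "cmod z < 1" using z by (auto simp: quarter_disc_def)
    then have p: "0 \<le> p" "p < 1" by (simp_all add: p_def power_less_one_iff)
    assume ?P
    then have 1: "4 * Re z ^ 4 * k = 1" "4 * Im z ^ 4 * k = 1" unfolding p_def k_def by blast+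
    have "k > 0" using p by (simp add: k_def)
    then have "Re z ^ 4 = Im z ^ 4" using 1 by (metis mult_cancel_right mult_cancel_left less_irrefl zero_neq_numeral)
    then have "Re z = Im z" using xy by (metis power_eq_imp_eq_base less_imp_le zero_less_numeral)
    then have zz: "z = Complex (Re z) (Re z)" by (simp add: complex_eq_iff)
    have pp: "p = 4 * Re z ^ 4" unfolding p_def by (subst zz) (rule cmod_diagonal_power4)
    then have "p * k = 1" using 1 by simp
    then have "p * (4 * (1 + 3 * p)) = (1 - p) ^ 3" using p by (simp add: k_def field_simps)
    then have "(p + 1) * ((p + 4)\<^sup>2 - 17) = 0"
      by (simp add: power2_eq_square power3_eq_cube algebra_simps)
    then have "(p + 4)\<^sup>2 = 17" using p by simp
    then have "p + 4 = sqrt 17" using p by (metis real_sqrt_unique add_nonneg_nonneg zero_le_numeral)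
    then have "Re z ^ 4 = s ^ 4" using pp s by simp
    then have "Re z = s" using xy s by (metis power_eq_imp_eq_base less_imp_le zero_less_numeral)
    then show "z = \<xi>\<^sub>0" using zz s by simp
  next
    assume z: "z = \<xi>\<^sub>0"
    define p where "p = sqrt 17 - 4"
    have p: "p < 1" "(p + 4)\<^sup>2 = 17" using sqrt17_bounds by (simp_all add: p_def)
    have cz: "cmod z ^ 4 = p" unfolding z s(1) cmod_diagonal_power4 using s(3) by (simp add: p_def)
    have "(1 - p) ^ 3 - p * (4 * (1 + 3 * p)) = - ((p + 1) * ((p + 4)\<^sup>2 - 17))"
      by (simp add: power2_eq_square power3_eq_cube algebra_simps)
    then have "p * (4 * (1 + 3 * p)) = (1 - p) ^ 3" using p by simp
    then have "p * (4 * (1 + 3 * p) / (1 - p) ^ 3) = 1" using p by simp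
    moreover have e: "4 * Re z ^ 4 = p" "4 * Im z ^ 4 = p" unfolding z s(1) p_def using s(3) by simp_all
    ultimately show ?P unfolding cz e by blast
  qed
  then show ?thesis using robin_quarter_disc_critical_iff \<xi>\<^sub>0_in_quarter_disc by auto
qed

section \<open>Conformal maps onto the quarter disc\<close>

text \<open>The Schwarz lemma for \<open>f\<close> and for its inverse gives
  \<open>cmod (f z) = cmod z\<close> throughout, and the case of equality makes \<open>f\<close> a
  rotation.\<close>

lemma Schwarz_automorphism:
  assumes f: "conformal_bijection f (ball 0 1) (ball 0 1)" and f0: "f 0 = 0"
  obtains c where "cmod c = 1" "\<And>z. z \<in> ball 0 1 \<Longrightarrow> f z = c * z"
proof -
  have hol: "f holomorphic_on ball 0 1" and inj: "inj_on f (ball 0 1)" and im: "f ` ball 0 1 = ball 0 1"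
    using f by (auto simp: conformal_bijection_def bij_betw_def)
  obtain g where g: "g holomorphic_on ball 0 1" and gf: "\<And>z. z \<in> ball 0 1 \<Longrightarrow> g (f z) = z"
    using holomorphic_has_inverse[OF hol open_ball inj] im by metis
  have fb: "cmod (f z) < 1" if "cmod z < 1" for z
    using im that by (metis image_eqI mem_ball_0)
  have gb: "cmod (g z) < 1" if "cmod z < 1" for z
    using im that gf by (metis imageE mem_ball_0)
  have g0: "g 0 = 0" using gf[of 0] f0 by simp
  have le: "cmod (f z) = cmod z" if z: "cmod z < 1" for z
    using Schwarz_Lemma(1)[OF hol f0 fb z] Schwarz_Lemma(1)[OF g g0 gb fb[OF z]] gf[of z] z by simp
  have "\<exists>\<xi>. cmod \<xi> < 1 \<and> \<xi> \<noteq> 0 \<and> cmod (f \<xi>) = cmod \<xi>"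
    by (rule exI[of _ "1/2"]) (use le[of "1/2"] in auto)
  then obtain c where "\<And>z. cmod z < 1 \<Longrightarrow> f z = c * z" "cmod c = 1"
    using Schwarz_Lemma(3)[OF hol f0 fb, of 0] by auto
  then show thesis using that by auto
qed

text \<open>The inverse of \<open>quarter_to_disc h\<close> has the required value at 0 when
  \<open>h\<close> is the image of \<open>\<xi>\<^sub>0\<close> in the half plane.\<close>

lemma quarter_disc_conformal_bijection_exists:
  "\<exists>F. conformal_bijection F (ball 0 1) quarter_disc \<and> F 0 = \<xi>\<^sub>0"
proof -
  define h where "h = quarter_to_plane \<xi>\<^sub>0"
  have h: "Im h > 0"
    using bij_betw_quarter_to_plane \<xi>\<^sub>0_in_quarter_disc by (auto simp: h_def bij_betw_def)
  let ?f = "quarter_to_disc h"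
  have hol: "?f holomorphic_on quarter_disc" and inj: "inj_on ?f quarter_disc"
    and im: "?f ` quarter_disc = ball 0 1"
    using conformal_bijection_quarter_to_disc[OF h] by (auto simp: conformal_bijection_def bij_betw_def)
  obtain g where g: "g holomorphic_on ball 0 1" and gf: "\<And>z. z \<in> quarter_disc \<Longrightarrow> g (?f z) = z"
    using holomorphic_has_inverse[OF hol open_quarter_disc inj] im by metis
  have "?f \<xi>\<^sub>0 = 0" by (simp add: quarter_to_disc_def h_def)
  then have "g 0 = \<xi>\<^sub>0" using gf[OF \<xi>\<^sub>0_in_quarter_disc] by simp
  moreover have "bij_betw g (ball 0 1) quarter_disc"
  proof (rule bij_betw_byWitness[where f' = "?f"])
    have "?f (g w) = w \<and> g w \<in> quarter_disc" if "w \<in> ball 0 1" for w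
    proof -
      from that im obtain x where "x \<in> quarter_disc" "w = ?f x" by blast
      then show ?thesis using gf by simp
    qed
    then show "\<forall>w\<in>ball 0 1. ?f (g w) = w" "g ` ball 0 1 \<subseteq> quarter_disc" by blast+
  qed (use im gf in auto)
  ultimately show ?thesis using g by (auto simp: conformal_bijection_def)
qed

text \<open>The composite of \<open>F\<close> with \<open>quarter_to_disc h\<close> is a rotation by
  \<open>c\<close>, so \<open>quarter_to_plane (F z)\<close> is an explicit Moebius function of
  \<open>z\<close>. Differentiating both sides and dividing by the derivative of
  \<open>quarter_to_plane\<close> gives a first order differential equation for \<open>F\<close>,
  from which all higher derivatives can be read off.\<close>

lemma quarter_disc_conformal_bijection_deriv:
  assumes F: "conformal_bijection F (ball 0 1) quarter_disc" and F0: "F 0 = \<xi>\<^sub>0"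
  defines "h \<equiv> quarter_to_plane \<xi>\<^sub>0"
  obtains c where "cmod c = 1" and
    "\<And>z. z \<in> ball 0 1 \<Longrightarrow> (F has_field_derivative
       (h - cnj h) * c / (1 - c * z)\<^sup>2 * ((1 - (F z)\<^sup>2) ^ 3 / (8 * F z * (1 + (F z)\<^sup>2)))) (at z)"
proof -
  have h: "Im h > 0"
    using bij_betw_quarter_to_plane \<xi>\<^sub>0_in_quarter_disc by (auto simp: h_def bij_betw_def)
  let ?f = "quarter_to_disc h"
  note cf = conformal_bijection_quarter_to_disc[OF h]
  have holF: "F holomorphic_on ball 0 1" and FQ: "\<And>z. z \<in> ball 0 1 \<Longrightarrow> F z \<in> quarter_disc"
    using F by (auto simp: conformal_bijection_def bij_betw_def)
  have "conformal_bijection (?f \<circ> F) (ball 0 1) (ball 0 1)"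
    using cf F unfolding conformal_bijection_def
    by (metis bij_betw_trans bij_betw_imp_surj_on holomorphic_on_compose_gen order_refl)
  moreover have "(?f \<circ> F) 0 = 0" by (simp add: F0 quarter_to_disc_def h_def)
  ultimately obtain c where c: "cmod c = 1" "\<And>z. z \<in> ball 0 1 \<Longrightarrow> (?f \<circ> F) z = c * z"
    by (rule Schwarz_automorphism) blast
  show thesis
  proof (rule that[OF c(1)])
    fix z :: complex assume z: "z \<in> ball 0 1"
    have pos: "Im (quarter_to_plane (F z)) > 0" if "z \<in> ball 0 1" for z
      using bij_betw_quarter_to_plane FQ[OF that] by (auto simp: bij_betw_def)
    have ne: "1 - c * z \<noteq> 0" if "z \<in> ball 0 1" for z
    proof -
      have "cmod (c * z) < 1" using that c(1) by (simp add: norm_mult)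
      then show ?thesis by auto
    qed
    have Feq: "quarter_to_plane (F z) = h + (h - cnj h) * (c * z) / (1 - c * z)" if z: "z \<in> ball 0 1" for z
    proof -
      let ?u = "quarter_to_plane (F z)"
      have "?u - cnj h \<noteq> 0" using pos[OF z] h by (auto simp: complex_eq_iff)
      moreover have "(?u - h) / (?u - cnj h) = c * z" using c(2)[OF z] by (simp add: quarter_to_disc_def)
      ultimately have "?u - h = c * z * (?u - cnj h)" by (simp add: field_simps)
      then show ?thesis using ne[OF z] by (simp add: field_simps)
    qed
    have dF: "(F has_field_derivative deriv F z) (at z)"
      using holF z by (simp add: holomorphic_derivI)
    let ?d = "8 * F z * (1 + (F z)\<^sup>2) / (1 - (F z)\<^sup>2) ^ 3"
    have d1: "((\<lambda>z. quarter_to_plane (F z)) has_field_derivative ?d * deriv F z) (at z)"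
      by (rule DERIV_chain2[OF quarter_to_plane_deriv dF]) (use quarter_disc_nonzero(2)[OF FQ[OF z]] in simp)
    have "((\<lambda>z. h + (h - cnj h) * (c * z) / (1 - c * z)) has_field_derivative (h - cnj h) * c / (1 - c * z)\<^sup>2) (at z)"
    proof -
      have "((\<lambda>z. h + (h - cnj h) * (c * z) / (1 - c * z)) has_field_derivative
          ((h - cnj h) * c * (1 - c * z) + (h - cnj h) * (c * z) * c) / ((1 - c * z) * (1 - c * z))) (at z)"
        using ne[OF z] by (auto intro!: derivative_eq_intros)
      also have "(h - cnj h) * c * (1 - c * z) + (h - cnj h) * (c * z) * c = (h - cnj h) * c"
        by (simp add: algebra_simps)
      finally show ?thesis by (simp add: power2_eq_square)
    qed
    then have "((\<lambda>z. quarter_to_plane (F z)) has_field_derivative (h - cnj h) * c / (1 - c * z)\<^sup>2) (at z)"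
      by (rule has_field_derivative_transform_within_open[OF _ open_ball z]) (simp add: Feq)
    with d1 have "?d * deriv F z = (h - cnj h) * c / (1 - c * z)\<^sup>2" by (rule DERIV_unique)
    then have "deriv F z = (h - cnj h) * c / (1 - c * z)\<^sup>2 * ((1 - (F z)\<^sup>2) ^ 3 / (8 * F z * (1 + (F z)\<^sup>2)))"
    proof -
      have *: "x = k * (m / n)" if "n / m * x = k" "n \<noteq> 0" "m \<noteq> 0" for x k m n :: complex
        using that by (auto simp: field_simps)
      show ?thesis if "?d * deriv F z = (h - cnj h) * c / (1 - c * z)\<^sup>2"
        by (rule *[OF that]) (use quarter_disc_nonzero[OF FQ[OF z]] in simp_all)
    qed
    then show "(F has_field_derivative (h - cnj h) * c / (1 - c * z)\<^sup>2 *
        ((1 - (F z)\<^sup>2) ^ 3 / (8 * F z * (1 + (F z)\<^sup>2)))) (at z)"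
      using dF by simp
  qed
qed

text \<open>Here \<open>P\<close> is the pre-Schwarzian of \<^const>\<open>quarter_to_plane\<close>, and \<open>2 * c / (1 - c * z)\<close> that of the
  Moebius map \<open>z \<mapsto> quarter_to_plane (F z)\<close>.\<close>

lemma quarter_disc_conformal_bijection_deriv3:
  assumes F: "conformal_bijection F (ball 0 1) quarter_disc" and F0: "F 0 = \<xi>\<^sub>0"
  defines "h \<equiv> quarter_to_plane \<xi>\<^sub>0"
  defines "P \<equiv> \<lambda>z. 1 / z + 2 * z / (1 + z\<^sup>2) + 6 * z / (1 - z\<^sup>2)"
  obtains c where "cmod c = 1" and
    "deriv F 0 = (h - cnj h) * c * ((1 - \<xi>\<^sub>0\<^sup>2) ^ 3 / (8 * \<xi>\<^sub>0 * (1 + \<xi>\<^sub>0\<^sup>2)))"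
    "(deriv ^^ 3) F 0 = deriv F 0 * ((2 * c - P \<xi>\<^sub>0 * deriv F 0)\<^sup>2
        + (2 * c\<^sup>2 - deriv P \<xi>\<^sub>0 * (deriv F 0)\<^sup>2 - P \<xi>\<^sub>0 * (deriv F 0 * (2 * c - P \<xi>\<^sub>0 * deriv F 0))))"
proof -
  obtain c where c: "cmod c = 1" and
    dF: "\<And>z. z \<in> ball 0 1 \<Longrightarrow> (F has_field_derivative
       (h - cnj h) * c / (1 - c * z)\<^sup>2 * ((1 - (F z)\<^sup>2) ^ 3 / (8 * F z * (1 + (F z)\<^sup>2)))) (at z)"
    using quarter_disc_conformal_bijection_deriv[OF F F0] unfolding h_def by blast
  define F1 where "F1 z = (h - cnj h) * c / (1 - c * z)\<^sup>2 * ((1 - (F z)\<^sup>2) ^ 3 / (8 * F z * (1 + (F z)\<^sup>2)))" for z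
  \<comment> \<open>This is the second derivative of \<open>F\<close>, found by logarithmic
    differentiation of \<open>F1\<close>: the factor with \<open>c\<close> contributes its
    pre-Schwarzian, the factor in \<open>F z\<close> contributes \<open>- P (F z)\<close> times the
    derivative of \<open>F\<close>.\<close>
  define F2 where "F2 z = F1 z * (2 * c / (1 - c * z) - P (F z) * F1 z)" for z
  have FQ: "F z \<in> quarter_disc" if "z \<in> ball 0 1" for z
    using F that by (auto simp: conformal_bijection_def bij_betw_def)
  have ne: "1 - c * z \<noteq> 0" if "z \<in> ball 0 1" for z
  proof -
    have "cmod (c * z) < 1" using that c(1) by (simp add: norm_mult)
    then show ?thesis by auto
  qed
  have dF1: "(F has_field_derivative F1 z) (at z)" if "z \<in> ball 0 1" for z
    using dF[OF that] by (simp add: F1_def)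
  have dF2: "(F1 has_field_derivative F2 z) (at z)" if z: "z \<in> ball 0 1" for z
  proof -
    note nz = quarter_disc_nonzero[OF FQ[OF z]]
    have q: "((\<lambda>x. (1 - x\<^sup>2) ^ 3 / (8 * x * (1 + x\<^sup>2))) has_field_derivative
        - P x * ((1 - x\<^sup>2) ^ 3 / (8 * x * (1 + x\<^sup>2)))) (at x)"
      if "x \<noteq> 0" "1 - x\<^sup>2 \<noteq> 0" "1 + x\<^sup>2 \<noteq> 0" for x
    proof -
      have "((\<lambda>x. (1 - x\<^sup>2) ^ 3 / (8 * x * (1 + x\<^sup>2))) has_field_derivative
         (- 6 * x * (1 - x\<^sup>2)\<^sup>2 * (8 * x * (1 + x\<^sup>2)) - (1 - x\<^sup>2) ^ 3 * (8 * (1 + x\<^sup>2) + 16 * x\<^sup>2))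
            / ((8 * x * (1 + x\<^sup>2)) * (8 * x * (1 + x\<^sup>2)))) (at x)"
        using that by (auto intro!: derivative_eq_intros simp: power2_eq_square)
      also have "(- 6 * x * (1 - x\<^sup>2)\<^sup>2 * (8 * x * (1 + x\<^sup>2)) - (1 - x\<^sup>2) ^ 3 * (8 * (1 + x\<^sup>2) + 16 * x\<^sup>2))
            / ((8 * x * (1 + x\<^sup>2)) * (8 * x * (1 + x\<^sup>2))) = - P x * ((1 - x\<^sup>2) ^ 3 / (8 * x * (1 + x\<^sup>2)))"
      proof -
        define a where "a = 1 - x\<^sup>2"
        define b where "b = 1 + x\<^sup>2"
        have "a \<noteq> 0" "b \<noteq> 0" using that by (auto simp: a_def b_def)
        then show ?thesis unfolding P_def a_def[symmetric] b_def[symmetric] using that(1)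
          by (simp add: divide_simps) (simp add: power2_eq_square power3_eq_cube algebra_simps)
      qed
      finally show ?thesis .
    qed
    note d1 = DERIV_chain2[OF q[OF nz] dF1[OF z]]
    have d2: "((\<lambda>z. (h - cnj h) * c / (1 - c * z)\<^sup>2) has_field_derivative
        (h - cnj h) * c / (1 - c * z)\<^sup>2 * (2 * c / (1 - c * z))) (at z)"
      using ne[OF z] by (auto intro!: derivative_eq_intros simp: divide_simps power2_eq_square)
    define a where "a = (h - cnj h) * c / (1 - c * z)\<^sup>2"
    define b where "b = (1 - (F z)\<^sup>2) ^ 3 / (8 * F z * (1 + (F z)\<^sup>2))"
    have F1z: "F1 z = a * b" by (simp only: F1_def a_def b_def)
    have "(F1 has_field_derivative a * (2 * c / (1 - c * z)) * b + - P (F z) * b * F1 z * a) (at z)"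
      using DERIV_mult[OF d2 d1] by (simp only: F1_def[abs_def] a_def b_def)
    also have "a * (2 * c / (1 - c * z)) * b + - P (F z) * b * F1 z * a = F2 z"
      unfolding F2_def F1z by (simp add: right_diff_distrib mult_ac)
    finally show ?thesis .
  qed
  have dP: "(P has_field_derivative deriv P \<xi>\<^sub>0) (at \<xi>\<^sub>0)"
  proof -
    have "P field_differentiable at \<xi>\<^sub>0"
      unfolding P_def using quarter_disc_nonzero[OF \<xi>\<^sub>0_in_quarter_disc]
      by (intro derivative_intros) auto
    then show ?thesis by (simp add: DERIV_deriv_iff_field_differentiable)
  qed
  have z0: "(0::complex) \<in> ball 0 1" by simp
  have "(F2 has_field_derivative
      F2 0 * (2 * c / (1 - c * 0) - P (F 0) * F1 0)
       + F1 0 * (2 * c\<^sup>2 - (deriv P \<xi>\<^sub>0 * F1 0 * F1 0 + P \<xi>\<^sub>0 * F2 0))) (at 0)"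
  proof -
    note a = DERIV_chain2[OF dP[folded F0] dF1[OF z0]]
    note b = DERIV_mult[OF a dF2[OF z0]]
    have d: "((\<lambda>z. 2 * c / (1 - c * z)) has_field_derivative 2 * c\<^sup>2) (at 0)"
      by (auto intro!: derivative_eq_intros simp: power2_eq_square)
    show ?thesis unfolding F2_def[abs_def]
      by (rule DERIV_cong[OF DERIV_mult[OF dF2[OF z0] DERIV_diff[OF d b]]])
        (simp add: F2_def F0 algebra_simps)
  qed
  then have D3: "deriv F2 0 = F2 0 * (2 * c - P \<xi>\<^sub>0 * F1 0)
       + F1 0 * (2 * c\<^sup>2 - (deriv P \<xi>\<^sub>0 * F1 0 * F1 0 + P \<xi>\<^sub>0 * F2 0))"
    by (simp add: DERIV_imp_deriv F0)
  have e1: "deriv F z = F1 z" if "z \<in> ball 0 1" for z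
    using dF1[OF that] by (rule DERIV_imp_deriv)
  \<comment> \<open>The iterated \<open>deriv\<close> at 0 depends on the lower derivatives near 0,
    so the formulas \<open>F1\<close> and \<open>F2\<close> have to hold on the whole disc.\<close>
  have "(deriv F has_field_derivative F2 z) (at z)" if "z \<in> ball 0 1" for z
    using dF2[OF that] by (rule has_field_derivative_transform_within_open[OF _ open_ball that]) (simp add: e1)
  then have e2: "deriv (deriv F) z = F2 z" if "z \<in> ball 0 1" for z
    using that by (simp add: DERIV_imp_deriv)
  have "deriv (deriv (deriv F)) 0 = deriv F2 0"
    by (rule deriv_cong_ev) (auto intro!: eventually_nhds_in_open[THEN eventually_mono, OF open_ball z0] e2)
  then have "(deriv ^^ 3) F 0 = deriv F2 0" by (simp add: eval_nat_numeral)
  moreover have "F1 0 = deriv F 0" using e1[OF z0] by simp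
  ultimately have "(deriv ^^ 3) F 0 = deriv F 0 * ((2 * c - P \<xi>\<^sub>0 * deriv F 0)\<^sup>2
        + (2 * c\<^sup>2 - deriv P \<xi>\<^sub>0 * (deriv F 0)\<^sup>2 - P \<xi>\<^sub>0 * (deriv F 0 * (2 * c - P \<xi>\<^sub>0 * deriv F 0))))"
    unfolding D3 by (simp add: F2_def F0 power2_eq_square algebra_simps)
  moreover have "deriv F 0 = (h - cnj h) * c * ((1 - \<xi>\<^sub>0\<^sup>2) ^ 3 / (8 * \<xi>\<^sub>0 * (1 + \<xi>\<^sub>0\<^sup>2)))"
    unfolding e1[OF z0] F1_def by (simp add: F0)
  ultimately show thesis using that c by blast
qed

text \<open>Since \<open>\<xi>\<^sub>0\<close> lies on the diagonal, its square \<open>w\<close> is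
  purely imaginary: conjugation is a change of sign and w^2 = -p. The equation p^2 = 1 - 8 p becomes
  w^4 = 1 + 8 w^2, and every quantity reduces to a rational function of \<open>w\<close> modulo this
  relation.\<close>

lemma quarter_disc_conformal_bijection_deriv3_ratio:
  assumes F: "conformal_bijection F (ball 0 1) quarter_disc" and F0: "F 0 = \<xi>\<^sub>0"
  defines "p \<equiv> sqrt 17 - 4"
  shows "cmod ((deriv ^^ 3) F 0 / deriv F 0) = 3 / 2 * (22 * p - 2) * (1 - p)\<^sup>2 / (1 + p) ^ 4"
proof -
  obtain s where s: "\<xi>\<^sub>0 = Complex s s" "s > 0" "4 * s ^ 4 = sqrt 17 - 4" by (rule \<xi>\<^sub>0_coords)
  define w where "w = \<xi>\<^sub>0\<^sup>2"
  define P where "P = (\<lambda>z::complex. 1 / z + 2 * z / (1 + z\<^sup>2) + 6 * z / (1 - z\<^sup>2))"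
  obtain c where c: "cmod c = 1" and
    F1: "deriv F 0 = (quarter_to_plane \<xi>\<^sub>0 - cnj (quarter_to_plane \<xi>\<^sub>0)) * c * ((1 - \<xi>\<^sub>0\<^sup>2) ^ 3 / (8 * \<xi>\<^sub>0 * (1 + \<xi>\<^sub>0\<^sup>2)))" and
    F3: "(deriv ^^ 3) F 0 = deriv F 0 * ((2 * c - P \<xi>\<^sub>0 * deriv F 0)\<^sup>2
        + (2 * c\<^sup>2 - deriv P \<xi>\<^sub>0 * (deriv F 0)\<^sup>2 - P \<xi>\<^sub>0 * (deriv F 0 * (2 * c - P \<xi>\<^sub>0 * deriv F 0))))"
    using quarter_disc_conformal_bijection_deriv3[OF F F0] unfolding P_def by blast
  have p: "3 / 25 < p" "p < 1 / 8" "p\<^sup>2 = 1 - 8 * p"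
    using sqrt17_bounds by (simp_all add: p_def power2_eq_square algebra_simps)
  have nz: "\<xi>\<^sub>0 \<noteq> 0" "1 - w \<noteq> 0" "1 + w \<noteq> 0"
    using quarter_disc_nonzero[OF \<xi>\<^sub>0_in_quarter_disc] by (simp_all add: w_def)
  have wi: "w = \<i> * of_real (2 * s\<^sup>2)"
    unfolding w_def s(1) by (simp add: complex_eq_iff power2_eq_square)
  have cw: "cnj w = - w" by (simp add: wi)
  have w2: "w\<^sup>2 = - of_real p"
  proof -
    have "w\<^sup>2 = - of_real ((2 * s\<^sup>2)\<^sup>2)" unfolding wi power_mult_distrib by simp
    also have "(2 * s\<^sup>2)\<^sup>2 = p" using s(3) by (simp add: p_def power_mult_distrib flip: power_mult)
    finally show ?thesis .
  qed
  have w4: "w ^ 4 = 1 + 8 * w\<^sup>2"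
  proof -
    have "w ^ 4 = (w\<^sup>2)\<^sup>2" by simp
    also have "\<dots> = of_real (p\<^sup>2)" unfolding w2 by simp
    finally show ?thesis unfolding p(3) w2 by simp
  qed
  define a where "a = 1 + w"
  define b where "b = 1 - w"
  have ab: "a \<noteq> 0" "b \<noteq> 0" using nz by (simp_all add: a_def b_def)
  have K: "quarter_to_plane \<xi>\<^sub>0 - cnj (quarter_to_plane \<xi>\<^sub>0) = 8 * w * (1 + w\<^sup>2) / (a\<^sup>2 * b\<^sup>2)"
  proof -
    have "quarter_to_plane \<xi>\<^sub>0 = (a / b)\<^sup>2" by (simp add: quarter_to_plane_def w_def a_def b_def)
    moreover have "cnj (quarter_to_plane \<xi>\<^sub>0) = (b / a)\<^sup>2"
      by (simp add: quarter_to_plane_def cw a_def b_def flip: w_def)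
    moreover have "(a / b)\<^sup>2 - (b / a)\<^sup>2 = (a ^ 4 - b ^ 4) / (a\<^sup>2 * b\<^sup>2)"
      using ab by (simp add: divide_simps power_divide)
    moreover have "a ^ 4 - b ^ 4 = 8 * w * (1 + w\<^sup>2)"
      unfolding a_def b_def by (simp add: power2_eq_square power4_eq_xxxx algebra_simps)
    ultimately show ?thesis by simp
  qed
  have F1': "deriv F 0 = c * \<xi>\<^sub>0 * (1 + w\<^sup>2) * b / a ^ 3"
  proof -
    have "deriv F 0 = 8 * w * (1 + w\<^sup>2) / (a\<^sup>2 * b\<^sup>2) * c * (b ^ 3 / (8 * \<xi>\<^sub>0 * a))"
      unfolding F1 K by (simp add: a_def b_def w_def)
    also have "\<dots> = w / \<xi>\<^sub>0 * ((1 + w\<^sup>2) * c * b / a ^ 3)"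
      using ab nz(1) by (simp add: divide_simps) (simp add: power2_eq_square power3_eq_cube)
    also have "w / \<xi>\<^sub>0 = \<xi>\<^sub>0" by (simp add: w_def power2_eq_square)
    finally show ?thesis by (simp add: mult_ac)
  qed
  have P\<xi>: "P \<xi>\<^sub>0 * \<xi>\<^sub>0 = (1 + 8 * w + 3 * w\<^sup>2) / (a * b)"
  proof -
    have "P \<xi>\<^sub>0 * \<xi>\<^sub>0 = 1 + 2 * w / a + 6 * w / b"
      unfolding P_def using nz(1) by (simp add: a_def b_def w_def power2_eq_square distrib_right mult.assoc)
    also have "\<dots> = (a * b + 2 * w * b + 6 * w * a) / (a * b)" using ab by (simp add: divide_simps) (simp add: algebra_simps)
    also have "a * b + 2 * w * b + 6 * w * a = 1 + 8 * w + 3 * w\<^sup>2"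
      by (simp add: a_def b_def power2_eq_square algebra_simps)
    finally show ?thesis .
  qed
  \<comment> \<open>This is the critical point equation once more: the two sides differ by w^4 - (1
    + 8 w^2). It yields \<open>P \<xi>\<^sub>0 * deriv F 0 = 2 * c\<close>, which says that the
    second derivative of \<open>F\<close> at 0 is zero.\<close>
  have rel: "(1 + 8 * w + 3 * w\<^sup>2) * (1 + w\<^sup>2) = 2 * a ^ 4"
  proof -
    have "(1 + 8 * w + 3 * w\<^sup>2) * (1 + w\<^sup>2) - 2 * a ^ 4 = w ^ 4 - (1 + 8 * w\<^sup>2)"
      unfolding a_def by (simp add: power2_eq_square power4_eq_xxxx algebra_simps)
    then show ?thesis using w4 by simp
  qed
  have PF: "P \<xi>\<^sub>0 * deriv F 0 = 2 * c"
  proof -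
    have "P \<xi>\<^sub>0 * deriv F 0 = (P \<xi>\<^sub>0 * \<xi>\<^sub>0) * (c * (1 + w\<^sup>2) * b / a ^ 3)" unfolding F1' by (simp add: mult_ac)
    also have "\<dots> = c * ((1 + 8 * w + 3 * w\<^sup>2) * (1 + w\<^sup>2)) / a ^ 4"
      unfolding P\<xi> using ab by (simp add: divide_simps) (simp add: power3_eq_cube power4_eq_xxxx)
    also have "\<dots> = 2 * c" unfolding rel using ab by simp
    finally show ?thesis .
  qed
  have dP: "deriv P \<xi>\<^sub>0 = - 1 / w + 2 * b / a\<^sup>2 + 6 * a / b\<^sup>2"
  proof (rule DERIV_imp_deriv)
    have nz': "1 + \<xi>\<^sub>0\<^sup>2 \<noteq> 0" "1 - \<xi>\<^sub>0\<^sup>2 \<noteq> 0" using nz by (simp_all add: w_def)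
    have 1: "((\<lambda>z::complex. 1 / z) has_field_derivative - 1 / w) (at \<xi>\<^sub>0)"
      using nz(1) by (auto intro!: derivative_eq_intros simp: w_def power2_eq_square)
    have 2: "((\<lambda>z::complex. 2 * z / (1 + z\<^sup>2)) has_field_derivative 2 * b / a\<^sup>2) (at \<xi>\<^sub>0)"
    proof -
      have "((\<lambda>z::complex. 2 * z / (1 + z\<^sup>2)) has_field_derivative
          (2 * (1 + \<xi>\<^sub>0\<^sup>2) - 2 * \<xi>\<^sub>0 * (2 * \<xi>\<^sub>0)) / ((1 + \<xi>\<^sub>0\<^sup>2) * (1 + \<xi>\<^sub>0\<^sup>2))) (at \<xi>\<^sub>0)"
        using nz' by (auto intro!: derivative_eq_intros)
      then show ?thesis by (simp add: a_def b_def w_def power2_eq_square algebra_simps)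
    qed
    have 3: "((\<lambda>z::complex. 6 * z / (1 - z\<^sup>2)) has_field_derivative 6 * a / b\<^sup>2) (at \<xi>\<^sub>0)"
    proof -
      have "((\<lambda>z::complex. 6 * z / (1 - z\<^sup>2)) has_field_derivative
          (6 * (1 - \<xi>\<^sub>0\<^sup>2) + 6 * \<xi>\<^sub>0 * (2 * \<xi>\<^sub>0)) / ((1 - \<xi>\<^sub>0\<^sup>2) * (1 - \<xi>\<^sub>0\<^sup>2))) (at \<xi>\<^sub>0)"
        using nz' by (auto intro!: derivative_eq_intros)
      then show ?thesis by (simp add: a_def b_def w_def power2_eq_square algebra_simps)
    qed
    show "(P has_field_derivative - 1 / w + 2 * b / a\<^sup>2 + 6 * a / b\<^sup>2) (at \<xi>\<^sub>0)"
      unfolding P_def by (intro DERIV_add 1 2 3)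
  qed
  have F1sq: "(deriv F 0)\<^sup>2 = c\<^sup>2 * w * (1 + w\<^sup>2)\<^sup>2 * b\<^sup>2 / a ^ 6"
    unfolding F1' by (simp add: power_mult_distrib power_divide w_def flip: power_mult)
  have nzF: "deriv F 0 \<noteq> 0"
  proof
    assume "deriv F 0 = 0"
    then have "c = 0" using PF by simp
    then show False using c by simp
  qed
  have "(deriv ^^ 3) F 0 / deriv F 0 = 2 * c\<^sup>2 - deriv P \<xi>\<^sub>0 * (deriv F 0)\<^sup>2"
    unfolding F3 PF using nzF by simp
  also have "\<dots> = c\<^sup>2 * (3 / 2 * (1 + 14 * w\<^sup>2 + w ^ 4) * (1 + w\<^sup>2)\<^sup>2 / a ^ 8)"
  proof -
    have "w \<noteq> 0" using nz by (simp add: w_def)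
    \<comment> \<open>The summand \<open>2 * c\<^sup>2\<close> is to be put over
      \<open>a ^ 8\<close>. Squaring \<open>rel\<close> writes its numerator with the factor
      \<open>(1 + w\<^sup>2)\<^sup>2\<close> that the other summand carries too.\<close>
    have "2 * a ^ 8 = (2 * a ^ 4)\<^sup>2 / 2" by (simp add: power_mult_distrib flip: power_mult)
    then have 2: "2 * a ^ 8 = (1 + 8 * w + 3 * w\<^sup>2)\<^sup>2 * (1 + w\<^sup>2)\<^sup>2 / 2"
      unfolding rel[symmetric] by (simp add: power_mult_distrib)
    have Pd: "deriv P \<xi>\<^sub>0 * (w * a\<^sup>2 * b\<^sup>2) = - (a\<^sup>2 * b\<^sup>2) + 2 * w * b ^ 3 + 6 * w * a ^ 3"
      unfolding dP using ab \<open>w \<noteq> 0\<close>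
      by (simp add: divide_simps) (simp add: power2_eq_square power3_eq_cube algebra_simps)
    have d: "2 * a ^ 8 - deriv P \<xi>\<^sub>0 * (w * a\<^sup>2 * b\<^sup>2) * (1 + w\<^sup>2)\<^sup>2 =
        3 / 2 * (1 + 14 * w\<^sup>2 + w ^ 4) * (1 + w\<^sup>2)\<^sup>2"
      unfolding 2 Pd unfolding a_def b_def
      by (simp add: power2_eq_square power3_eq_cube power4_eq_xxxx field_simps)
    have "2 * c\<^sup>2 - deriv P \<xi>\<^sub>0 * (deriv F 0)\<^sup>2 =
        c\<^sup>2 * ((2 * a ^ 8 - deriv P \<xi>\<^sub>0 * (w * a\<^sup>2 * b\<^sup>2) * (1 + w\<^sup>2)\<^sup>2) / a ^ 8)"
      unfolding F1sq using ab by (simp add: divide_simps) (simp add: eval_nat_numeral algebra_simps)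
    then show ?thesis unfolding d .
  qed
  finally have e: "(deriv ^^ 3) F 0 / deriv F 0 = c\<^sup>2 * (3 / 2 * (1 + 14 * w\<^sup>2 + w ^ 4) * (1 + w\<^sup>2)\<^sup>2 / a ^ 8)" .
  have "cmod ((deriv ^^ 3) F 0 / deriv F 0) =
      3 / 2 * cmod (1 + 14 * w\<^sup>2 + w ^ 4) * (cmod (1 + w\<^sup>2))\<^sup>2 / cmod a ^ 8"
    unfolding e norm_mult norm_divide norm_power c by (simp only: norm_numeral power_one mult_1_left)
  \<comment> \<open>With w^4 = 1 + 8 w^2 the expression is 2 + 22 w^2 = 2 - 22 p, which is negative
    because p > 1/11.\<close>
  also have "cmod (1 + 14 * w\<^sup>2 + w ^ 4) = 22 * p - 2"
  proof -
    have "1 + 14 * w\<^sup>2 + w ^ 4 = of_real (2 - 22 * p)" unfolding w4 w2 by simp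
    then show ?thesis using p by (simp only: norm_of_real)
  qed
  also have "cmod (1 + w\<^sup>2) = 1 - p"
  proof -
    have "1 + w\<^sup>2 = of_real (1 - p)" unfolding w2 by simp
    then show ?thesis using p by (simp only: norm_of_real)
  qed
  also have "cmod a ^ 8 = (1 + p) ^ 4"
  proof -
    have "(cmod a)\<^sup>2 = 1 + (2 * s\<^sup>2)\<^sup>2" unfolding cmod_power2 a_def wi by simp
    also have "(2 * s\<^sup>2)\<^sup>2 = p" using s(3) by (simp add: p_def power_mult_distrib flip: power_mult)
    finally have "((cmod a)\<^sup>2) ^ 4 = (1 + p) ^ 4" by simp
    then show ?thesis by (simp flip: power_mult)
  qed
  finally show ?thesis .
qed

lemma quarter_disc_conformal_bijection_nondegenerate:
  assumes F: "conformal_bijection F (ball 0 1) quarter_disc" and F0: "F 0 = \<xi>\<^sub>0"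
  shows "cmod ((deriv ^^ 3) F 0 / deriv F 0)
            \<notin> {2 * sqrt (1 - 1 / (real n)\<^sup>2) | n::nat. n \<ge> 1} \<union> {2}"
proof -
  define p where "p = sqrt 17 - 4"
  have p: "3 / 25 < p" "p < 1 / 8" using sqrt17_bounds by (simp_all add: p_def)
  define r where "r = 3 / 2 * (22 * p - 2) * (1 - p)\<^sup>2 / (1 + p) ^ 4"
  have r: "cmod ((deriv ^^ 3) F 0 / deriv F 0) = r"
    using quarter_disc_conformal_bijection_deriv3_ratio[OF F F0] by (simp add: p_def r_def)
  have "(1 + p) ^ 4 \<ge> 1" using p by (simp add: one_le_power)
  then have "r > 0" using p by (auto simp: r_def intro!: divide_pos_pos mult_pos_pos)
  have "r < 3 / 2"
  proof -
    have "(22 * p - 2) * (1 - p)\<^sup>2 \<le> (22 * p - 2) * 1"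
      using p by (intro mult_left_mono) (auto simp: power_le_one)
    also have "\<dots> < (1 + p) ^ 4" proof -
      have "(22 * p - 2) * 1 < 1" using p by simp
      then show ?thesis using \<open>(1 + p) ^ 4 \<ge> 1\<close> by (rule less_le_trans)
    qed
    finally have "(22 * p - 2) * (1 - p)\<^sup>2 / (1 + p) ^ 4 < 1"
      using \<open>(1 + p) ^ 4 \<ge> 1\<close> by (subst divide_less_eq_1_pos) auto
    then have "3 / 2 * ((22 * p - 2) * (1 - p)\<^sup>2 / (1 + p) ^ 4) < 3 / 2 * 1"
      by (rule mult_strict_left_mono) simp
    then show ?thesis unfolding r_def by (simp only: mult_1_right times_divide_eq_right mult.assoc)
  qed
  have "r \<noteq> 2 * sqrt (1 - 1 / (real n)\<^sup>2)" if "n \<ge> 1" for n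
  proof (cases "n = 1")
    case True
    then show ?thesis using \<open>r > 0\<close> by simp
  next
    case False
    then have "real n \<ge> 2" using that by simp
    then have "(real n)\<^sup>2 \<ge> 2\<^sup>2" by (intro power_mono) auto
    then have "1 / (real n)\<^sup>2 \<le> 1 / 4" using that by (intro divide_left_mono) auto
    \<comment> \<open>Since \<open>r < 3 / 2\<close>, the lower bound 3/4 for the root is enough;
      its square 9/16 lies below 1 - 1/4.\<close>
    then have "3 / 4 \<le> sqrt (1 - 1 / (real n)\<^sup>2)"
      by (intro real_le_rsqrt) (simp add: power2_eq_square)
    then show ?thesis using \<open>r < 3 / 2\<close> by simp
  qed
  then show ?thesis unfolding r using \<open>r < 3 / 2\<close> by auto
qed

section \<open>Calculus of smooth functions\<close>

text \<open>By uniqueness of derivatives any explicit \<open>f'\<close> may stand for the chosen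
  \<open>frechet_derivative\<close>, which makes inductions over \<open>k\<close> possible.\<close>

lemma C_k_SucI:
  assumes "\<And>x. (f has_derivative f' x) (at x)" "\<And>v. C_k k (\<lambda>x. f' x v)"
  shows "C_k (Suc k) f"
proof -
  have "frechet_derivative f (at x) = f' x" for x
    using frechet_derivative_at[OF assms(1)] by simp
  then show ?thesis using assms by (auto simp: differentiable_def)
qed

lemma C_k_SucD:
  assumes "C_k (Suc k) f"
  shows "(f has_derivative frechet_derivative f (at x)) (at x)"
    and "C_k k (\<lambda>x. frechet_derivative f (at x) v)"
  using assms by (auto simp: frechet_derivative_works[symmetric])

text \<open>The product and chain rules keep undifferentiated factors, which enter the induction at
  the lower order.\<close>

lemma C_k_pred: "C_k (Suc k) f \<Longrightarrow> C_k k f"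
proof (induction k arbitrary: f)
  case 0
  then show ?case
    by (auto simp: continuous_on_eq_continuous_at intro: differentiable_imp_continuous_within)
next
  case (Suc k)
  then show ?case by (simp only: C_k.simps) blast
qed

lemma C_k_continuous_on: "C_k k f \<Longrightarrow> continuous_on S f"
proof (induction k)
  case 0
  then show ?case by (auto intro: continuous_on_subset)
next
  case (Suc k)
  then show ?case using C_k_pred by blast
qed

lemma C_k_const: "C_k k (\<lambda>x. c)"
  by (induction k arbitrary: c) (auto intro: C_k_SucI[of _ "\<lambda>_ _. 0"] simp del: C_k.simps(2))

lemma C_k_bounded_linear: "bounded_linear f \<Longrightarrow> C_k k f"
  by (cases k)
    (auto intro!: C_k_SucI[of f "\<lambda>_. f"] C_k_const bounded_linear_imp_has_derivative linear_continuous_on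
      simp del: C_k.simps(2))

lemma C_k_add:
  assumes "C_k k f" "C_k k g"
  shows "C_k k (\<lambda>x. f x + g x)"
  using assms
proof (induction k arbitrary: f g)
  case 0
  then show ?case by (auto intro: continuous_on_add)
next
  case (Suc k)
  show ?case
    by (rule C_k_SucI[OF has_derivative_add[OF C_k_SucD(1)[OF Suc.prems(1)] C_k_SucD(1)[OF Suc.prems(2)]]])
      (intro Suc.IH C_k_SucD(2)[OF Suc.prems(1)] C_k_SucD(2)[OF Suc.prems(2)])
qed

lemma C_k_mult:
  assumes "C_k k f" "C_k k g"
  shows "C_k k (\<lambda>x. f x * g x)"
  using assms
proof (induction k arbitrary: f g)
  case 0
  then show ?case by (auto intro: continuous_on_mult)
next
  case (Suc k)
  show ?case
    by (rule C_k_SucI[OF has_derivative_mult[OF C_k_SucD(1)[OF Suc.prems(1)] C_k_SucD(1)[OF Suc.prems(2)]]])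
      (intro C_k_add Suc.IH C_k_pred[OF Suc.prems(1)] C_k_pred[OF Suc.prems(2)]
         C_k_SucD(2)[OF Suc.prems(1)] C_k_SucD(2)[OF Suc.prems(2)])
qed

lemma C_k_cmult: "C_k k f \<Longrightarrow> C_k k (\<lambda>x. c * f x)"
  by (intro C_k_mult C_k_const)

lemma C_k_uminus: "C_k k f \<Longrightarrow> C_k k (\<lambda>x. - f x)"
  using C_k_cmult[of k f "-1"] by simp

lemma C_k_diff: "C_k k f \<Longrightarrow> C_k k g \<Longrightarrow> C_k k (\<lambda>x. f x - g x)"
  using C_k_add[OF _ C_k_uminus, of k f g] by simp

lemma C_k_power: "C_k k f \<Longrightarrow> C_k k (\<lambda>x. f x ^ n)"
  by (induction n) (auto intro: C_k_const C_k_mult)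

lemma C_k_compose_affine:
  assumes "C_k k f" "bounded_linear L"
  shows "C_k k (\<lambda>x. f (L x + c))"
  using assms(1)
proof (induction k arbitrary: f)
  case 0
  have "continuous_on UNIV (\<lambda>x. L x + c)"
    by (intro continuous_on_add linear_continuous_on assms(2) continuous_on_const)
  with 0 show ?case
    by (auto intro: continuous_on_compose2[of UNIV f])
next
  case (Suc k)
  have L: "((\<lambda>x. L x + c) has_derivative L) (at x)" for x
    using bounded_linear_imp_has_derivative[OF assms(2)] by (auto intro!: derivative_eq_intros)
  show ?case
    by (rule C_k_SucI[OF has_derivative_compose[OF L C_k_SucD(1)[OF Suc.prems]]])
      (intro Suc.IH C_k_SucD(2)[OF Suc.prems])
qed

lemma C_k_compose_linear: "C_k k f \<Longrightarrow> bounded_linear L \<Longrightarrow> C_k k (\<lambda>x. f (L x))"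
  using C_k_compose_affine[of k f L 0] by simp

text \<open>For a scalar \<open>g\<close> the chain rule is a product of two numbers, so
  \<open>C_k_mult\<close> closes the induction. Both functions are generalized because the
  derivative of \<open>g\<close> replaces \<open>g\<close> in the next step.\<close>

lemma C_k_compose_real:
  fixes g :: "real \<Rightarrow> real"
  assumes "C_k k f" "C_k k g"
  shows "C_k k (\<lambda>x. g (f x))"
  using assms
proof (induction k arbitrary: f g)
  case 0
  then show ?case
    by (auto intro!: continuous_on_compose2[of UNIV g])
next
  case (Suc k)
  note f = C_k_SucD[OF Suc.prems(1)] and g = C_k_SucD[OF Suc.prems(2)]
  have lin: "frechet_derivative g (at y) h = h * frechet_derivative g (at y) 1" for y h
    using linear_cmul[OF has_derivative_linear[OF g(1)], of y h 1] by simp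
  have "((\<lambda>x. g (f x)) has_derivative
      (\<lambda>v. frechet_derivative f (at x) v * frechet_derivative g (at (f x)) 1)) (at x)" for x
    by (rule has_derivative_eq_rhs[OF has_derivative_compose[OF f(1) g(1)]]) (rule ext, rule lin)
  then show ?case
    by (rule C_k_SucI) (rule C_k_mult[OF f(2) Suc.IH[OF C_k_pred[OF Suc.prems(1)] g(2)]])
qed

text \<open>Here \<open>f\<close> stays fixed in the induction: the derivative of
  \<open>inverse (f x)\<close> is built from a derivative of \<open>f\<close> and from
  \<open>inverse (f x)\<close> itself at the lower order.\<close>

lemma C_k_inverse:
  assumes "C_k k f" "\<And>x. f x \<noteq> 0"
  shows "C_k k (\<lambda>x. inverse (f x))"
  using assms(1)
proof (induction k)
  case 0
  then show ?case using assms(2) by (auto intro!: continuous_on_inverse)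
next
  case (Suc k)
  note f = C_k_SucD[OF Suc.prems]
  have "((\<lambda>x. inverse (f x)) has_derivative
      (\<lambda>v. - (inverse (f x) * frechet_derivative f (at x) v * inverse (f x)))) (at x)" for x
    by (rule Deriv.has_derivative_inverse[OF assms(2) f(1)])
  then show ?case
    by (rule C_k_SucI) (intro C_k_uminus C_k_mult Suc.IH f(2) C_k_pred[OF Suc.prems])
qed

lemma C_k_ln:
  assumes "C_k k f" "\<And>x. f x > 0"
  shows "C_k k (\<lambda>x. ln (f x))"
proof (cases k)
  case 0
  then show ?thesis using assms by (auto intro!: continuous_on_ln simp: less_imp_neq[THEN not_sym])
next
  case (Suc j)
  note f = C_k_SucD[OF assms(1)[unfolded Suc]]
  have "((\<lambda>x. ln (f x)) has_derivative
      (\<lambda>v. frechet_derivative f (at x) v * inverse (f x))) (at x)" for x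
    by (rule has_derivative_eq_rhs[OF has_derivative_ln[OF assms(2) f(1)]]) (simp add: mult.commute)
  then show ?thesis
    unfolding Suc
    by (rule C_k_SucI)
      (intro C_k_mult f(2) C_k_inverse C_k_pred[OF assms(1)[unfolded Suc]], metis assms(2) less_irrefl)
qed

text \<open>The polynomial factor makes this family of flat functions closed under differentiation,
  so smoothness of exp(-1/x), extended by 0, follows by induction over all \<open>p\<close> at
  once.\<close>

definition exp_cutoff :: "real poly \<Rightarrow> real \<Rightarrow> real" where
  "exp_cutoff p x = (if x > 0 then poly p (1 / x) * exp (- (1 / x)) else 0)"

lemma poly_times_exp_tendsto_0: "((\<lambda>y::real. poly p y * exp (- y)) \<longlongrightarrow> 0) at_top"
proof -
  have "((\<lambda>y. \<Sum>i\<le>degree p. coeff p i * (y ^ i / exp y)) \<longlongrightarrow> (\<Sum>i\<le>degree p. coeff p i * 0)) at_top"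
    by (intro tendsto_intros tendsto_power_div_exp_0)
  then show ?thesis
    by (simp add: poly_altdef sum_divide_distrib exp_minus divide_inverse sum_distrib_right mult.assoc)
qed

text \<open>For positive \<open>x\<close> the inner derivatives of 1/x and -1/x give the factor
  1/x^2, that is \<open>monom 1 2\<close>, with \<open>- pderiv p\<close> from the polynomial and
  \<open>p\<close> from the exponential. At 0 the difference quotient is again of the same kind,
  with \<open>pCons 0 p\<close>, the product of the variable and \<open>p\<close>, and the
  exponential wins.\<close>

lemma exp_cutoff_deriv:
  "(exp_cutoff p has_field_derivative exp_cutoff (monom 1 2 * (p - pderiv p)) x) (at x)"
proof -
  consider "x > 0" | "x < 0" | "x = 0" by linarith
  then show ?thesis
  proof cases
    case 1
    have "((\<lambda>x. poly p (1 / x) * exp (- (1 / x))) has_field_derivative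
        exp_cutoff (monom 1 2 * (p - pderiv p)) x) (at x)"
      using 1 by (auto intro!: derivative_eq_intros DERIV_chain2[OF poly_DERIV]
          simp: exp_cutoff_def poly_monom power2_eq_square divide_simps)
        (simp add: algebra_simps)
    then show ?thesis
      by (rule has_field_derivative_transform_within_open[of _ _ _ "{0<..}"])
        (use 1 in \<open>auto simp: exp_cutoff_def\<close>)
  next
    case 2
    have "((\<lambda>x. 0) has_field_derivative exp_cutoff (monom 1 2 * (p - pderiv p)) x) (at x)"
      using 2 by (simp add: exp_cutoff_def)
    then show ?thesis
      by (rule has_field_derivative_transform_within_open[of _ _ _ "{..<0}"])
        (use 2 in \<open>auto simp: exp_cutoff_def\<close>)
  next
    case 3
    have "((\<lambda>y. exp_cutoff p y / y) \<longlongrightarrow> 0) (at_right 0)"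
    proof (rule Lim_transform_eventually)
      show "((\<lambda>y. poly (pCons 0 p) (inverse y) * exp (- inverse y)) \<longlongrightarrow> 0) (at_right 0)"
        by (rule filterlim_compose[OF poly_times_exp_tendsto_0 filterlim_inverse_at_top_right])
      show "\<forall>\<^sub>F y in at_right 0. poly (pCons 0 p) (inverse y) * exp (- inverse y) = exp_cutoff p y / y"
        by (rule eventually_at_rightI[of 0 1]) (auto simp: exp_cutoff_def divide_inverse)
    qed
    moreover have "((\<lambda>y. exp_cutoff p y / y) \<longlongrightarrow> 0) (at_left 0)"
      by (rule Lim_transform_eventually[OF tendsto_const])
        (rule eventually_at_leftI[of "-1" 0], auto simp: exp_cutoff_def)
    ultimately have "((\<lambda>y. exp_cutoff p y / y) \<longlongrightarrow> 0) (at 0)"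
      by (simp add: filterlim_at_split)
    then show ?thesis
      unfolding 3 by (simp add: has_field_derivative_iff exp_cutoff_def)
  qed
qed

lemma C_k_exp_cutoff: "C_k k (exp_cutoff p)"
proof (induction k arbitrary: p)
  case 0
  then show ?case
    using exp_cutoff_deriv by (auto simp: continuous_on_eq_continuous_at intro: DERIV_isCont)
next
  case (Suc k)
  show ?case
    by (rule C_k_SucI[OF exp_cutoff_deriv[of p, unfolded has_field_derivative_def]])
      (intro C_k_mult C_k_const Suc.IH)
qed

lemma smooth_positive_part:
  obtains e :: "real \<Rightarrow> real" where "\<And>k. C_k k e" "\<And>x. x > 0 \<Longrightarrow> e x > 0" "\<And>x. x \<le> 0 \<Longrightarrow> e x = 0"
  by (rule that[of "exp_cutoff 1"]) (auto simp: C_k_exp_cutoff exp_cutoff_def)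

text \<open>The quotient e(x - 1) / (e(x - 1) + e(2 - x)) is well defined because the two arguments
  add up to 1 and so are never both nonpositive.\<close>

lemma smooth_step:
  obtains \<theta> :: "real \<Rightarrow> real" where "\<And>k. C_k k \<theta>" "\<And>x. x \<le> 1 \<Longrightarrow> \<theta> x = 0" "\<And>x. x \<ge> 2 \<Longrightarrow> \<theta> x = 1"
    "\<And>x. 0 \<le> \<theta> x" "\<And>x. \<theta> x \<le> 1"
proof -
  obtain e :: "real \<Rightarrow> real" where e: "\<And>k. C_k k e" "\<And>x. x > 0 \<Longrightarrow> e x > 0" "\<And>x. x \<le> 0 \<Longrightarrow> e x = 0"
    by (rule smooth_positive_part) blast
  have nn: "e x \<ge> 0" for x using e(2,3) by (metis less_eq_real_def linorder_not_less)
  have pos: "e (x - 1) + e (2 - x) > 0" for x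
  proof (cases "x > 1")
    case True
    then show ?thesis using e(2)[of "x - 1"] nn[of "2 - x"] by linarith
  next
    case False
    then show ?thesis using e(2)[of "2 - x"] nn[of "x - 1"] by linarith
  qed
  have a: "C_k k (\<lambda>x. e (x - 1))" for k
    using C_k_compose_affine[OF e(1)[of k] bounded_linear_ident, of "-1"] by simp
  have b: "C_k k (\<lambda>x. e (2 - x))" for k
    using C_k_compose_affine[OF e(1)[of k] bounded_linear_minus[OF bounded_linear_ident], of "2"]
    by (simp add: add.commute)
  show thesis
  proof (rule that[of "\<lambda>x. e (x - 1) * inverse (e (x - 1) + e (2 - x))"])
    show "C_k k (\<lambda>x. e (x - 1) * inverse (e (x - 1) + e (2 - x)))" for k
      by (intro C_k_mult C_k_inverse C_k_add a b) (use pos in \<open>metis less_irrefl\<close>)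
    show "e (x - 1) * inverse (e (x - 1) + e (2 - x)) = 1" if "x \<ge> 2" for x
      using that e(3)[of "2 - x"] e(2)[of "x - 1"] by simp
    show "e (x - 1) * inverse (e (x - 1) + e (2 - x)) \<le> 1" for x
      using pos[of x] nn[of "2 - x"] by (simp add: field_simps)
    show "0 \<le> e (x - 1) * inverse (e (x - 1) + e (2 - x))" for x
      using pos[of x] nn[of "x - 1"] by simp
  qed (use e(3) in auto)
qed

section \<open>Directional derivatives and the Laplacian of smooth functions\<close>

abbreviation dir_deriv :: "'a \<Rightarrow> ('a::real_normed_vector \<Rightarrow> real) \<Rightarrow> 'a \<Rightarrow> real" where
  "dir_deriv v f x \<equiv> frechet_derivative f (at x) v"

abbreviation smooth :: "('a::euclidean_space \<Rightarrow> real) \<Rightarrow> bool" where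
  "smooth f \<equiv> \<forall>k. C_k k f"

lemma smooth_dir_deriv: "smooth f \<Longrightarrow> smooth (dir_deriv v f)"
  by (auto intro: C_k_SucD(2))

lemma smooth_differentiable: "smooth f \<Longrightarrow> f differentiable (at x)"
  by (metis C_k.simps(2))

lemma smooth_has_derivative: "smooth f \<Longrightarrow> (f has_derivative frechet_derivative f (at x)) (at x)"
  by (simp add: smooth_differentiable frechet_derivative_works[symmetric])

lemma smooth_continuous_on: "smooth f \<Longrightarrow> continuous_on S f"
  using C_k_continuous_on by blast

lemma dir_derivI: "(f has_derivative f') (at x) \<Longrightarrow> dir_deriv v f x = f' v"
  using frechet_derivative_at by metis

text \<open>Functions that agree near \<open>x\<close> have the same Frechet derivatives, if any, so
  the choice operator in \<open>frechet_derivative\<close> returns the same value even where neither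
  is differentiable.\<close>

lemma dir_deriv_cong:
  assumes "open S" "x \<in> S" "\<And>y. y \<in> S \<Longrightarrow> f y = g y"
  shows "dir_deriv v f x = dir_deriv v g x"
proof -
  have "(f has_derivative D) (at x) \<longleftrightarrow> (g has_derivative D) (at x)" for D
    by (intro iffI; erule has_derivative_transform_within_open[OF _ assms(1,2)]; simp add: assms(3))
  then show ?thesis by (simp add: frechet_derivative_def)
qed

lemma dir_deriv_eq_0:
  assumes "open S" "x \<in> S" "\<And>y. y \<in> S \<Longrightarrow> f y = c"
  shows "dir_deriv v f x = 0"
  using dir_deriv_cong[of S x f "\<lambda>_. c" v] assms by (simp add: frechet_derivative_const)

lemma laplacian_eq_0:
  assumes "open S" "x \<in> S" "\<And>y. y \<in> S \<Longrightarrow> f y = c"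
  shows "laplacian f x = 0"
proof -
  have "dir_deriv v f y = 0" if "y \<in> S" for y v
    by (rule dir_deriv_eq_0[where S = S]) (use assms that in auto)
  then show ?thesis
    unfolding laplacian_def using dir_deriv_eq_0[OF assms(1,2), of "dir_deriv _ f" 0] by simp
qed

lemma dir_deriv_add:
  "f differentiable at x \<Longrightarrow> g differentiable at x \<Longrightarrow>
    dir_deriv v (\<lambda>x. f x + g x) x = dir_deriv v f x + dir_deriv v g x"
  by (rule dir_derivI) (auto intro: has_derivative_add simp: frechet_derivative_works[symmetric])

lemma dir_deriv_cmult:
  "f differentiable at x \<Longrightarrow> dir_deriv v (\<lambda>x. c * f x) x = c * dir_deriv v f x"
  by (rule dir_derivI) (auto intro!: has_derivative_mult_right simp: frechet_derivative_works[symmetric])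

lemma dir_deriv_mult:
  "f differentiable at x \<Longrightarrow> g differentiable at x \<Longrightarrow>
    dir_deriv v (\<lambda>x. f x * g x) x = f x * dir_deriv v g x + dir_deriv v f x * g x"
  by (rule dir_derivI) (auto intro: has_derivative_mult simp: frechet_derivative_works[symmetric])

lemma dir_deriv_compose_affine:
  assumes "f differentiable at (L x + c)" "bounded_linear L"
  shows "dir_deriv v (\<lambda>x. f (L x + c)) x = dir_deriv (L v) f (L x + c)"
proof (rule dir_derivI)
  have L: "((\<lambda>x. L x + c) has_derivative L) (at x)"
    using bounded_linear_imp_has_derivative[OF assms(2)] by (auto intro!: derivative_eq_intros)
  show "((\<lambda>x. f (L x + c)) has_derivative (\<lambda>v. dir_deriv (L v) f (L x + c))) (at x)"
    using has_derivative_compose[OF L] assms(1) by (simp add: frechet_derivative_works)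
qed

lemma laplacian_add:
  assumes "smooth f" "smooth g"
  shows "laplacian (\<lambda>z. f z + g z) z = laplacian f z + laplacian g z"
proof -
  have "dir_deriv v (\<lambda>z. f z + g z) = (\<lambda>z. dir_deriv v f z + dir_deriv v g z)" for v
    using assms by (auto simp: dir_deriv_add smooth_differentiable)
  then show ?thesis using assms
    by (simp add: laplacian_def dir_deriv_add smooth_differentiable smooth_dir_deriv)
qed

lemma laplacian_cmult:
  assumes "smooth f"
  shows "laplacian (\<lambda>z. c * f z) z = c * laplacian f z"
proof -
  have "dir_deriv v (\<lambda>z. c * f z) = (\<lambda>z. c * dir_deriv v f z)" for v
    using assms by (auto simp: dir_deriv_cmult smooth_differentiable)
  then show ?thesis using assms
    by (simp add: laplacian_def dir_deriv_cmult smooth_differentiable smooth_dir_deriv algebra_simps)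
qed

lemma laplacian_mult:
  assumes "smooth f" "smooth g"
  shows "laplacian (\<lambda>z. f z * g z) z = f z * laplacian g z
      + 2 * (dir_deriv 1 f z * dir_deriv 1 g z + dir_deriv \<i> f z * dir_deriv \<i> g z) + laplacian f z * g z"
proof -
  have eq: "dir_deriv v (\<lambda>z. f z * g z) = (\<lambda>z. f z * dir_deriv v g z + dir_deriv v f z * g z)" for v
    using assms by (auto simp: dir_deriv_mult smooth_differentiable)
  have s: "smooth (\<lambda>z. f z * dir_deriv v g z)" "smooth (\<lambda>z. dir_deriv v f z * g z)" for v
    using assms by (auto intro!: C_k_mult C_k_SucD(2))
  have "dir_deriv v (dir_deriv v (\<lambda>z. f z * g z)) z = f z * dir_deriv v (dir_deriv v g) z
      + 2 * (dir_deriv v f z * dir_deriv v g z) + dir_deriv v (dir_deriv v f) z * g z" for v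
    unfolding eq using assms s
    by (simp add: dir_deriv_add dir_deriv_mult smooth_differentiable smooth_dir_deriv)
  then show ?thesis unfolding laplacian_def by (simp add: algebra_simps)
qed

lemma dir_deriv_translate:
  fixes a :: "'a::euclidean_space"
  assumes "f differentiable at (x - a)"
  shows "dir_deriv v (\<lambda>x. f (x - a)) x = dir_deriv v f (x - a)"
  using dir_deriv_compose_affine[OF _ bounded_linear_ident, of f x "- a" v] assms by simp

lemma smooth_translate: "smooth f \<Longrightarrow> smooth (\<lambda>x. f (x - a))"
  using C_k_compose_affine[OF _ bounded_linear_ident, of _ f "- a"] by simp

lemma laplacian_translate:
  assumes "smooth f"
  shows "laplacian (\<lambda>z. f (z - a)) z = laplacian f (z - a)"
proof -
  have "dir_deriv v (\<lambda>z. f (z - a)) = (\<lambda>z. dir_deriv v f (z - a))" for v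
    using assms by (auto simp: dir_deriv_translate smooth_differentiable)
  then show ?thesis using assms
    by (simp add: laplacian_def smooth_differentiable smooth_dir_deriv
      dir_deriv_translate[where f = "dir_deriv 1 f"] dir_deriv_translate[where f = "dir_deriv \<i> f"])
qed

lemma smooth_laplacian: "smooth f \<Longrightarrow> smooth (laplacian f)"
  unfolding laplacian_def[abs_def] by (intro allI C_k_add) (auto intro!: C_k_SucD(2))

lemma frechet_derivative_complex:
  fixes f :: "complex \<Rightarrow> real"
  assumes "f differentiable at z"
  shows "frechet_derivative f (at z) h = Re h * dir_deriv 1 f z + Im h * dir_deriv \<i> f z"
proof -
  have lin: "linear (frechet_derivative f (at z))"
    using assms by (simp add: linear_frechet_derivative)
  have "h = Re h *\<^sub>R 1 + Im h *\<^sub>R \<i>" by (simp add: complex_eq_iff)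
  then have "frechet_derivative f (at z) h = frechet_derivative f (at z) (Re h *\<^sub>R 1 + Im h *\<^sub>R \<i>)" by simp
  also have "\<dots> = Re h * dir_deriv 1 f z + Im h * dir_deriv \<i> f z"
    by (simp add: linear_add[OF lin] linear_cmul[OF lin])
  finally show ?thesis .
qed

section \<open>Integrals over the plane and differentiation of convolutions\<close>

lemma integrable_compact_support:
  fixes f :: "'a::euclidean_space \<Rightarrow> real"
  assumes "continuous_on UNIV f" "compact K" "\<And>z. z \<notin> K \<Longrightarrow> f z = 0"
  shows "integrable lborel f"
proof -
  have "integrable lborel (\<lambda>x. indicator K x *\<^sub>R f x)"
    using assms(2) continuous_on_subset[OF assms(1)] by (intro borel_integrable_compact) auto
  also have "(\<lambda>x. indicator K x *\<^sub>R f x) = f"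
    using assms(3) by (auto simp: fun_eq_iff indicator_def)
  finally show ?thesis .
qed

lemma bounded_compact_support:
  fixes f :: "'a::euclidean_space \<Rightarrow> real"
  assumes "continuous_on UNIV f" "compact K" "\<And>z. z \<notin> K \<Longrightarrow> f z = 0"
  obtains M where "M > 0" "\<And>z. \<bar>f z\<bar> \<le> M"
proof -
  have "compact (f ` K)" using assms(1,2) by (meson compact_continuous_image continuous_on_subset subset_UNIV)
  then obtain M where M: "M > 0" "\<And>y. y \<in> f ` K \<Longrightarrow> norm y \<le> M"
    using compact_imp_bounded bounded_pos by metis
  have "\<bar>f z\<bar> \<le> M" for z
    using M assms(3)[of z] by (cases "z \<in> K") auto
  then show thesis using that M(1) by blast
qed

text \<open>This change of variables rescales the approximate delta function in Weyl's lemma; in the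
  plane the exponent is 2.\<close>

lemma integral_lborel_affine:
  fixes f :: "'a::euclidean_space \<Rightarrow> real"
  assumes [measurable]: "f \<in> borel_measurable borel" and c: "c \<noteq> 0"
  shows "integral\<^sup>L lborel f = \<bar>c\<bar> ^ DIM('a) * (\<integral>x. f (t + c *\<^sub>R x) \<partial>lborel)"
proof -
  have "integral\<^sup>L lborel f = integral\<^sup>L (density (distr lborel borel (\<lambda>x. t + c *\<^sub>R x)) (\<lambda>_. \<bar>c\<bar> ^ DIM('a))) f"
    using lborel_affine[OF c, of t] by simp
  also have "\<dots> = \<bar>c\<bar> ^ DIM('a) * (\<integral>x. f (t + c *\<^sub>R x) \<partial>lborel)"
    by (subst integral_density) (auto simp: integral_distr)
  finally show ?thesis .
qed

text \<open>Half the Laplacian of \<open>log_kernel 1\<close> is this function. It is dominated by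
  the product of 1 / (1 + x^2) and 1 / (1 + y^2), so the integral over the plane splits and arctan
  replaces polar coordinates; the negative half line follows by reflection.\<close>

lemma integrable_inverse_square_plane:
  "integrable lborel (\<lambda>u::complex. 1 / (1 + (cmod u)\<^sup>2)\<^sup>2)"
proof -
  define f where "f x = 1 / (1 + x\<^sup>2)" for x :: real
  have pos: "1 + x\<^sup>2 > 0" for x :: real by (simp add: add_pos_nonneg)
  have "continuous_on UNIV f" unfolding f_def[abs_def]
    by (intro continuous_intros) (use pos in \<open>metis less_irrefl\<close>)
  then have [measurable]: "f \<in> borel_measurable borel" by (rule borel_measurable_continuous_onI)
  have half: "(\<integral>\<^sup>+x. ennreal (f x) * indicator {0..} x \<partial>lborel) = pi / 2 - arctan 0"
  proof (rule nn_integral_FTC_atLeast)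
    show "DERIV arctan x :> f x" for x
      using DERIV_arctan[of x] by (simp add: f_def divide_inverse)
    show "(arctan \<longlongrightarrow> pi / 2) at_top" by (rule tendsto_arctan_at_top)
  qed (auto simp: f_def pos less_imp_le)
  have "(\<integral>\<^sup>+x. ennreal (f x) * indicator {..0} x \<partial>lborel) =
      ennreal \<bar>- 1\<bar> * (\<integral>\<^sup>+x. ennreal (f (0 + - 1 * x)) * indicator {..0} (0 + - 1 * x) \<partial>lborel)"
    by (rule nn_integral_real_affine) auto
  also have "\<dots> = (\<integral>\<^sup>+x. ennreal (f x) * indicator {0..} x \<partial>lborel)"
    by (simp add: f_def indicator_def)
  finally have half': "(\<integral>\<^sup>+x. ennreal (f x) * indicator {..0} x \<partial>lborel) = pi / 2 - arctan 0"
    unfolding half .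
  have "(\<integral>\<^sup>+x. ennreal (f x) \<partial>lborel) \<le>
      (\<integral>\<^sup>+x. ennreal (f x) * indicator {0..} x + ennreal (f x) * indicator {..0} x \<partial>lborel)"
    by (intro nn_integral_mono) (auto simp: indicator_def)
  also have "\<dots> = ennreal (pi / 2 - arctan 0) + ennreal (pi / 2 - arctan 0)"
    by (subst nn_integral_add) (auto simp: half half')
  also have "\<dots> < \<infinity>" by simp
  finally have fin: "(\<integral>\<^sup>+x. ennreal (f x) \<partial>lborel) < \<infinity>" .
  have "(\<integral>\<^sup>+u. ennreal (1 / (1 + (cmod u)\<^sup>2)\<^sup>2) \<partial>lborel) \<le>
      (\<integral>\<^sup>+u. (\<Prod>b\<in>(Basis::complex set). ennreal (f (u \<bullet> b))) \<partial>lborel)"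
  proof (rule nn_integral_mono)
    fix u :: complex
    have "(1 + (Re u)\<^sup>2) * (1 + (Im u)\<^sup>2) \<le> (1 + (Re u)\<^sup>2 + (Im u)\<^sup>2) * (1 + (Re u)\<^sup>2 + (Im u)\<^sup>2)"
      by (intro mult_mono) auto
    then have "1 / (1 + (cmod u)\<^sup>2)\<^sup>2 \<le> 1 / ((1 + (Re u)\<^sup>2) * (1 + (Im u)\<^sup>2))"
      unfolding cmod_power2 using pos by (intro divide_left_mono) (auto simp: power2_eq_square add.assoc add_pos_nonneg)
    also have "\<dots> = f (Re u) * f (Im u)" by (simp add: f_def)
    finally have "ennreal (1 / (1 + (cmod u)\<^sup>2)\<^sup>2) \<le> ennreal (f (Re u) * f (Im u))"
      by (rule ennreal_leI)
    also have "\<dots> = (\<Prod>b\<in>Basis. ennreal (f (u \<bullet> b)))"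
      by (simp add: Basis_complex_def ennreal_mult[symmetric] f_def)
    finally show "ennreal (1 / (1 + (cmod u)\<^sup>2)\<^sup>2) \<le> (\<Prod>b\<in>Basis. ennreal (f (u \<bullet> b)))" .
  qed
  also have "\<dots> = (\<Prod>b\<in>(Basis::complex set). (\<integral>\<^sup>+x. ennreal (f x) \<partial>lborel))"
    by (rule nn_integral_lborel_prod) auto
  also have "\<dots> < \<infinity>" using fin by (simp add: Basis_complex_def ennreal_mult_less_top)
  finally have "(\<integral>\<^sup>+u. ennreal (1 / (1 + (cmod u)\<^sup>2)\<^sup>2) \<partial>lborel) < \<infinity>" .
  moreover have "(\<lambda>u::complex. 1 / (1 + (cmod u)\<^sup>2)\<^sup>2) \<in> borel_measurable borel" by measurable
  ultimately show ?thesis by (intro integrableI_nonneg) auto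
qed

text \<open>The value is pi, but it serves only to normalize the reproducing kernel, for which
  positivity is enough.\<close>

lemma integral_inverse_square_plane_pos:
  "integral\<^sup>L lborel (\<lambda>u::complex. 1 / (1 + (cmod u)\<^sup>2)\<^sup>2) > 0"
proof -
  have pos: "1 / (1 + (cmod u)\<^sup>2)\<^sup>2 > 0" for u :: complex
    by (intro divide_pos_pos zero_less_power add_pos_nonneg) auto
  have "integral\<^sup>L lborel (\<lambda>u::complex. 1 / (1 + (cmod u)\<^sup>2)\<^sup>2) \<noteq> 0"
  proof
    assume "integral\<^sup>L lborel (\<lambda>u::complex. 1 / (1 + (cmod u)\<^sup>2)\<^sup>2) = 0"
    then have "AE u::complex in lborel. 1 / (1 + (cmod u)\<^sup>2)\<^sup>2 = 0"
      by (subst (asm) integral_nonneg_eq_0_iff_AE[OF integrable_inverse_square_plane])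
        (auto simp: less_imp_le[OF pos])
    then have "AE u::complex in lborel. False" by (rule AE_mp) (use pos in \<open>auto simp: less_le\<close>)
    then show False by (simp add: ae_filter_eq_bot_iff)
  qed
  moreover have "integral\<^sup>L lborel (\<lambda>u::complex. 1 / (1 + (cmod u)\<^sup>2)\<^sup>2) \<ge> 0"
    using pos by (intro Bochner_Integration.integral_nonneg) (auto simp: less_imp_le)
  ultimately show ?thesis by linarith
qed

text \<open>All derivatives fall on the kernel, so continuity of \<psi> suffices. For centres in
  \<open>ball a 1\<close> the integrands are supported in one fixed box, on which differentiation
  under the integral sign applies; the minus sign comes from the argument
  \<open>z - a\<close>.\<close>

lemma convolution_has_derivative:
  fixes \<psi> k :: "complex \<Rightarrow> real"
  assumes \<psi>: "continuous_on UNIV \<psi>" and k: "smooth k" and supp: "\<And>z. cmod z > r \<Longrightarrow> k z = 0"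
  defines "T \<equiv> \<lambda>k a. \<integral>z. \<psi> z * k (z - a) \<partial>lborel"
  shows "(T k has_derivative (\<lambda>h. - (Re h * T (dir_deriv 1 k) a + Im h * T (dir_deriv \<i> k) a))) (at a)"
proof -
  obtain l u :: complex where lu: "cball a (\<bar>r\<bar> + 1) \<subseteq> cbox l u"
    using bounded_subset_cbox_symmetric[OF bounded_cball] by metis
  have cont: "continuous_on S (\<lambda>x. k' (g x))" if "smooth k'" "continuous_on S g" for k' :: "complex \<Rightarrow> real" and S and g :: "'b::topological_space \<Rightarrow> complex"
    by (rule continuous_on_compose2[OF smooth_continuous_on[OF that(1)] that(2)]) auto
  have Teq: "T k' x = integral (cbox l u) (\<lambda>z. \<psi> z * k' (z - x))"
    if "smooth k'" "\<And>z. cmod z > r \<Longrightarrow> k' z = 0" "x \<in> ball a 1" for k' x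
  proof -
    have z: "\<psi> z * k' (z - x) = 0" if "z \<notin> cbox l u" for z
    proof -
      have "z \<notin> cball a (\<bar>r\<bar> + 1)" using that lu by blast
      then have "dist a z > \<bar>r\<bar> + 1" by simp
      moreover have "dist a z \<le> dist a x + cmod (z - x)"
        using dist_triangle[of a z x] by (simp add: dist_norm norm_minus_commute)
      ultimately have "cmod (z - x) > r" using \<open>x \<in> ball a 1\<close> by simp
      then show ?thesis using that(1) \<open>\<And>z. cmod z > r \<Longrightarrow> k' z = 0\<close> by simp
    qed
    have "integrable lborel (\<lambda>z. \<psi> z * k' (z - x))"
      by (rule integrable_compact_support[OF _ compact_cbox z])
        (intro continuous_on_mult \<psi> cont[OF that(1)] continuous_intros)
    then have "T k' x = integral UNIV (\<lambda>z. \<psi> z * k' (z - x))"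
      unfolding T_def by (simp add: integral_lborel)
    also have "(\<lambda>z. \<psi> z * k' (z - x)) = (\<lambda>z. if z \<in> cbox l u then \<psi> z * k' (z - x) else 0)"
      using z by auto
    also have "integral UNIV \<dots> = integral (cbox l u) (\<lambda>z. \<psi> z * k' (z - x))"
      by (rule Henstock_Kurzweil_Integration.integral_restrict_UNIV)
    finally show ?thesis .
  qed
  have supp': "dir_deriv v k z = 0" if "cmod z > r" for v z
    by (rule dir_deriv_eq_0[of "- cball 0 r"]) (use that supp in auto)
  \<comment> \<open>The Leibniz rule expects the derivative as a bounded linear operator that
    depends continuously on both arguments; splitting it along \<open>Re\<close> and
    \<open>Im\<close> reduces this to scalar continuity.\<close>
  define fx where "fx x t = (- (\<psi> t * dir_deriv 1 k (t - x))) *\<^sub>R Blinfun Re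
      + (- (\<psi> t * dir_deriv \<i> k (t - x))) *\<^sub>R Blinfun Im" for x t
  have Bl: "blinfun_apply (Blinfun Re) = Re" "blinfun_apply (Blinfun Im) = Im"
    by (simp_all add: bounded_linear_Blinfun_apply bounded_linear_Re bounded_linear_Im)
  have dk: "((\<lambda>x. k (t - x)) has_derivative (\<lambda>h. - frechet_derivative k (at (t - x)) h)) (at x)" for t x
  proof -
    have "((\<lambda>x. t - x) has_derivative uminus) (at x)" by (auto intro!: derivative_eq_intros)
    from has_derivative_compose[OF this smooth_has_derivative[OF k]] show ?thesis
      using smooth_has_derivative[OF k, of "t - x"]
      by (simp add: linear_neg[OF has_derivative_linear])
  qed
  have "((\<lambda>x. integral (cbox l u) (\<lambda>t. \<psi> t * k (t - x))) has_derivative integral (cbox l u) (fx a)) (at a within ball a 1)"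
  proof (rule leibniz_rule[where U = "ball a 1"])
    show "((\<lambda>x. \<psi> t * k (t - x)) has_derivative blinfun_apply (fx x t)) (at x within ball a 1)" for x t
    proof -
      have "((\<lambda>x. \<psi> t * k (t - x)) has_derivative (\<lambda>h. \<psi> t * - frechet_derivative k (at (t - x)) h)) (at x)"
        by (rule has_derivative_mult_right[OF dk])
      also have "(\<lambda>h. \<psi> t * - frechet_derivative k (at (t - x)) h) = blinfun_apply (fx x t)"
        by (rule ext, subst frechet_derivative_complex[OF smooth_differentiable[OF k]])
          (simp add: fx_def blinfun.bilinear_simps Bl algebra_simps)
      finally show ?thesis by (rule has_derivative_at_withinI)
    qed
    show "(\<lambda>t. \<psi> t * k (t - x)) integrable_on cbox l u" for x
      by (intro integrable_continuous continuous_on_mult cont[OF k] continuous_on_subset[OF \<psi>] continuous_intros) auto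
    have "continuous_on (ball a 1 \<times> cbox l u) (\<lambda>p. fx (fst p) (snd p))"
      unfolding fx_def
      by (intro continuous_intros continuous_on_compose2[OF \<psi>] cont smooth_dir_deriv k) auto
    then show "continuous_on (ball a 1 \<times> cbox l u) (\<lambda>(x, t). fx x t)"
      by (simp add: case_prod_unfold)
  qed auto
  then have "((\<lambda>x. integral (cbox l u) (\<lambda>t. \<psi> t * k (t - x))) has_derivative integral (cbox l u) (fx a)) (at a)"
    by (simp add: at_within_open[OF centre_in_ball[THEN iffD2]])
  also have "blinfun_apply (integral (cbox l u) (fx a)) = (\<lambda>h. - (Re h * T (dir_deriv 1 k) a + Im h * T (dir_deriv \<i> k) a))"
  proof
    fix h
    have int: "(\<lambda>t. - (\<psi> t * dir_deriv v k (t - a))) integrable_on cbox l u" for v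
      by (intro integrable_continuous continuous_intros cont[OF smooth_dir_deriv[OF k]] continuous_on_subset[OF \<psi>]) auto
    have "integral (cbox l u) (fx a) =
        integral (cbox l u) (\<lambda>t. - (\<psi> t * dir_deriv 1 k (t - a))) *\<^sub>R Blinfun Re
        + integral (cbox l u) (\<lambda>t. - (\<psi> t * dir_deriv \<i> k (t - a))) *\<^sub>R Blinfun Im"
      unfolding fx_def[abs_def]
      by (intro integral_unique has_integral_add has_integral_scaleR_left integrable_integral int)
    also have "\<dots> = (- T (dir_deriv 1 k) a) *\<^sub>R Blinfun Re + (- T (dir_deriv \<i> k) a) *\<^sub>R Blinfun Im"
      by (simp add: Teq[OF smooth_dir_deriv[OF k] supp'])
    finally have eq: "integral (cbox l u) (fx a) =
        (- T (dir_deriv 1 k) a) *\<^sub>R Blinfun Re + (- T (dir_deriv \<i> k) a) *\<^sub>R Blinfun Im" .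
    show "blinfun_apply (integral (cbox l u) (fx a)) h =
        - (Re h * T (dir_deriv 1 k) a + Im h * T (dir_deriv \<i> k) a)"
      unfolding eq by (simp add: blinfun.bilinear_simps Bl algebra_simps)
  qed
  finally show ?thesis
    by (rule has_derivative_transform_within_open[of _ _ _ _ "ball a 1"]) (auto simp: Teq[OF k supp])
qed

section \<open>Weyl's lemma in the plane\<close>

lemma smooth_cmod_power2: "smooth (\<lambda>z. (cmod z)\<^sup>2)"
  unfolding cmod_power2
  by (intro allI C_k_add C_k_power C_k_bounded_linear[OF bounded_linear_Re] C_k_bounded_linear[OF bounded_linear_Im])

text \<open>The squared modulus is used because \<open>cmod\<close> is not smooth at 0. The factor
  \<open>2 / r\<^sup>2\<close> places radius \<open>r / 2\<close> at the value 1/2 and radius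
  \<open>r\<close> at 2, outside the transition interval of the step.\<close>

lemma smooth_disc_cutoff:
  assumes "r > 0"
  obtains X :: "complex \<Rightarrow> real" where "smooth X" "\<And>z. cmod z \<le> r / 2 \<Longrightarrow> X z = 1"
    "\<And>z. cmod z \<ge> r \<Longrightarrow> X z = 0"
proof -
  obtain \<theta> :: "real \<Rightarrow> real" where \<theta>: "\<And>k. C_k k \<theta>" "\<And>x. x \<le> 1 \<Longrightarrow> \<theta> x = 0" "\<And>x. x \<ge> 2 \<Longrightarrow> \<theta> x = 1"
    by (rule smooth_step) blast
  define X where "X z = 1 - \<theta> (2 / r\<^sup>2 * (cmod z)\<^sup>2)" for z
  show thesis
  proof (rule that[of X])
    show "smooth X" unfolding X_def[abs_def]
      by (intro allI C_k_diff C_k_const C_k_compose_real[OF _ \<theta>(1)] C_k_cmult smooth_cmod_power2[rule_format])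
    show "X z = 1" if "cmod z \<le> r / 2" for z
    proof -
      have "(cmod z)\<^sup>2 \<le> (r / 2)\<^sup>2" using that by (intro power_mono) auto
      then have "2 / r\<^sup>2 * (cmod z)\<^sup>2 \<le> 1" using assms by (simp add: power_divide field_simps) (use zero_le_power2[of "cmod z"] in linarith)
      then show ?thesis by (simp add: X_def \<theta>(2))
    qed
    show "X z = 0" if "cmod z \<ge> r" for z
    proof -
      have "(cmod z)\<^sup>2 \<ge> r\<^sup>2" using that assms by (intro power_mono) auto
      then have "2 / r\<^sup>2 * (cmod z)\<^sup>2 \<ge> 2" using assms by (simp add: field_simps)
      then show ?thesis by (simp add: X_def \<theta>(3))
    qed
  qed
qed

text \<open>A smooth approximation of the fundamental solution of the Laplacian (up to the factor 2 pi):
  as \<open>c\<close> tends to 0 its Laplacian concentrates at the origin.\<close>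

definition log_kernel :: "real \<Rightarrow> complex \<Rightarrow> real" where
  "log_kernel c z = ln ((cmod z)\<^sup>2 + c) / 2"

context
  fixes c :: real
  assumes c: "c > 0"
begin

lemma smooth_log_kernel: "smooth (log_kernel c)"
proof -
  have "smooth (\<lambda>z. 1 / 2 * ln ((cmod z)\<^sup>2 + c))"
    by (intro allI C_k_cmult C_k_ln C_k_add smooth_cmod_power2[rule_format] C_k_const)
      (use c in \<open>simp add: add_nonneg_pos\<close>)
  then show ?thesis by (simp add: log_kernel_def[abs_def])
qed

lemma cmod_power2_has_derivative:
  "((\<lambda>z. (cmod z)\<^sup>2 + c) has_derivative (\<lambda>h. 2 * (Re z * Re h + Im z * Im h))) (at z)"
  unfolding cmod_power2 by (auto intro!: derivative_eq_intros simp: algebra_simps)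

lemma dir_deriv_log_kernel:
  "dir_deriv v (log_kernel c) z = (Re z * Re v + Im z * Im v) / ((cmod z)\<^sup>2 + c)"
proof (rule dir_derivI)
  have pos: "(cmod z)\<^sup>2 + c > 0" using c by (simp add: add_nonneg_pos)
  show "(log_kernel c has_derivative (\<lambda>h. (Re z * Re h + Im z * Im h) / ((cmod z)\<^sup>2 + c))) (at z)"
    unfolding log_kernel_def[abs_def]
    by (rule has_derivative_eq_rhs[OF has_derivative_divide'[OF has_derivative_ln[OF pos cmod_power2_has_derivative] has_derivative_const]])
      (use pos in \<open>auto simp: fun_eq_iff field_simps\<close>)
qed

text \<open>Under z = sqrt(c) u this becomes 2 / (1 + |u|^2)^2 with the Jacobian included, so the
  total mass does not depend on \<open>c\<close> and the family is an approximate delta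
  function.\<close>

lemma laplacian_log_kernel:
  "laplacian (log_kernel c) z = 2 * c / ((cmod z)\<^sup>2 + c)\<^sup>2"
proof -
  define q where "q = (cmod z)\<^sup>2 + c"
  have q: "q > 0" using c by (simp add: q_def add_nonneg_pos)
  have 1: "dir_deriv 1 (\<lambda>w. Re w / ((cmod w)\<^sup>2 + c)) z = (q - 2 * (Re z)\<^sup>2) / q\<^sup>2"
  proof (rule dir_derivI[THEN trans])
    show "((\<lambda>w. Re w / ((cmod w)\<^sup>2 + c)) has_derivative
      (\<lambda>h. (Re h * q - Re z * (2 * (Re z * Re h + Im z * Im h))) / (q * q))) (at z)"
      unfolding q_def
      by (rule has_derivative_divide'[OF bounded_linear_imp_has_derivative[OF bounded_linear_Re] cmod_power2_has_derivative])
        (use q in \<open>simp add: q_def\<close>)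
  qed (simp add: power2_eq_square)
  have 2: "dir_deriv \<i> (\<lambda>w. Im w / ((cmod w)\<^sup>2 + c)) z = (q - 2 * (Im z)\<^sup>2) / q\<^sup>2"
  proof (rule dir_derivI[THEN trans])
    show "((\<lambda>w. Im w / ((cmod w)\<^sup>2 + c)) has_derivative
      (\<lambda>h. (Im h * q - Im z * (2 * (Re z * Re h + Im z * Im h))) / (q * q))) (at z)"
      unfolding q_def
      by (rule has_derivative_divide'[OF bounded_linear_imp_has_derivative[OF bounded_linear_Im] cmod_power2_has_derivative])
        (use q in \<open>simp add: q_def\<close>)
  qed (simp add: power2_eq_square)
  have "laplacian (log_kernel c) z = (q - 2 * (Re z)\<^sup>2) / q\<^sup>2 + (q - 2 * (Im z)\<^sup>2) / q\<^sup>2"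
    unfolding laplacian_def dir_deriv_log_kernel using 1 2 by simp
  also have "\<dots> = (2 * q - 2 * ((Re z)\<^sup>2 + (Im z)\<^sup>2)) / q\<^sup>2"
    by (simp add: add_divide_distrib[symmetric])
  also have "2 * q - 2 * ((Re z)\<^sup>2 + (Im z)\<^sup>2) = 2 * c" by (simp add: q_def cmod_power2)
  finally show ?thesis by (simp add: q_def)
qed

end

text \<open>The test function is a cutoff \<open>X\<close> times \<open>log_kernel\<close>, both
  centred at \<open>a\<close>. Its Laplacian is \<open>X\<close> times the approximate delta
  function plus terms with derivatives of \<open>X\<close>, which live on the annulus between
  \<open>r / 2\<close> and \<open>r\<close>, away from the singularity of the logarithm. In the
  limit \<open>2 * c0 * \<psi> a\<close> plus the integral against \<open>k\<close> is 0, and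
  rescaling \<open>k\<close> gives the kernel.\<close>

lemma weakly_harmonic_representation:
  fixes \<psi> :: "complex \<Rightarrow> real"
  assumes \<psi>: "continuous_on UNIV \<psi>"
    and weak: "\<And>\<phi>. test_function V \<phi> \<Longrightarrow> (LINT z|lebesgue. \<psi> z * laplacian \<phi> z) = 0"
    and r: "r > 0"
  obtains k where "smooth k" "\<And>z. cmod z > r \<Longrightarrow> k z = 0"
    "\<And>a. cball a r \<subseteq> V \<Longrightarrow> \<psi> a = (LINT z|lborel. \<psi> z * k (z - a))"
proof -
  obtain X :: "complex \<Rightarrow> real" where X: "smooth X" "\<And>z. cmod z \<le> r / 2 \<Longrightarrow> X z = 1"
    "\<And>z. cmod z \<ge> r \<Longrightarrow> X z = 0"
    using smooth_disc_cutoff[OF r] by blast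
  obtain e :: "real \<Rightarrow> real" where e: "\<And>k. C_k k e" "\<And>x. x > 0 \<Longrightarrow> e x > 0" "\<And>x. x \<le> 0 \<Longrightarrow> e x = 0"
    by (rule smooth_positive_part) blast
  \<comment> \<open>\<open>Y\<close> is positive in the disc of radius \<open>r / 2\<close> and zero
    outside. Added to the squared modulus it removes the singularity of the limit kernel at 0, at
    places where \<open>G\<close> and \<open>H\<close> are 0, so that \<open>k\<close> is smooth
    without changing its values on the annulus.\<close>
  define Y where "Y z = e (r\<^sup>2 / 4 - (cmod z)\<^sup>2)" for z
  have Y0: "Y z = 0" if "cmod z \<ge> r / 2" for z
  proof -
    have "(r / 2)\<^sup>2 \<le> (cmod z)\<^sup>2" using that r by (intro power_mono) auto
    then show ?thesis by (simp add: Y_def e(3) power_divide)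
  qed
  have Ypos: "(cmod z)\<^sup>2 + Y z > 0" for z
  proof (cases "cmod z \<ge> r / 2")
    case True
    then show ?thesis using r Y0 by auto
  next
    case False
    then have "(cmod z)\<^sup>2 < (r / 2)\<^sup>2" using r by (intro power_strict_mono) auto
    then have "Y z > 0" by (simp add: Y_def e(2) power_divide)
    then show ?thesis by (simp add: add_nonneg_pos)
  qed
  have Yne: "(cmod z)\<^sup>2 + Y z \<noteq> 0" for z using Ypos[of z] by (rule less_imp_neq[THEN not_sym])
  have sY: "C_k k (\<lambda>z. (cmod z)\<^sup>2 + Y z)" for k
    unfolding Y_def
    by (intro C_k_add C_k_diff C_k_const C_k_compose_real[OF _ e(1)] smooth_cmod_power2[rule_format])
  \<comment> \<open>\<open>G\<close> is the numerator of the mixed gradient term in the Laplacian of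
    the product, \<open>H\<close> the coefficient of the logarithm; the half in \<open>H\<close> is
    the one in \<open>log_kernel\<close>.\<close>
  define G where "G z = 2 * (dir_deriv 1 X z * Re z + dir_deriv \<i> X z * Im z)" for z
  define H where "H z = laplacian X z / 2" for z
  have sG: "smooth G" unfolding G_def[abs_def]
    by (intro allI C_k_add C_k_mult C_k_const C_k_bounded_linear[OF bounded_linear_Re] C_k_bounded_linear[OF bounded_linear_Im]
        smooth_dir_deriv[OF X(1), rule_format])
  have sH: "smooth H"
    using C_k_cmult[OF smooth_laplacian[OF X(1), rule_format], of _ "1 / 2"] by (simp add: H_def[abs_def])
  have dX: "dir_deriv v X z = 0" if "cmod z < r / 2 \<or> cmod z > r" for v z
    using that
  proof
    assume "cmod z < r / 2"
    then show ?thesis by (intro dir_deriv_eq_0[of "ball 0 (r/2)" _ _ 1]) (auto simp: X(2))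
  next
    assume "cmod z > r"
    then show ?thesis by (intro dir_deriv_eq_0[of "- cball 0 r" _ _ 0]) (auto simp: X(3))
  qed
  have G0: "G z = 0" if "cmod z < r / 2 \<or> cmod z > r" for z
    unfolding G_def using dX[OF that] by simp
  have H0: "H z = 0" if "cmod z < r / 2 \<or> cmod z > r" for z
    using that unfolding H_def
  proof
    assume "cmod z < r / 2"
    then have "laplacian X z = 0" by (intro laplacian_eq_0[of "ball 0 (r/2)" _ _ 1]) (auto simp: X(2))
    then show "laplacian X z / 2 = 0" by simp
  next
    assume "cmod z > r"
    then have "laplacian X z = 0" by (intro laplacian_eq_0[of "- cball 0 r" _ _ 0]) (auto simp: X(3))
    then show "laplacian X z / 2 = 0" by simp
  qed
  define k where "k z = G z * inverse ((cmod z)\<^sup>2 + Y z) + H z * ln ((cmod z)\<^sup>2 + Y z)" for z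
  have sk: "smooth k" unfolding k_def[abs_def]
    by (intro allI C_k_add C_k_mult sG[rule_format] sH[rule_format] C_k_inverse C_k_ln sY Ypos Yne)
  have k0: "k z = 0" if "cmod z > r" for z using that by (simp add: k_def G0 H0)
  define \<epsilon> where "\<epsilon> n = 1 / real (Suc n)" for n
  have \<epsilon>: "\<epsilon> n > 0" "\<epsilon> n \<le> 1" for n by (simp_all add: \<epsilon>_def)
  have \<epsilon>0: "\<epsilon> \<longlonglongrightarrow> 0" unfolding \<epsilon>_def by (rule LIMSEQ_Suc[OF lim_1_over_n])
  define kk where "kk n z = G z / ((cmod z)\<^sup>2 + (\<epsilon> n)\<^sup>2) + H z * ln ((cmod z)\<^sup>2 + (\<epsilon> n)\<^sup>2)" for n z
  have qpos: "(cmod z)\<^sup>2 + (\<epsilon> n)\<^sup>2 > 0" for z n using \<epsilon>(1)[of n] by (simp add: add_nonneg_pos)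
  have contc: "continuous_on UNIV (\<lambda>z. f (z - a))" if "smooth f" for f :: "complex \<Rightarrow> real" and a
    using smooth_continuous_on[OF smooth_translate[OF that]] .
  define c0 where "c0 = integral\<^sup>L lborel (\<lambda>u::complex. 1 / (1 + (cmod u)\<^sup>2)\<^sup>2)"
  have c0: "c0 > 0" unfolding c0_def by (rule integral_inverse_square_plane_pos)
  have main: "2 * c0 * \<psi> a + (LINT z|lborel. \<psi> z * k (z - a)) = 0" if a: "cball a r \<subseteq> V" for a
  proof -
    have zero: "f (z - a) = 0" if "\<And>z. cmod z > r \<Longrightarrow> f z = 0" "z \<notin> cball a r" for f :: "complex \<Rightarrow> real" and z
      using that by (simp add: dist_norm norm_minus_commute)
    define A where "A n = (LINT z|lborel. \<psi> z * (X (z - a) * (2 * (\<epsilon> n)\<^sup>2 / ((cmod (z - a))\<^sup>2 + (\<epsilon> n)\<^sup>2)\<^sup>2)))" for n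
    define B where "B n = (LINT z|lborel. \<psi> z * kk n (z - a))" for n
    have AB: "A n + B n = 0" for n
    proof -
      define c where "c = (\<epsilon> n)\<^sup>2"
      have c: "c > 0" using \<epsilon>(1)[of n] by (simp add: c_def)
      define XL where "XL z = X z * log_kernel c z" for z
      have sXL: "smooth XL" unfolding XL_def[abs_def]
        by (intro allI C_k_mult X(1)[rule_format] smooth_log_kernel[OF c, rule_format])
      have lap: "laplacian XL z = X z * (2 * c / ((cmod z)\<^sup>2 + c)\<^sup>2) + kk n z" for z
      proof -
        have "laplacian XL z = X z * (2 * c / ((cmod z)\<^sup>2 + c)\<^sup>2)
            + 2 * (dir_deriv 1 X z * (Re z / ((cmod z)\<^sup>2 + c)) + dir_deriv \<i> X z * (Im z / ((cmod z)\<^sup>2 + c)))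
            + laplacian X z * log_kernel c z"
          unfolding XL_def[abs_def] laplacian_mult[OF X(1) smooth_log_kernel[OF c]]
            dir_deriv_log_kernel[OF c] laplacian_log_kernel[OF c] by simp
        then show ?thesis
          by (simp add: kk_def G_def H_def log_kernel_def add_divide_distrib flip: c_def)
      qed
      have tf: "test_function V (\<lambda>z. XL (z - a))"
        unfolding test_function_def
      proof (intro conjI exI[of _ "cball a r"] allI impI)
        show "C_k k (\<lambda>z. XL (z - a))" for k using smooth_translate[OF sXL] by blast
        show "XL (z - a) = 0" if "z \<notin> cball a r" for z
          by (rule zero[OF _ that]) (simp add: XL_def X(3))
      qed (use a in auto)
      have "(LINT z|lebesgue. \<psi> z * laplacian XL (z - a)) = 0"
        using weak[OF tf] unfolding laplacian_translate[OF sXL] .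
      moreover have meas: "(\<lambda>z. \<psi> z * laplacian XL (z - a)) \<in> borel_measurable lborel"
        using continuous_on_mult[OF \<psi> contc[OF smooth_laplacian[OF sXL], of a]]
        by (simp add: borel_measurable_continuous_onI)
      ultimately have 0: "(LINT z|lborel. \<psi> z * laplacian XL (z - a)) = 0"
        by (simp add: integral_completion)
      have ne: "(cmod z)\<^sup>2 + c \<noteq> 0" for z using c by (metis add_nonneg_pos less_irrefl zero_le_power2)
      have i1: "integrable lborel (\<lambda>z. \<psi> z * (X (z - a) * (2 * c / ((cmod (z - a))\<^sup>2 + c)\<^sup>2)))"
        by (rule integrable_compact_support[of _ "cball a r"])
          (auto intro!: continuous_intros \<psi> contc[OF X(1)] simp: ne X(3) dist_norm norm_minus_commute)
      have "continuous_on UNIV (\<lambda>z. kk n (z - a))"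
        unfolding kk_def c_def[symmetric]
        by (intro continuous_intros contc[OF sG] contc[OF sH]) (use ne c in \<open>auto simp: ne add_nonneg_pos\<close>)
      then have i2: "integrable lborel (\<lambda>z. \<psi> z * kk n (z - a))"
        by (intro integrable_compact_support[of _ "cball a r"] continuous_on_mult \<psi>)
          (auto simp: kk_def G0 H0 dist_norm norm_minus_commute)
      have "A n + B n = (LINT z|lborel. \<psi> z * laplacian XL (z - a))"
        unfolding A_def B_def c_def[symmetric] lap distrib_left
        using Bochner_Integration.integral_add[OF i1 i2] by simp
      then show ?thesis using 0 by simp
    qed
    have "A \<longlonglongrightarrow> 2 * c0 * \<psi> a"
    proof -
      define f where "f z = \<psi> (a + z) * X z" for z
      have cf: "continuous_on UNIV f" unfolding f_def[abs_def]
        by (intro continuous_intros continuous_on_compose2[OF \<psi>] smooth_continuous_on X(1)) auto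
      obtain M where M: "M > 0" "\<And>z. \<bar>f z\<bar> \<le> M"
        by (rule bounded_compact_support[OF cf compact_cball[of 0 r]]) (auto simp: f_def X(3))
      \<comment> \<open>Substituting z = a + \<epsilon> u, the Jacobian turns the concentrating
        factor into a profile that does not depend on \<open>n\<close>; the dependence moves into
        the continuous function \<open>f\<close>.\<close>
      have Aeq: "A n = (LINT u|lborel. f (\<epsilon> n *\<^sub>R u) * (2 * (1 / (1 + (cmod u)\<^sup>2)\<^sup>2)))" for n
      proof -
        have meas: "(\<lambda>z. \<psi> z * (X (z - a) * (2 * (\<epsilon> n)\<^sup>2 / ((cmod (z - a))\<^sup>2 + (\<epsilon> n)\<^sup>2)\<^sup>2))) \<in> borel_measurable borel"
          by (intro borel_measurable_continuous_onI continuous_intros \<psi> contc[OF X(1)])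
            (use \<epsilon>(1)[of n] in auto)
        have "A n = (LINT u|lborel. (\<epsilon> n)\<^sup>2 * (\<psi> (a + \<epsilon> n *\<^sub>R u) * (X (\<epsilon> n *\<^sub>R u) *
            (2 * (\<epsilon> n)\<^sup>2 / ((cmod (\<epsilon> n *\<^sub>R u))\<^sup>2 + (\<epsilon> n)\<^sup>2)\<^sup>2))))"
          unfolding A_def integral_mult_right_zero
          by (subst integral_lborel_affine[OF meas, of "\<epsilon> n" a]) (use \<epsilon>(1)[of n] in auto)
        also have "\<dots> = (LINT u|lborel. f (\<epsilon> n *\<^sub>R u) * (2 * (1 / (1 + (cmod u)\<^sup>2)\<^sup>2)))"
        proof (rule Bochner_Integration.integral_cong[OF refl])
          fix u
          have "(cmod (\<epsilon> n *\<^sub>R u))\<^sup>2 + (\<epsilon> n)\<^sup>2 = (\<epsilon> n)\<^sup>2 * (1 + (cmod u)\<^sup>2)"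
            by (simp add: power_mult_distrib algebra_simps)
          then have e: "(\<epsilon> n)\<^sup>2 * (2 * (\<epsilon> n)\<^sup>2 / ((cmod (\<epsilon> n *\<^sub>R u))\<^sup>2 + (\<epsilon> n)\<^sup>2)\<^sup>2) = 2 * (1 / (1 + (cmod u)\<^sup>2)\<^sup>2)"
            using \<epsilon>(1)[of n] by (simp only: power_mult_distrib) (simp add: power2_eq_square)
          show "(\<epsilon> n)\<^sup>2 * (\<psi> (a + \<epsilon> n *\<^sub>R u) * (X (\<epsilon> n *\<^sub>R u) *
            (2 * (\<epsilon> n)\<^sup>2 / ((cmod (\<epsilon> n *\<^sub>R u))\<^sup>2 + (\<epsilon> n)\<^sup>2)\<^sup>2))) = f (\<epsilon> n *\<^sub>R u) * (2 * (1 / (1 + (cmod u)\<^sup>2)\<^sup>2))"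
            by (simp only: f_def mult.assoc mult.left_commute[of "(\<epsilon> n)\<^sup>2"] e)
        qed
        finally show ?thesis .
      qed
      have "(\<lambda>n. LINT u|lborel. f (\<epsilon> n *\<^sub>R u) * (2 * (1 / (1 + (cmod u)\<^sup>2)\<^sup>2)))
          \<longlonglongrightarrow> (LINT u|lborel. f 0 * (2 * (1 / (1 + (cmod u)\<^sup>2)\<^sup>2)))"
      proof (rule integral_dominated_convergence[where w = "\<lambda>u. M * (2 * (1 / (1 + (cmod u)\<^sup>2)\<^sup>2))"])
        show "integrable lborel (\<lambda>u::complex. M * (2 * (1 / (1 + (cmod u)\<^sup>2)\<^sup>2)))"
          by (intro integrable_mult_right impI integrable_inverse_square_plane)
        have ne: "1 + (cmod u)\<^sup>2 \<noteq> 0" for u by (metis add_pos_nonneg less_irrefl zero_le_power2 zero_less_one)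
        show "(\<lambda>u. f (\<epsilon> n *\<^sub>R u) * (2 * (1 / (1 + (cmod u)\<^sup>2)\<^sup>2))) \<in> borel_measurable lborel" for n
          unfolding measurable_lborel2
          by (intro borel_measurable_continuous_onI continuous_intros continuous_on_compose2[OF cf])
            (auto simp: ne)
        show "AE u in lborel. (\<lambda>n. f (\<epsilon> n *\<^sub>R u) * (2 * (1 / (1 + (cmod u)\<^sup>2)\<^sup>2)))
            \<longlonglongrightarrow> f 0 * (2 * (1 / (1 + (cmod u)\<^sup>2)\<^sup>2))"
        proof (intro AE_I2 tendsto_mult tendsto_const)
          fix u :: complex
          have "(\<lambda>n. \<epsilon> n *\<^sub>R u) \<longlonglongrightarrow> 0 *\<^sub>R u" by (intro tendsto_scaleR \<epsilon>0 tendsto_const)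
          then show "(\<lambda>n. f (\<epsilon> n *\<^sub>R u)) \<longlonglongrightarrow> f 0"
            using cf by (intro continuous_on_tendsto_compose[OF cf]) auto
        qed
        show "AE u in lborel. norm (f (\<epsilon> n *\<^sub>R u) * (2 * (1 / (1 + (cmod u)\<^sup>2)\<^sup>2))) \<le> M * (2 * (1 / (1 + (cmod u)\<^sup>2)\<^sup>2))" for n
          using M(2) by (intro AE_I2) (auto simp: abs_mult intro!: divide_right_mono)
      qed simp
      moreover have "(LINT u|lborel. f 0 * (2 * (1 / (1 + (cmod u)\<^sup>2)\<^sup>2))) = 2 * c0 * \<psi> a"
        using r unfolding c0_def integral_mult_right_zero by (simp add: f_def X(2))
      ultimately show ?thesis by (simp add: Aeq[abs_def])
    qed
    moreover have "B \<longlonglongrightarrow> (LINT z|lborel. \<psi> z * k (z - a))"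
      unfolding B_def
    proof (rule integral_dominated_convergence)
      \<comment> \<open>On the annulus that carries \<open>H\<close> the argument of the logarithm
        stays between r^2 / 4 and r^2 + 1, uniformly in \<open>n\<close>.\<close>
      define C where "C = \<bar>ln (r\<^sup>2 / 4)\<bar> + \<bar>ln (r\<^sup>2 + 1)\<bar>"
      define w where "w z = \<bar>\<psi> z\<bar> * (\<bar>G (z - a)\<bar> * (4 / r\<^sup>2) + \<bar>H (z - a)\<bar> * C)" for z
      show "integrable lborel w" unfolding w_def
        by (rule integrable_compact_support[of _ "cball a r"])
          (use r in \<open>auto intro!: continuous_intros \<psi> contc[OF sG] contc[OF sH] simp: G0 H0 dist_norm norm_minus_commute\<close>)
      show "AE z in lborel. norm (\<psi> z * kk n (z - a)) \<le> w z" for n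
      proof (rule AE_I2)
        fix z
        have "\<bar>kk n (z - a)\<bar> \<le> \<bar>G (z - a)\<bar> * (4 / r\<^sup>2) + \<bar>H (z - a)\<bar> * C"
        proof (cases "cmod (z - a) < r / 2 \<or> cmod (z - a) > r")
          case True
          then show ?thesis by (simp add: kk_def G0 H0)
        next
          case False
          let ?q = "(cmod (z - a))\<^sup>2 + (\<epsilon> n)\<^sup>2"
          have "(r / 2)\<^sup>2 \<le> (cmod (z - a))\<^sup>2" "(cmod (z - a))\<^sup>2 \<le> r\<^sup>2" "(\<epsilon> n)\<^sup>2 \<le> 1"
            using False r \<epsilon>[of n] by (auto intro!: power_mono simp: power_le_one)
          moreover have "(r / 2)\<^sup>2 = r\<^sup>2 / 4" "0 \<le> (\<epsilon> n)\<^sup>2" by (simp_all add: power_divide)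
          ultimately have q: "r\<^sup>2 / 4 \<le> ?q" "?q \<le> r\<^sup>2 + 1" by linarith+
          have r2: "r\<^sup>2 / 4 > 0" using r by simp
          have "ln (r\<^sup>2 / 4) \<le> ln ?q" "ln ?q \<le> ln (r\<^sup>2 + 1)" using q r2 qpos[of "z - a" n] by (simp_all add: add_nonneg_pos)
          then have l: "\<bar>ln ?q\<bar> \<le> C" unfolding C_def by linarith
          have "\<bar>G (z - a) / ?q\<bar> \<le> \<bar>G (z - a)\<bar> / (r\<^sup>2 / 4)"
            using q r2 qpos[of "z - a" n] by (simp only: abs_divide abs_of_pos) (intro divide_left_mono mult_pos_pos; simp)
          moreover have "\<bar>H (z - a) * ln ?q\<bar> \<le> \<bar>H (z - a)\<bar> * C" using l by (simp add: abs_mult mult_left_mono)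
          ultimately show ?thesis unfolding kk_def
            by (intro order_trans[OF abs_triangle_ineq] add_mono) auto
        qed
        then show "norm (\<psi> z * kk n (z - a)) \<le> w z"
          by (simp add: w_def abs_mult mult_left_mono)
      qed
      show "AE z in lborel. (\<lambda>n. \<psi> z * kk n (z - a)) \<longlonglongrightarrow> \<psi> z * k (z - a)"
      proof (rule AE_I2)
        fix z
        show "(\<lambda>n. \<psi> z * kk n (z - a)) \<longlonglongrightarrow> \<psi> z * k (z - a)"
        proof (cases "cmod (z - a) < r / 2")
          case True
          then show ?thesis by (simp add: kk_def k_def G0 H0)
        next
          case False
          then have nz: "cmod (z - a) > 0" using r by linarith
          have l: "(\<lambda>n. (cmod (z - a))\<^sup>2 + (\<epsilon> n)\<^sup>2) \<longlonglongrightarrow> (cmod (z - a))\<^sup>2 + 0\<^sup>2"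
            by (intro tendsto_intros \<epsilon>0)
          have "(\<lambda>n. kk n (z - a)) \<longlonglongrightarrow> G (z - a) / ((cmod (z - a))\<^sup>2 + 0\<^sup>2) + H (z - a) * ln ((cmod (z - a))\<^sup>2 + 0\<^sup>2)"
            unfolding kk_def using nz by (intro tendsto_intros l) auto
          then have "(\<lambda>n. kk n (z - a)) \<longlonglongrightarrow> k (z - a)"
          proof -
            have "Y (z - a) = 0" using Y0[of "z - a"] False by linarith
            then have "k (z - a) = G (z - a) / ((cmod (z - a))\<^sup>2 + 0\<^sup>2) + H (z - a) * ln ((cmod (z - a))\<^sup>2 + 0\<^sup>2)"
              by (simp add: k_def divide_inverse)
            then show "(\<lambda>n. kk n (z - a)) \<longlonglongrightarrow> k (z - a)"
              if "(\<lambda>n. kk n (z - a)) \<longlonglongrightarrow> G (z - a) / ((cmod (z - a))\<^sup>2 + 0\<^sup>2) + H (z - a) * ln ((cmod (z - a))\<^sup>2 + 0\<^sup>2)"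
              using that by (simp only:)
          qed
          then show ?thesis by (intro tendsto_intros)
        qed
      qed
      show "(\<lambda>z. \<psi> z * k (z - a)) \<in> borel_measurable lborel"
        using continuous_on_mult[OF \<psi> contc[OF sk]] by (simp add: borel_measurable_continuous_onI)
      show "(\<lambda>z. \<psi> z * kk n (z - a)) \<in> borel_measurable lborel" for n
        unfolding measurable_lborel2 kk_def
        by (intro borel_measurable_continuous_onI continuous_intros \<psi> contc[OF sG] contc[OF sH])
          (use \<epsilon>(1)[of n] qpos in \<open>auto simp: add_nonneg_pos\<close>)
    qed
    ultimately have "(\<lambda>n. A n + B n) \<longlonglongrightarrow> 2 * c0 * \<psi> a + (LINT z|lborel. \<psi> z * k (z - a))"
      by (rule tendsto_add)
    then show ?thesis by (simp add: AB LIMSEQ_const_iff)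
  qed
  show thesis
  proof (rule that[of "\<lambda>z. - 1 / (2 * c0) * k z"])
    show "smooth (\<lambda>z. - 1 / (2 * c0) * k z)" by (intro allI C_k_cmult sk[rule_format])
    show "- 1 / (2 * c0) * k z = 0" if "cmod z > r" for z using k0[OF that] by simp
    show "\<psi> a = (LINT z|lborel. \<psi> z * (- 1 / (2 * c0) * k (z - a)))" if "cball a r \<subseteq> V" for a
    proof -
      have "(LINT z|lborel. \<psi> z * (- 1 / (2 * c0) * k (z - a))) = (LINT z|lborel. - 1 / (2 * c0) * (\<psi> z * k (z - a)))"
        by (simp add: mult_ac)
      also have "\<dots> = - 1 / (2 * c0) * (LINT z|lborel. \<psi> z * k (z - a))"
        by (rule integral_mult_right_zero)
      also have "\<dots> = \<psi> a" using main[OF that] c0 by (simp add: field_simps)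
      finally show ?thesis ..
    qed
  qed
qed

text \<open>The radius is half that of a disc inside \<open>V\<close>, so one kernel reproduces
  \<psi> at every centre near \<open>b\<close>. The partial derivatives of \<psi> are then
  convolutions of \<psi> with derivatives of the kernel; these are differentiable for the same
  reason, hence continuous.\<close>

lemma weakly_harmonic_imp_C1:
  fixes \<psi> :: "complex \<Rightarrow> real"
  assumes \<psi>: "continuous_on UNIV \<psi>" and V: "open V"
    and weak: "\<And>\<phi>. test_function V \<phi> \<Longrightarrow> (LINT z|lebesgue. \<psi> z * laplacian \<phi> z) = 0"
  shows "\<forall>z\<in>V. \<psi> differentiable (at z)" and "continuous_on V (grad \<psi>)"
proof -
  have "\<psi> differentiable (at b) \<and> isCont (grad \<psi>) b" if b: "b \<in> V" for b
  proof -
    obtain s where s: "s > 0" "cball b s \<subseteq> V" using V b open_contains_cball by metis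
    define r where "r = s / 2"
    have r: "r > 0" using s by (simp add: r_def)
    obtain k where k: "smooth k" "\<And>z. cmod z > r \<Longrightarrow> k z = 0"
      and rep: "\<And>a. cball a r \<subseteq> V \<Longrightarrow> \<psi> a = (LINT z|lborel. \<psi> z * k (z - a))"
      using weakly_harmonic_representation[OF \<psi> weak r] by blast
    define T where "T k a = (LINT z|lborel. \<psi> z * k (z - a))" for k a
    have sub: "cball a r \<subseteq> V" if "a \<in> ball b r" for a
    proof -
      have "x \<in> cball b s" if "x \<in> cball a r" for x
        using that \<open>a \<in> ball b r\<close> dist_triangle[of b x a] by (simp add: r_def dist_commute)
      then show ?thesis using s(2) by blast
    qed
    have T: "(T k has_derivative (\<lambda>h. - (Re h * T (dir_deriv 1 k) a + Im h * T (dir_deriv \<i> k) a))) (at a)"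
      if "smooth k" "\<And>z. cmod z > r \<Longrightarrow> k z = 0" for k a
      unfolding T_def[abs_def] by (rule convolution_has_derivative[OF \<psi> that])
    have d\<psi>: "(\<psi> has_derivative (\<lambda>h. - (Re h * T (dir_deriv 1 k) a + Im h * T (dir_deriv \<i> k) a))) (at a)"
      if "a \<in> ball b r" for a
      by (rule has_derivative_transform_within_open[OF T[OF k] open_ball that])
        (use rep sub in \<open>simp_all add: T_def\<close>)
    have grad: "Complex (- T (dir_deriv 1 k) a) (- T (dir_deriv \<i> k) a) = grad \<psi> a" if "a \<in> ball b r" for a
      unfolding grad_def dir_derivI[OF d\<psi>[OF that]] by simp
    have supp': "dir_deriv v k z = 0" if "cmod z > r" for v z
      by (rule dir_deriv_eq_0[of "- cball 0 r"]) (use that k(2) in auto)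
    have contT: "isCont (T (dir_deriv v k)) a" for v a
      using T[OF smooth_dir_deriv[OF k(1)] supp'] has_derivative_continuous by blast
    have *: "isCont (\<lambda>a. Complex (- T (dir_deriv 1 k) a) (- T (dir_deriv \<i> k) a)) b"
      unfolding Complex_eq by (intro continuous_intros contT)
    have br: "b \<in> ball b r" using r by simp
    have ev: "\<forall>\<^sub>F a in nhds b. Complex (- T (dir_deriv 1 k) a) (- T (dir_deriv \<i> k) a) = grad \<psi> a"
      using eventually_nhds_in_open[OF open_ball br] by (rule eventually_mono) (rule grad)
    from * have "isCont (grad \<psi>) b" using isCont_cong[OF ev] by simp
    then show ?thesis using d\<psi>[OF br] by (auto simp: differentiable_def)
  qed
  then show "\<forall>z\<in>V. \<psi> differentiable (at z)" and "continuous_on V (grad \<psi>)"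
    by (auto simp: continuous_at_imp_continuous_on)
qed

section \<open>Odd extension across the axes\<close>

text \<open>The Jacobian is a product of signs. The coordinate form covers reflections of the plane
  and reflections of the space variable in time and space together.\<close>

lemma lebesgue_sign_change:
  fixes c :: "'a::euclidean_space \<Rightarrow> real"
  assumes c: "\<And>j. j \<in> Basis \<Longrightarrow> \<bar>c j\<bar> = 1" and T: "\<And>x. T x = (\<Sum>j\<in>Basis. (c j * (x \<bullet> j)) *\<^sub>R j)"
  shows "T \<in> lebesgue \<rightarrow>\<^sub>M lebesgue" and "distr lebesgue lebesgue T = lebesgue"
proof -
  have T': "T = (\<lambda>x. 0 + (\<Sum>j\<in>Basis. (c j * (x \<bullet> j)) *\<^sub>R j))" using T by auto
  have c0: "c j \<noteq> 0" if "j \<in> Basis" for j using c[OF that] by auto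
  show m: "T \<in> lebesgue \<rightarrow>\<^sub>M lebesgue" unfolding T' by (rule lebesgue_affine_measurable[OF c0])
  have "(lebesgue :: 'a measure) = density (distr lebesgue lebesgue T) (\<lambda>_. (\<Prod>j\<in>Basis. \<bar>c j\<bar>))"
    unfolding T' by (rule lebesgue_affine_euclidean[OF c0])
  also have "\<dots> = distr lebesgue lebesgue T" using c by (simp add: density_1 prod.neutral)
  finally show "distr lebesgue lebesgue T = lebesgue" ..
qed

text \<open>With signs for \<open>a\<close> and \<open>b\<close> this is the identity, one of the
  two axis reflections or the point reflection, so that all four cases share their proofs.\<close>

definition axis_refl :: "real \<Rightarrow> real \<Rightarrow> complex \<Rightarrow> complex" where
  "axis_refl a b z = Complex (a * Re z) (b * Im z)"

lemma axis_refl_sel [simp]: "Re (axis_refl a b z) = a * Re z" "Im (axis_refl a b z) = b * Im z"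
  by (simp_all add: axis_refl_def)

lemma axis_refl_1_1 [simp]: "axis_refl 1 1 z = z" by (simp add: complex_eq_iff)

lemma axis_refl_refl: "axis_refl a b (axis_refl c d z) = axis_refl (a * c) (b * d) z"
  by (simp add: axis_refl_def)

lemma sign_mult_self: "\<bar>a\<bar> = 1 \<Longrightarrow> a * a = (1::real)"
  by (auto simp: abs_if split: if_splits)

lemma axis_refl_involution: "\<bar>a\<bar> = 1 \<Longrightarrow> \<bar>b\<bar> = 1 \<Longrightarrow> axis_refl a b (axis_refl a b z) = z"
  by (simp add: axis_refl_refl sign_mult_self)

lemma cmod_axis_refl: "\<bar>a\<bar> = 1 \<Longrightarrow> \<bar>b\<bar> = 1 \<Longrightarrow> cmod (axis_refl a b z) = cmod z"
  using sign_mult_self[of a] sign_mult_self[of b]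
  by (simp add: cmod_def power_mult_distrib flip: power2_eq_square)

lemma bounded_linear_axis_refl: "bounded_linear (axis_refl a b)"
proof -
  have "axis_refl a b = (\<lambda>z. (a * Re z) *\<^sub>R 1 + (b * Im z) *\<^sub>R \<i>)"
    by (auto simp: complex_eq_iff)
  moreover have "bounded_linear \<dots>"
    by (intro bounded_linear_add bounded_linear_scaleR_left[THEN bounded_linear_compose]
        bounded_linear_const_mult bounded_linear_Re bounded_linear_Im)
  ultimately show ?thesis by simp
qed

lemma axis_refl_lebesgue:
  assumes "\<bar>a\<bar> = 1" "\<bar>b\<bar> = 1"
  shows "axis_refl a b \<in> lebesgue \<rightarrow>\<^sub>M lebesgue" and "distr lebesgue lebesgue (axis_refl a b) = lebesgue"
proof -
  have T: "axis_refl a b x = (\<Sum>j\<in>Basis. ((if j = 1 then a else b) * (x \<bullet> j)) *\<^sub>R j)" for x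
    by (simp add: Basis_complex_def complex_eq_iff)
  show "axis_refl a b \<in> lebesgue \<rightarrow>\<^sub>M lebesgue" "distr lebesgue lebesgue (axis_refl a b) = lebesgue"
    by (rule lebesgue_sign_change[OF _ T]; use assms in simp)+
qed

lemma axis_refl_time_lebesgue:
  fixes a b :: real
  assumes "\<bar>a\<bar> = 1" "\<bar>b\<bar> = 1"
  defines "T \<equiv> \<lambda>p::real \<times> complex. (fst p, axis_refl a b (snd p))"
  shows "T \<in> lebesgue \<rightarrow>\<^sub>M lebesgue" and "distr lebesgue lebesgue T = lebesgue"
proof -
  define c where "c j = (if snd j = 1 then a else if snd j = \<i> then b else 1)" for j :: "real \<times> complex"
  have T: "T x = (\<Sum>j\<in>Basis. (c j * (x \<bullet> j)) *\<^sub>R j)" for x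
    by (simp add: T_def c_def sum_Basis_prod_eq Basis_complex_def prod_eq_iff complex_eq_iff
      inner_prod_def inner_complex_def)
  show "T \<in> lebesgue \<rightarrow>\<^sub>M lebesgue" "distr lebesgue lebesgue T = lebesgue"
    by (rule lebesgue_sign_change[OF _ T]; use assms in \<open>simp add: c_def\<close>)+
qed

lemma has_bochner_integral_involution:
  fixes f :: "'a \<Rightarrow> real"
  assumes T: "T \<in> M \<rightarrow>\<^sub>M M" "distr M M T = M" "\<And>x. T (T x) = x" and f: "has_bochner_integral M f I"
  shows "has_bochner_integral M (\<lambda>x. f (T x)) I"
proof -
  have m: "f \<in> borel_measurable M" using f by (auto simp: has_bochner_integral_iff)
  have "has_bochner_integral (distr M M T) (\<lambda>x. f (T x)) I"
    by (rule has_bochner_integral_distr) (use m T f in \<open>auto intro: measurable_compose\<close>)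
  then show ?thesis using T(2) by simp
qed

lemma dir_deriv_axis_refl:
  assumes "f differentiable at (axis_refl a b z)"
  shows "dir_deriv 1 (\<lambda>z. f (axis_refl a b z)) z = a * dir_deriv 1 f (axis_refl a b z)"
    and "dir_deriv \<i> (\<lambda>z. f (axis_refl a b z)) z = b * dir_deriv \<i> f (axis_refl a b z)"
proof -
  have lin: "linear (frechet_derivative f (at (axis_refl a b z)))"
    using assms by (simp add: linear_frechet_derivative)
  have e: "axis_refl a b 1 = a *\<^sub>R 1" "axis_refl a b \<i> = b *\<^sub>R \<i>" by (simp_all add: complex_eq_iff)
  have "dir_deriv v (\<lambda>z. f (axis_refl a b z)) z = dir_deriv (axis_refl a b v) f (axis_refl a b z)" for v
    using dir_deriv_compose_affine[OF _ bounded_linear_axis_refl, of f a b z 0 v] assms by simp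
  then show "dir_deriv 1 (\<lambda>z. f (axis_refl a b z)) z = a * dir_deriv 1 f (axis_refl a b z)"
    "dir_deriv \<i> (\<lambda>z. f (axis_refl a b z)) z = b * dir_deriv \<i> f (axis_refl a b z)"
    by (simp_all only: e linear_cmul[OF lin] real_scaleR_def)
qed

lemma smooth_axis_refl: "smooth f \<Longrightarrow> smooth (\<lambda>z. f (axis_refl a b z))"
  using C_k_compose_linear[OF _ bounded_linear_axis_refl] by blast

lemma laplacian_axis_refl:
  assumes f: "smooth f" and ab: "\<bar>a\<bar> = 1" "\<bar>b\<bar> = 1"
  shows "laplacian (\<lambda>z. f (axis_refl a b z)) z = laplacian f (axis_refl a b z)"
proof -
  have 1: "dir_deriv 1 (\<lambda>z. f (axis_refl a b z)) = (\<lambda>z. a * dir_deriv 1 f (axis_refl a b z))"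
    and 2: "dir_deriv \<i> (\<lambda>z. f (axis_refl a b z)) = (\<lambda>z. b * dir_deriv \<i> f (axis_refl a b z))"
    using f by (auto simp: dir_deriv_axis_refl smooth_differentiable)
  have s: "smooth (\<lambda>z. dir_deriv v f (axis_refl a b z))" for v
    by (rule smooth_axis_refl[OF smooth_dir_deriv[OF f]])
  have d: "dir_deriv 1 (\<lambda>z. dir_deriv 1 f (axis_refl a b z)) z = a * dir_deriv 1 (dir_deriv 1 f) (axis_refl a b z)"
    "dir_deriv \<i> (\<lambda>z. dir_deriv \<i> f (axis_refl a b z)) z = b * dir_deriv \<i> (dir_deriv \<i> f) (axis_refl a b z)"
    by (rule dir_deriv_axis_refl[OF smooth_differentiable[OF smooth_dir_deriv[OF f]]])+
  show ?thesis
    unfolding laplacian_def 1 2 dir_deriv_cmult[OF smooth_differentiable[OF s]] d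
    by (simp add: sign_mult_self[OF ab(1)] sign_mult_self[OF ab(2)] flip: mult.assoc)
qed

text \<open>The sum over the four reflections is weighted by the product of the signs. It plays two
  roles: for functions that vanish off the quarter disc it is the odd extension, for test functions
  in the disc it is the odd symmetrization.\<close>

definition odd_ext :: "(complex \<Rightarrow> real) \<Rightarrow> complex \<Rightarrow> real" where
  "odd_ext f z = f (axis_refl 1 1 z) - f (axis_refl 1 (- 1) z) - f (axis_refl (- 1) 1 z) + f (axis_refl (- 1) (- 1) z)"

lemma smooth_odd_ext:
  assumes "smooth f"
  shows "smooth (odd_ext f)"
  unfolding odd_ext_def[abs_def]
  by (intro allI C_k_add C_k_diff smooth_axis_refl[OF assms, rule_format])

lemma laplacian_odd_ext:
  assumes "smooth f"
  shows "laplacian (odd_ext f) z = odd_ext (laplacian f) z"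
proof -
  have s: "smooth (\<lambda>z. c * f (axis_refl a b z))" for a b c
    by (intro allI C_k_cmult smooth_axis_refl[OF assms, rule_format])
  have L: "laplacian (\<lambda>z. c * f (axis_refl a b z)) z = c * laplacian f (axis_refl a b z)"
    if "\<bar>a\<bar> = 1" "\<bar>b\<bar> = 1" for a b c
    by (simp only: laplacian_cmult[OF smooth_axis_refl[OF assms]] laplacian_axis_refl[OF assms that])
  have e: "odd_ext f = (\<lambda>z. 1 * f (axis_refl 1 1 z) + (- 1 * f (axis_refl 1 (- 1) z) + (- 1 * f (axis_refl (- 1) 1 z) + 1 * f (axis_refl (- 1) (- 1) z))))"
    by (auto simp: odd_ext_def)
  have l: "laplacian (\<lambda>z. 1 * f (axis_refl 1 1 z) + (- 1 * f (axis_refl 1 (- 1) z) + (- 1 * f (axis_refl (- 1) 1 z) + 1 * f (axis_refl (- 1) (- 1) z)))) z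
      = 1 * laplacian f (axis_refl 1 1 z) + (- 1 * laplacian f (axis_refl 1 (- 1) z)
      + (- 1 * laplacian f (axis_refl (- 1) 1 z) + 1 * laplacian f (axis_refl (- 1) (- 1) z)))"
  proof -
    note a = s[of 1 1 1] s[of "- 1" 1 "- 1"] s[of "- 1" "- 1" 1] s[of 1 "- 1" "- 1"]
    have b: "smooth (\<lambda>z. - 1 * f (axis_refl (- 1) 1 z) + 1 * f (axis_refl (- 1) (- 1) z))"
      by (intro allI C_k_add a[rule_format])
    have c: "smooth (\<lambda>z. - 1 * f (axis_refl 1 (- 1) z) + (- 1 * f (axis_refl (- 1) 1 z) + 1 * f (axis_refl (- 1) (- 1) z)))"
      by (intro allI C_k_add a[rule_format])
    show ?thesis
      by (subst laplacian_add[OF a(1) c], subst laplacian_add[OF a(2) b], subst laplacian_add[OF a(3) a(4)])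
        (simp only: L abs_one abs_minus_cancel)
  qed
  show ?thesis
    unfolding e l by (simp only: odd_ext_def mult_1_left mult_minus_left diff_conv_add_uminus add.assoc)
qed

text \<open>Each reflection is an involution that preserves Lebesgue measure, so the operator is
  symmetric and can be moved from one factor to the other.\<close>

lemma integral_odd_ext:
  assumes int: "\<And>a b. \<bar>a\<bar> = 1 \<Longrightarrow> \<bar>b\<bar> = 1 \<Longrightarrow> integrable lebesgue (\<lambda>z. u (axis_refl a b z) * v z)"
  shows "(LINT z|lebesgue. odd_ext u z * v z) = (LINT z|lebesgue. u z * odd_ext v z)"
proof -
  define J where "J a b = (LINT z|lebesgue. u (axis_refl a b z) * v z)" for a b
  have 1: "has_bochner_integral lebesgue (\<lambda>z. u (axis_refl a b z) * v z) (J a b)" if "\<bar>a\<bar> = 1" "\<bar>b\<bar> = 1" for a b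
    unfolding J_def by (rule has_bochner_integral_integrable[OF int[OF that]])
  have 2: "has_bochner_integral lebesgue (\<lambda>z. u z * v (axis_refl a b z)) (J a b)" if "\<bar>a\<bar> = 1" "\<bar>b\<bar> = 1" for a b
    using has_bochner_integral_involution[OF axis_refl_lebesgue[OF that] axis_refl_involution[OF that] 1[OF that]]
    by (simp only: axis_refl_involution[OF that])
  have "has_bochner_integral lebesgue (\<lambda>z. odd_ext u z * v z) (J 1 1 - J 1 (- 1) - J (- 1) 1 + J (- 1) (- 1))"
    unfolding odd_ext_def ring_distribs
    by (intro has_bochner_integral_add has_bochner_integral_diff 1) auto
  moreover have "has_bochner_integral lebesgue (\<lambda>z. u z * odd_ext v z) (J 1 1 - J 1 (- 1) - J (- 1) 1 + J (- 1) (- 1))"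
    unfolding odd_ext_def ring_distribs
    by (intro has_bochner_integral_add has_bochner_integral_diff 2) auto
  ultimately show ?thesis by (simp add: has_bochner_integral_iff)
qed

section \<open>Cutting off near the axes\<close>

lemma dir_deriv_compose_real:
  fixes \<theta> :: "real \<Rightarrow> real"
  assumes "smooth \<theta>" "bounded_linear l"
  shows "dir_deriv v (\<lambda>z. \<theta> (l z)) z = l v * dir_deriv 1 \<theta> (l z)"
proof (rule dir_derivI)
  have lin: "frechet_derivative \<theta> (at y) h = h * dir_deriv 1 \<theta> y" for y h
    using linear_cmul[OF has_derivative_linear[OF smooth_has_derivative[OF assms(1)]], of y h 1] by simp
  show "((\<lambda>z. \<theta> (l z)) has_derivative (\<lambda>v. l v * dir_deriv 1 \<theta> (l z))) (at z)"
    by (rule has_derivative_eq_rhs[OF has_derivative_compose[OF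
          bounded_linear_imp_has_derivative[OF assms(2)] smooth_has_derivative[OF assms(1)]]])
      (rule ext, rule lin)
qed

lemma laplacian_compose_real:
  fixes \<theta> :: "real \<Rightarrow> real" and l :: "complex \<Rightarrow> real"
  assumes "smooth \<theta>" "bounded_linear l"
  shows "laplacian (\<lambda>z. \<theta> (l z)) z = ((l 1)\<^sup>2 + (l \<i>)\<^sup>2) * dir_deriv 1 (dir_deriv 1 \<theta>) (l z)"
proof -
  have s: "smooth (\<lambda>z. dir_deriv 1 \<theta> (l z))"
    using C_k_compose_linear[OF smooth_dir_deriv[OF assms(1), rule_format] assms(2)] by blast
  have "dir_deriv v (dir_deriv v (\<lambda>z. \<theta> (l z))) z = (l v)\<^sup>2 * dir_deriv 1 (dir_deriv 1 \<theta>) (l z)" for v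
    unfolding dir_deriv_compose_real[OF assms] dir_deriv_cmult[OF smooth_differentiable[OF s]]
      dir_deriv_compose_real[OF smooth_dir_deriv[OF assms(1)] assms(2)] by (simp add: power2_eq_square)
  then show ?thesis by (simp add: laplacian_def distrib_right)
qed

text \<open>For a function that vanishes on the axes, the Lipschitz bound controls its values by the
  distance to each axis; the same constant bounds both partial derivatives.\<close>

lemma smooth_lipschitz:
  fixes f :: "complex \<Rightarrow> real"
  assumes f: "smooth f" and K: "compact K" "\<And>z. z \<notin> K \<Longrightarrow> f z = 0"
  obtains L where "L > 0" "\<And>z. \<bar>dir_deriv 1 f z\<bar> \<le> L" "\<And>z. \<bar>dir_deriv \<i> f z\<bar> \<le> L"
    "\<And>z w. \<bar>f z - f w\<bar> \<le> L * cmod (z - w)"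
proof -
  have d0: "dir_deriv v f z = 0" if "z \<notin> K" for v z
    by (rule dir_deriv_eq_0[of "- K"]) (use that K in \<open>auto simp: compact_imp_closed\<close>)
  obtain A where A: "A > 0" "\<And>z. \<bar>dir_deriv 1 f z\<bar> \<le> A"
    by (rule bounded_compact_support[OF smooth_continuous_on[OF smooth_dir_deriv[OF f]] K(1) d0]) blast+
  obtain B where B: "B > 0" "\<And>z. \<bar>dir_deriv \<i> f z\<bar> \<le> B"
    by (rule bounded_compact_support[OF smooth_continuous_on[OF smooth_dir_deriv[OF f]] K(1) d0]) blast+
  have "\<bar>f z - f w\<bar> \<le> (A + B) * cmod (z - w)" for z w
  proof -
    have "norm (f z - f w) \<le> (A + B) * norm (z - w)"
    proof (rule differentiable_bound[of UNIV f "\<lambda>x. frechet_derivative f (at x)"])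
      show "(f has_derivative frechet_derivative f (at x)) (at x within UNIV)" for x
        using smooth_has_derivative[OF f] by simp
      show "onorm (frechet_derivative f (at x)) \<le> A + B" for x
      proof (rule onorm_le)
        fix h
        have "norm (frechet_derivative f (at x) h) = \<bar>Re h * dir_deriv 1 f x + Im h * dir_deriv \<i> f x\<bar>"
          by (subst frechet_derivative_complex[OF smooth_differentiable[OF f]]) simp
        also have "\<dots> \<le> \<bar>Re h\<bar> * \<bar>dir_deriv 1 f x\<bar> + \<bar>Im h\<bar> * \<bar>dir_deriv \<i> f x\<bar>"
          by (metis abs_mult abs_triangle_ineq)
        also have "\<dots> \<le> cmod h * A + cmod h * B"
          by (intro add_mono mult_mono abs_Re_le_cmod abs_Im_le_cmod A(2) B(2)) auto
        finally show "norm (frechet_derivative f (at x) h) \<le> (A + B) * norm h"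
          by (simp add: algebra_simps)
      qed
    qed auto
    then show ?thesis by simp
  qed
  moreover have "\<bar>dir_deriv 1 f z\<bar> \<le> A + B" "\<bar>dir_deriv \<i> f z\<bar> \<le> A + B" for z
    using A B(1) B(2)[of z] A(2)[of z] by linarith+
  ultimately show thesis using that[of "A + B"] A(1) B(1) by simp
qed

lemma compact_subset_quarter_disc_margin:
  assumes K: "compact K" "K \<subseteq> quarter_disc"
  obtains m where "m > 0" "\<And>z. z \<in> K \<Longrightarrow> m \<le> Re z \<and> m \<le> Im z"
proof (cases "K = {}")
  case True
  then show thesis using that[of 1] by auto
next
  case False
  have "continuous_on K (\<lambda>z. min (Re z) (Im z))" by (intro continuous_intros)
  then obtain w where "w \<in> K" "\<forall>z\<in>K. min (Re w) (Im w) \<le> min (Re z) (Im z)"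
    using continuous_attains_inf[OF K(1) False] by blast
  then show thesis using that[of "min (Re w) (Im w)"] K(2) by (auto simp: quarter_disc_def)
qed

text \<open>The cutoff \<open>\<theta> (N * x) * \<theta> (N * y)\<close> makes \<open>f\<close> admissible on the quarter disc.  Its commutator with the
  Laplacian is of size \<open>N\<close> on strips of width \<open>1 / N\<close>, because \<open>f\<close> vanishes on the axes, and there \<open>g\<close> is small.\<close>

lemma quarter_disc_poisson_extends:
  fixes f g \<omega> :: "complex \<Rightarrow> real"
  assumes g: "continuous_on UNIV g" and g0: "\<And>z. z \<notin> quarter_disc \<Longrightarrow> g z = 0"
    and poisson: "\<And>\<phi>. test_function quarter_disc \<phi> \<Longrightarrow>
      (LINT z|lebesgue. g z * laplacian \<phi> z) = (LINT z|lebesgue. \<omega> z * \<phi> z)"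
    and K: "compact K" "K \<subseteq> quarter_disc" "\<And>z. z \<notin> K \<Longrightarrow> \<omega> z = 0"
    and f: "smooth f" and K': "compact K'" "K' \<subseteq> ball 0 1" "\<And>z. z \<notin> K' \<Longrightarrow> f z = 0"
    and axes: "\<And>z. Re z = 0 \<or> Im z = 0 \<Longrightarrow> f z = 0"
  shows "(LINT z|lebesgue. g z * laplacian f z) = (LINT z|lebesgue. \<omega> z * f z)"
proof -
  obtain \<theta> :: "real \<Rightarrow> real" where \<theta>: "smooth \<theta>" "\<And>x. x \<le> 1 \<Longrightarrow> \<theta> x = 0" "\<And>x. x \<ge> 2 \<Longrightarrow> \<theta> x = 1"
    "\<And>x. 0 \<le> \<theta> x" "\<And>x. \<theta> x \<le> 1"
    using smooth_step by metis
  define \<theta>1 where "\<theta>1 = dir_deriv 1 \<theta>"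
  define \<theta>2 where "\<theta>2 = dir_deriv 1 \<theta>1"
  have s\<theta>1: "smooth \<theta>1" and s\<theta>2: "smooth \<theta>2" unfolding \<theta>1_def \<theta>2_def using \<theta>(1) by (intro smooth_dir_deriv; simp)+
  have \<theta>1_0: "\<theta>1 x = 0" if "x \<notin> {1..2}" for x
  proof (cases "x < 1")
    case True
    then show ?thesis unfolding \<theta>1_def by (intro dir_deriv_eq_0[of "{..<1}" _ _ 0]) (auto simp: \<theta>(2))
  next
    case False
    then show ?thesis unfolding \<theta>1_def using that by (intro dir_deriv_eq_0[of "{2<..}" _ _ 1]) (auto simp: \<theta>(3))
  qed
  have \<theta>2_0: "\<theta>2 x = 0" if "x \<notin> {1..2}" for x
    unfolding \<theta>2_def by (rule dir_deriv_eq_0[of "- {1..2}"]) (use that \<theta>1_0 in auto)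
  obtain B1 where B1: "B1 > 0" "\<And>x. \<bar>\<theta>1 x\<bar> \<le> B1"
    by (rule bounded_compact_support[OF smooth_continuous_on[OF s\<theta>1] compact_Icc \<theta>1_0]) blast+
  obtain B2 where B2: "B2 > 0" "\<And>x. \<bar>\<theta>2 x\<bar> \<le> B2"
    by (rule bounded_compact_support[OF smooth_continuous_on[OF s\<theta>2] compact_Icc \<theta>2_0]) blast+
  obtain L where L: "L > 0" "\<And>z. \<bar>dir_deriv 1 f z\<bar> \<le> L" "\<And>z. \<bar>dir_deriv \<i> f z\<bar> \<le> L"
    "\<And>z w. \<bar>f z - f w\<bar> \<le> L * cmod (z - w)"
    by (rule smooth_lipschitz[OF f K'(1,3)]) blast+
  define N where "N n = real (Suc n)" for n
  have N: "N n > 0" for n by (simp add: N_def)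
  define a where "a n z = \<theta> (N n * Re z)" for n z
  define b where "b n z = \<theta> (N n * Im z)" for n z
  define \<eta> where "\<eta> n z = a n z * b n z" for n z
  have blR: "bounded_linear (\<lambda>z. N n * Re z)" and blI: "bounded_linear (\<lambda>z. N n * Im z)" for n
    by (intro bounded_linear_const_mult bounded_linear_Re bounded_linear_Im)+
  have sa: "smooth (a n)" and sb: "smooth (b n)" for n
    unfolding a_def[abs_def] b_def[abs_def]
    using C_k_compose_linear[OF \<theta>(1)[rule_format] blR] C_k_compose_linear[OF \<theta>(1)[rule_format] blI] by blast+
  have s\<eta>: "smooth (\<eta> n)" for n
    unfolding \<eta>_def[abs_def] by (intro allI C_k_mult sa[rule_format] sb[rule_format])
  have s\<eta>f: "smooth (\<lambda>z. \<eta> n z * f z)" for n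
    by (intro allI C_k_mult s\<eta>[rule_format] f[rule_format])
  have da: "dir_deriv v (a n) z = N n * Re v * \<theta>1 (N n * Re z)"
    and db: "dir_deriv v (b n) z = N n * Im v * \<theta>1 (N n * Im z)" for n v z
    unfolding a_def[abs_def] b_def[abs_def] \<theta>1_def
    by (rule dir_deriv_compose_real[OF \<theta>(1) blR], rule dir_deriv_compose_real[OF \<theta>(1) blI])
  have la: "laplacian (a n) z = (N n)\<^sup>2 * \<theta>2 (N n * Re z)"
    and lb: "laplacian (b n) z = (N n)\<^sup>2 * \<theta>2 (N n * Im z)" for n z
    unfolding a_def[abs_def] b_def[abs_def] \<theta>1_def \<theta>2_def
    using laplacian_compose_real[OF \<theta>(1) blR, of n z] laplacian_compose_real[OF \<theta>(1) blI, of n z] by simp_all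
  define E where "E n z = laplacian (\<lambda>z. \<eta> n z * f z) z - \<eta> n z * laplacian f z" for n z
  have E_eq: "E n z = 2 * (N n * \<theta>1 (N n * Re z) * b n z * dir_deriv 1 f z + N n * \<theta>1 (N n * Im z) * a n z * dir_deriv \<i> f z)
      + ((N n)\<^sup>2 * \<theta>2 (N n * Re z) * b n z + (N n)\<^sup>2 * \<theta>2 (N n * Im z) * a n z) * f z" for n z
  proof -
    have d\<eta>: "dir_deriv v (\<eta> n) z = a n z * dir_deriv v (b n) z + dir_deriv v (a n) z * b n z" for v
      unfolding \<eta>_def[abs_def] by (rule dir_deriv_mult[OF smooth_differentiable[OF sa] smooth_differentiable[OF sb]])
    \<comment> \<open>The mixed term of the product rule is zero, since \<open>a n\<close> depends
      on the real part and \<open>b n\<close> on the imaginary part only.\<close>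
    have l\<eta>: "laplacian (\<eta> n) z = a n z * laplacian (b n) z + laplacian (a n) z * b n z"
      unfolding \<eta>_def[abs_def] laplacian_mult[OF sa sb] da db by simp
    show ?thesis
      unfolding E_def laplacian_mult[OF s\<eta> f] d\<eta> l\<eta> da db la lb by (simp add: algebra_simps)
  qed
  have ab1: "\<bar>a n z\<bar> \<le> 1" "\<bar>b n z\<bar> \<le> 1" for n z using \<theta>(4,5) by (simp_all add: a_def b_def)
  have fx: "\<bar>f z\<bar> \<le> L * \<bar>Re z\<bar>" and fy: "\<bar>f z\<bar> \<le> L * \<bar>Im z\<bar>" for z
  proof -
    have "cmod (z - Complex 0 (Im z)) = \<bar>Re z\<bar>" "cmod (z - Complex (Re z) 0) = \<bar>Im z\<bar>"
      by (simp_all add: cmod_def)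
    then show "\<bar>f z\<bar> \<le> L * \<bar>Re z\<bar>" "\<bar>f z\<bar> \<le> L * \<bar>Im z\<bar>"
      using L(4)[of z "Complex 0 (Im z)"] L(4)[of z "Complex (Re z) 0"] axes[of "Complex 0 (Im z)"] axes[of "Complex (Re z) 0"]
      by simp_all
  qed
  define M where "M = 2 * B1 * L + 2 * B2 * L"
  have M: "M > 0" using B1 B2 L by (simp add: M_def add_pos_pos)
  have term1: "\<bar>2 * (N n * \<theta>1 (N n * x) * c * d) + (N n)\<^sup>2 * \<theta>2 (N n * x) * c * y\<bar> \<le> N n * M * of_bool (1 \<le> N n * x \<and> N n * x \<le> 2)"
    if c: "\<bar>c\<bar> \<le> 1" and d: "\<bar>d\<bar> \<le> L" and y: "\<bar>y\<bar> \<le> L * \<bar>x\<bar>" for n x c d y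
  proof (cases "1 \<le> N n * x \<and> N n * x \<le> 2")
    case False
    then have "\<theta>1 (N n * x) = 0" "\<theta>2 (N n * x) = 0" by (auto intro: \<theta>1_0 \<theta>2_0)
    then show ?thesis using False by auto
  next
    case True
    have "x > 0" using True N[of n] by (smt (verit) zero_less_mult_pos)
    have 1: "\<bar>2 * (N n * \<theta>1 (N n * x) * c * d)\<bar> \<le> 2 * (N n * B1 * 1 * L)"
      unfolding abs_mult using B1 N[of n] c d by (intro mult_mono) auto
    have "\<bar>(N n)\<^sup>2 * \<theta>2 (N n * x) * c * y\<bar> \<le> (N n)\<^sup>2 * B2 * 1 * (L * x)"
      unfolding abs_mult using B2 N[of n] c y \<open>x > 0\<close> L(1) by (intro mult_mono) auto
    \<comment> \<open>One factor \<open>N n\<close> is absorbed by \<open>N n * x\<close>, which is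
      at most 2 on the strip. This is where the vanishing of \<open>f\<close> on the axes lowers the
      order from N^2 to N.\<close>
    also have "\<dots> = N n * B2 * L * (N n * x)" by (simp add: power2_eq_square)
    also have "\<dots> \<le> N n * B2 * L * 2" using True B2 L(1) N[of n] by (intro mult_left_mono) auto
    finally have 2: "\<bar>(N n)\<^sup>2 * \<theta>2 (N n * x) * c * y\<bar> \<le> N n * B2 * L * 2" .
    show ?thesis using True by (intro order_trans[OF abs_triangle_ineq] order_trans[OF add_mono[OF 1 2]]) (simp add: M_def algebra_simps)
  qed
  have E_le: "\<bar>E n z\<bar> \<le> N n * M * (of_bool (1 \<le> N n * Re z \<and> N n * Re z \<le> 2) + of_bool (1 \<le> N n * Im z \<and> N n * Im z \<le> 2))" for n z
  proof -
    have "E n z = (2 * (N n * \<theta>1 (N n * Re z) * b n z * dir_deriv 1 f z) + (N n)\<^sup>2 * \<theta>2 (N n * Re z) * b n z * f z)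
        + (2 * (N n * \<theta>1 (N n * Im z) * a n z * dir_deriv \<i> f z) + (N n)\<^sup>2 * \<theta>2 (N n * Im z) * a n z * f z)"
      unfolding E_eq by (simp add: algebra_simps)
    also have "\<bar>\<dots>\<bar> \<le> N n * M * of_bool (1 \<le> N n * Re z \<and> N n * Re z \<le> 2) + N n * M * of_bool (1 \<le> N n * Im z \<and> N n * Im z \<le> 2)"
      by (intro order_trans[OF abs_triangle_ineq] add_mono term1 ab1 L(2,3) fx fy)
    finally show ?thesis by (simp only: distrib_left)
  qed
  have lap0: "laplacian f z = 0" if "z \<notin> K'" for z
    by (rule laplacian_eq_0[of "- K'"]) (use that K' in \<open>auto simp: compact_imp_closed\<close>)
  have lap0': "laplacian (\<lambda>z. \<eta> n z * f z) z = 0" if "z \<notin> K'" for n z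
    by (rule laplacian_eq_0[of "- K'"]) (use that K' in \<open>auto simp: compact_imp_closed\<close>)
  note cl = smooth_continuous_on[OF smooth_laplacian[OF f]]
    and c\<eta> = smooth_continuous_on[OF s\<eta>] and cl\<eta> = smooth_continuous_on[OF smooth_laplacian[OF s\<eta>f]]
  have contE: "continuous_on UNIV (E n)" for n
    unfolding E_def[abs_def]
    by (intro continuous_on_diff continuous_on_mult cl c\<eta> cl\<eta>)
  have "(\<lambda>n. LINT z|lborel. g z * E n z) \<longlonglongrightarrow> 0"
  proof (rule LIMSEQ_I)
    fix \<epsilon> :: real assume "\<epsilon> > 0"
    \<comment> \<open>The final bound is 4 e M: the integrand is at most e N M on two strips, each
      of width 1/N and length 2, so of area 2/N. The denominator leaves a factor 1/2 for the strict
      inequality.\<close>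
    define e where "e = \<epsilon> / (8 * M)"
    have e: "e > 0" using \<open>\<epsilon> > 0\<close> M by (simp add: e_def)
    have "uniformly_continuous_on (cball 0 1) g"
      by (rule compact_uniformly_continuous[OF continuous_on_subset[OF g]]) auto
    then obtain d where d: "d > 0" "\<And>z w. z \<in> cball 0 1 \<Longrightarrow> w \<in> cball 0 1 \<Longrightarrow> dist w z < d \<Longrightarrow> dist (g w) (g z) < e"
      using e unfolding uniformly_continuous_on_def by metis
    obtain n0 where n0: "2 / d < real n0" using reals_Archimedean2 by blast
    have "norm (LINT z|lborel. g z * E n z) < \<epsilon>" if "n \<ge> n0" for n
    proof -
      have "2 / d < N n" using n0 that by (simp add: N_def)
      then have Nd: "2 / N n < d" using d(1) N[of n] by (simp add: field_simps)
      define S1 where "S1 = cbox (Complex (1 / N n) (- 1)) (Complex (2 / N n) 1)"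
      define S2 where "S2 = cbox (Complex (- 1) (1 / N n)) (Complex 1 (2 / N n))"
      have m: "measure lborel S1 = 2 / N n" "measure lborel S2 = 2 / N n"
        unfolding S1_def S2_def using N[of n]
        by (simp_all add: measure_lborel_cbox_eq Basis_complex_def divide_right_mono field_simps)
      have gE: "norm (g z * E n z) \<le> e * (N n * M) * (indicator S1 z + indicator S2 z)" for z
      proof (cases "z \<in> quarter_disc")
        case False
        then show ?thesis using g0[of z] e N[of n] M by simp
      next
        case True
        then have z: "Re z > 0" "Im z > 0" "cmod z < 1" by (auto simp: quarter_disc_def)
        then have z': "Re z \<le> 1" "Im z \<le> 1" using complex_Re_le_cmod[of z] abs_Im_le_cmod[of z] by linarith+
        have small: "\<bar>g z\<bar> \<le> e" if "N n * Re z \<le> 2 \<or> N n * Im z \<le> 2"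
        proof -
          \<comment> \<open>The projection of \<open>z\<close> to an axis at distance at most
            \<open>2 / N n\<close>; it stays in the closed unit disc, where \<open>g\<close> is
            uniformly continuous, and \<open>g\<close> is 0 there.\<close>
          define w where "w = (if N n * Re z \<le> 2 then Complex 0 (Im z) else Complex (Re z) 0)"
          have "g w = 0" by (rule g0) (simp add: w_def quarter_disc_def)
          have t: "N n * t \<le> 2 \<Longrightarrow> t < d" for t :: real
            using Nd N[of n] by (intro le_less_trans[OF _ Nd]) (simp add: pos_le_divide_eq mult.commute)
          have "dist w z < d"
            using that t[of "Re z"] t[of "Im z"] z by (auto simp: w_def dist_norm cmod_def)
          moreover have "cmod w \<le> cmod z" by (auto simp: w_def cmod_def)
          ultimately have "dist (g w) (g z) < e" using z by (intro d(2)) auto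
          then show ?thesis using \<open>g w = 0\<close> by (simp add: dist_real_def)
        qed
        have i1: "of_bool (1 \<le> N n * Re z \<and> N n * Re z \<le> 2) = (indicator S1 z :: real)"
          and i2: "of_bool (1 \<le> N n * Im z \<and> N n * Im z \<le> 2) = (indicator S2 z :: real)"
          unfolding S1_def S2_def indicator_def using z z' N[of n]
          by (auto simp: in_cbox_complex_iff field_simps)
        show ?thesis
        proof (cases "N n * Re z \<le> 2 \<or> N n * Im z \<le> 2")
          case True
          have "norm (g z * E n z) \<le> e * (N n * M * (indicator S1 z + indicator S2 z))"
            unfolding real_norm_def abs_mult using E_le[of n z, unfolded i1 i2] small[OF True] e
            by (intro mult_mono) auto
          then show ?thesis by (simp add: mult.assoc)
        next
          case False
          then have "E n z = 0" using E_le[of n z] by simp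
          then show ?thesis using e N[of n] M by simp
        qed
      qed
      have ind: "integrable lborel (indicator S1 :: complex \<Rightarrow> real)" "integrable lborel (indicator S2 :: complex \<Rightarrow> real)"
        unfolding S1_def S2_def using emeasure_bounded_finite[OF bounded_cbox]
        by (auto intro!: integrable_real_indicator)
      have int: "integrable lborel (\<lambda>z. e * (N n * M) * (indicator S1 z + indicator S2 z))"
        by (intro integrable_mult_right Bochner_Integration.integrable_add impI ind)
      have "norm (LINT z|lborel. g z * E n z) \<le> (LINT z|lborel. e * (N n * M) * (indicator S1 z + indicator S2 z))"
        by (rule Bochner_Integration.integral_norm_bound_integral[OF _ int gE])
          (rule integrable_compact_support[OF _ K'(1)], intro continuous_on_mult g contE, simp add: E_def lap0 lap0')
      also have "\<dots> = e * (N n * M) * (2 / N n + 2 / N n)"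
        unfolding integral_mult_right_zero
        by (subst Bochner_Integration.integral_add[OF ind]) (simp add: m)
      also have "\<dots> = 4 * e * M" using N[of n] by (simp add: field_simps)
      also have "\<dots> < \<epsilon>" using M \<open>\<epsilon> > 0\<close> by (simp add: e_def)
      finally show ?thesis .
    qed
    then show "\<exists>n0. \<forall>n\<ge>n0. norm ((LINT z|lborel. g z * E n z) - 0) < \<epsilon>" by auto
  qed
  \<comment> \<open>Off the quarter disc \<open>g\<close> is 0, and at each point inside it the
    cutoff is eventually 1.\<close>
  moreover have "(\<lambda>n. LINT z|lborel. g z * (\<eta> n z * laplacian f z)) \<longlonglongrightarrow> (LINT z|lborel. g z * laplacian f z)"
  proof (rule integral_dominated_convergence[where w = "\<lambda>z. \<bar>g z * laplacian f z\<bar>"])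
    have "integrable lborel (\<lambda>z. g z * laplacian f z)"
      by (rule integrable_compact_support[OF _ K'(1)]) (auto intro!: continuous_on_mult g cl simp: lap0)
    then show "integrable lborel (\<lambda>z. \<bar>g z * laplacian f z\<bar>)" by (rule integrable_abs)
    show "(\<lambda>z. g z * laplacian f z) \<in> borel_measurable lborel"
      unfolding measurable_lborel2
      by (intro borel_measurable_continuous_onI continuous_on_mult g cl)
    show "(\<lambda>z. g z * (\<eta> n z * laplacian f z)) \<in> borel_measurable lborel" for n
      unfolding measurable_lborel2
      by (intro borel_measurable_continuous_onI continuous_on_mult g cl c\<eta>)
    show "AE z in lborel. (\<lambda>n. g z * (\<eta> n z * laplacian f z)) \<longlonglongrightarrow> g z * laplacian f z"
    proof (rule AE_I2)
      fix z
      show "(\<lambda>n. g z * (\<eta> n z * laplacian f z)) \<longlonglongrightarrow> g z * laplacian f z"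
      proof (cases "z \<in> quarter_disc")
        case False
        then show ?thesis by (simp add: g0)
      next
        case True
        then have z: "Re z > 0" "Im z > 0" by (auto simp: quarter_disc_def)
        obtain n0 where n0: "2 / min (Re z) (Im z) < real n0" using reals_Archimedean2 by blast
        have "\<eta> n z = 1" if "n \<ge> n0" for n
        proof -
          have "2 / min (Re z) (Im z) < N n" using n0 that by (simp add: N_def)
          then have "2 < N n * min (Re z) (Im z)" using z by (subst (asm) pos_divide_less_eq) auto
          moreover have "N n * min (Re z) (Im z) \<le> N n * Re z" "N n * min (Re z) (Im z) \<le> N n * Im z"
            using N[of n] by (simp_all add: mult_left_mono)
          ultimately show ?thesis by (simp add: \<eta>_def a_def b_def \<theta>(3))
        qed
        then have "\<forall>\<^sub>F n in sequentially. g z * (\<eta> n z * laplacian f z) = g z * laplacian f z"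
          by (auto simp: eventually_sequentially)
        then show ?thesis by (rule tendsto_eventually)
      qed
    qed
    show "AE z in lborel. norm (g z * (\<eta> n z * laplacian f z)) \<le> \<bar>g z * laplacian f z\<bar>" for n
    proof (rule AE_I2)
      fix z
      have "\<bar>\<eta> n z\<bar> \<le> 1 * 1" unfolding \<eta>_def abs_mult by (intro mult_mono ab1) auto
      then have "\<bar>\<eta> n z\<bar> * \<bar>g z * laplacian f z\<bar> \<le> 1 * \<bar>g z * laplacian f z\<bar>" by (intro mult_right_mono) auto
      then show "norm (g z * (\<eta> n z * laplacian f z)) \<le> \<bar>g z * laplacian f z\<bar>" by (simp add: abs_mult mult_ac)
    qed
  qed
  ultimately have "(\<lambda>n. (LINT z|lborel. g z * E n z) + (LINT z|lborel. g z * (\<eta> n z * laplacian f z)))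
      \<longlonglongrightarrow> 0 + (LINT z|lborel. g z * laplacian f z)"
    by (rule tendsto_add)
  moreover have "(LINT z|lborel. g z * E n z) + (LINT z|lborel. g z * (\<eta> n z * laplacian f z))
      = (LINT z|lebesgue. \<omega> z * (\<eta> n z * f z))" for n
  proof -
    have 1: "integrable lborel (\<lambda>z. g z * E n z)"
      by (rule integrable_compact_support[OF _ K'(1)], intro continuous_on_mult g contE) (simp add: E_def lap0 lap0')
    have 2: "integrable lborel (\<lambda>z. g z * (\<eta> n z * laplacian f z))"
      by (rule integrable_compact_support[OF _ K'(1)], intro continuous_on_mult g cl c\<eta>) (simp add: lap0)
    have "(LINT z|lborel. g z * E n z) + (LINT z|lborel. g z * (\<eta> n z * laplacian f z)) =
        (LINT z|lborel. g z * E n z + g z * (\<eta> n z * laplacian f z))"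
      using 1 2 by simp
    also have "\<dots> = (LINT z|lborel. g z * laplacian (\<lambda>z. \<eta> n z * f z) z)"
      by (simp add: E_def algebra_simps)
    also have "\<dots> = (LINT z|lebesgue. g z * laplacian (\<lambda>z. \<eta> n z * f z) z)"
      by (rule integral_completion[symmetric], unfold measurable_lborel2)
        (intro borel_measurable_continuous_onI continuous_on_mult g cl\<eta>)
    also have "\<dots> = (LINT z|lebesgue. \<omega> z * (\<eta> n z * f z))"
    proof (rule poisson, unfold test_function_def, intro conjI exI[of _ "K' \<inter> {z. 1 / N n \<le> Re z} \<inter> {z. 1 / N n \<le> Im z}"] allI impI)
      show "C_k k (\<lambda>z. \<eta> n z * f z)" for k using s\<eta>f by blast
      show "compact (K' \<inter> {z. 1 / N n \<le> Re z} \<inter> {z. 1 / N n \<le> Im z})"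
        by (intro compact_Int_closed K'(1) closed_halfspace_Re_ge closed_halfspace_Im_ge)
      have "1 / N n > 0" using N[of n] by simp
      then show "K' \<inter> {z. 1 / N n \<le> Re z} \<inter> {z. 1 / N n \<le> Im z} \<subseteq> quarter_disc"
        using K'(2) unfolding quarter_disc_def by (auto simp del: zero_less_divide_1_iff)
      show "\<eta> n z * f z = 0" if "z \<notin> K' \<inter> {z. 1 / N n \<le> Re z} \<inter> {z. 1 / N n \<le> Im z}" for z
      proof (cases "z \<in> K'")
        case True
        then have "N n * Re z \<le> 1 \<or> N n * Im z \<le> 1" using that N[of n] by (auto simp: field_simps)
        then show ?thesis by (auto simp: \<eta>_def a_def b_def \<theta>(2))
      qed (simp add: K'(3))
    qed
    finally show ?thesis .
  qed
  \<comment> \<open>The support \<open>K\<close> of \<omega> keeps a positive distance from the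
    axes, so the cutoff is eventually 1 on all of it and the sequence becomes constant.\<close>
  moreover have "\<forall>\<^sub>F n in sequentially. (LINT z|lebesgue. \<omega> z * (\<eta> n z * f z)) = (LINT z|lebesgue. \<omega> z * f z)"
  proof -
    obtain m where m: "m > 0" "\<And>z. z \<in> K \<Longrightarrow> m \<le> Re z \<and> m \<le> Im z"
      by (rule compact_subset_quarter_disc_margin[OF K(1,2)]) blast
    obtain n0 where n0: "2 / m < real n0" using reals_Archimedean2 by blast
    have "(LINT z|lebesgue. \<omega> z * (\<eta> n z * f z)) = (LINT z|lebesgue. \<omega> z * f z)" if "n \<ge> n0" for n
    proof (rule Bochner_Integration.integral_cong[OF refl])
      fix z
      show "\<omega> z * (\<eta> n z * f z) = \<omega> z * f z"
      proof (cases "z \<in> K")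
        case True
        have "2 / m < N n" using n0 that by (simp add: N_def)
        then have "2 < N n * m" using m(1) by (subst (asm) pos_divide_less_eq) auto
        moreover have "N n * m \<le> N n * Re z" "N n * m \<le> N n * Im z"
          using N[of n] m(2)[OF True] by (simp_all add: mult_left_mono)
        ultimately show ?thesis by (simp add: \<eta>_def a_def b_def \<theta>(3))
      qed (simp add: K(3))
    qed
    then show ?thesis by (auto simp: eventually_sequentially)
  qed
  ultimately have "(LINT z|lebesgue. \<omega> z * f z) = (LINT z|lborel. g z * laplacian f z)"
    by (simp add: tendsto_unique[OF sequentially_bot tendsto_eventually])
  also have "\<dots> = (LINT z|lebesgue. g z * laplacian f z)"
    by (rule integral_completion[symmetric], unfold measurable_lborel2)
      (intro borel_measurable_continuous_onI continuous_on_mult g cl)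
  finally show ?thesis ..
qed

section \<open>The odd extension on each reflected quadrant\<close>

lemma sign_cases:
  assumes "\<bar>a\<bar> = (1::real)"
  obtains "a = 1" | "a = - 1"
  using assms by (auto simp: abs_if split: if_splits)

text \<open>Only one of the four reflections brings \<open>z\<close> into the quarter disc: any
  other flips the sign of a coordinate that must be positive, so its term vanishes.\<close>

lemma odd_ext_quadrant:
  assumes ab: "\<bar>a\<bar> = 1" "\<bar>b\<bar> = 1" and z: "axis_refl a b z \<in> quarter_disc"
    and f: "\<And>z. z \<notin> quarter_disc \<Longrightarrow> f z = 0"
  shows "odd_ext f z = a * b * f (axis_refl a b z)"
proof -
  have *: "f (axis_refl c d z) = 0" if "c * a < 0 \<or> d * b < 0" for c d
  proof (rule f)
    show "axis_refl c d z \<notin> quarter_disc"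
    proof
      assume "axis_refl c d z \<in> quarter_disc"
      then have "0 < c * Re z" "0 < d * Im z" "0 < a * Re z" "0 < b * Im z"
        using z by (auto simp: quarter_disc_def)
      then have "0 < (c * Re z) * (a * Re z)" "0 < (d * Im z) * (b * Im z)" by simp_all
      then have "0 < (c * a) * (Re z)\<^sup>2" "0 < (d * b) * (Im z)\<^sup>2" by (simp_all add: power2_eq_square mult_ac)
      moreover have "x * y\<^sup>2 \<le> 0" if "x < 0" for x y :: real using that by (intro mult_nonpos_nonneg) auto
      ultimately show False using that by (meson not_less)
    qed
  qed
  show ?thesis
    using ab(1)
  proof (cases rule: sign_cases)
    case 1
    show ?thesis
      using ab(2) by (cases rule: sign_cases) (use 1 * in \<open>simp_all add: odd_ext_def del: axis_refl_1_1\<close>)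
  next
    case 2
    show ?thesis
      using ab(2) by (cases rule: sign_cases) (use 2 * in \<open>simp_all add: odd_ext_def del: axis_refl_1_1\<close>)
  qed
qed

lemma open_reflected_quarter_disc: "open {z. axis_refl a b z \<in> quarter_disc}"
  using open_vimage[OF open_quarter_disc linear_continuous_on[OF bounded_linear_axis_refl]]
  by (simp add: vimage_def)

text \<open>The chain rule contributes \<open>a\<close> or \<open>b\<close> to the factor
  \<open>a * b\<close> of the extension; as the square of a sign is 1, the x derivative keeps
  \<open>b\<close> and the y derivative keeps \<open>a\<close>.\<close>

lemma odd_ext_deriv_quadrant:
  assumes ab: "\<bar>a\<bar> = 1" "\<bar>b\<bar> = 1" and z: "axis_refl a b z \<in> quarter_disc"
    and f: "\<And>z. z \<notin> quarter_disc \<Longrightarrow> f z = 0" and diff: "f differentiable at (axis_refl a b z)"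
  shows "odd_ext f differentiable at z"
    and "dir_deriv 1 (odd_ext f) z = b * dir_deriv 1 f (axis_refl a b z)"
    and "dir_deriv \<i> (odd_ext f) z = a * dir_deriv \<i> f (axis_refl a b z)"
proof -
  let ?h = "\<lambda>z. f (axis_refl a b z)"
  have eq: "odd_ext f w = a * b * ?h w" if "w \<in> {z. axis_refl a b z \<in> quarter_disc}" for w
    using odd_ext_quadrant[OF ab _ f] that by simp
  have dh: "?h differentiable at z"
    using has_derivative_compose[OF bounded_linear_imp_has_derivative[OF bounded_linear_axis_refl]
        diff[unfolded frechet_derivative_works]]
    by (rule differentiableI)
  then have "(\<lambda>z. a * b * ?h z) differentiable at z" by (intro derivative_intros) auto
  then obtain D where "((\<lambda>z. a * b * ?h z) has_derivative D) (at z)" by (auto simp: differentiable_def)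
  then have "(odd_ext f has_derivative D) (at z)"
    by (rule has_derivative_transform_within_open[OF _ open_reflected_quarter_disc]) (use z eq in auto)
  then show "odd_ext f differentiable at z" by (auto simp: differentiable_def)
  have "dir_deriv v (odd_ext f) z = a * b * dir_deriv v ?h z" for v
    using dir_deriv_cong[OF open_reflected_quarter_disc _ eq] z dir_deriv_cmult[OF dh, where v = v and c = "a * b"] by simp
  then show "dir_deriv 1 (odd_ext f) z = b * dir_deriv 1 f (axis_refl a b z)"
    "dir_deriv \<i> (odd_ext f) z = a * dir_deriv \<i> f (axis_refl a b z)"
    using dir_deriv_axis_refl[OF diff] sign_mult_self[OF ab(1)] sign_mult_self[OF ab(2)]
    by (simp_all add: mult_ac flip: mult.assoc)
qed

text \<open>\<open>stream_function\<close> constrains \<psi> only on the closure of the domain,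
  whereas \<open>odd_ext\<close> evaluates its argument at all four reflected points; the values
  outside are therefore set to 0.\<close>

definition quarter_ext :: "(complex \<Rightarrow> real) \<Rightarrow> complex \<Rightarrow> real" where
  "quarter_ext \<psi> z = (if z \<in> quarter_disc then \<psi> z else 0)"

lemma quarter_ext_simps: "z \<in> quarter_disc \<Longrightarrow> quarter_ext \<psi> z = \<psi> z"
  "z \<notin> quarter_disc \<Longrightarrow> quarter_ext \<psi> z = 0"
  by (simp_all add: quarter_ext_def)

text \<open>The closure and the complement are closed sets that cover the plane and meet exactly in
  the frontier, where both pieces are 0.\<close>

lemma continuous_on_quarter_ext:
  assumes "continuous_on (closure quarter_disc) \<psi>" "\<forall>z\<in>frontier quarter_disc. \<psi> z = 0"
  shows "continuous_on UNIV (quarter_ext \<psi>)"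
proof -
  have "quarter_ext \<psi> z = \<psi> z" if "z \<in> closure quarter_disc" for z
    using assms(2) that open_quarter_disc
    by (auto simp: quarter_ext_def frontier_def interior_open)
  then have "continuous_on (closure quarter_disc) (quarter_ext \<psi>)"
    using continuous_on_cong[OF refl, of "closure quarter_disc" "quarter_ext \<psi>" \<psi>] assms(1) by simp
  moreover have "continuous_on (- quarter_disc) (quarter_ext \<psi>)"
    by (rule continuous_on_eq[OF continuous_on_const[of _ 0]]) (simp add: quarter_ext_def)
  ultimately have "continuous_on (closure quarter_disc \<union> - quarter_disc) (quarter_ext \<psi>)"
    using open_quarter_disc by (intro continuous_on_closed_Un) auto
  moreover have "closure quarter_disc \<union> - quarter_disc = UNIV" using closure_subset by auto
  ultimately show ?thesis by simp
qed

lemma dir_deriv_quarter_ext: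
  "z \<in> quarter_disc \<Longrightarrow> dir_deriv v (quarter_ext \<psi>) z = dir_deriv v \<psi> z"
  by (rule dir_deriv_cong[OF open_quarter_disc]) (auto simp: quarter_ext_def)

lemma differentiable_quarter_ext:
  assumes "z \<in> quarter_disc" "\<psi> differentiable at z"
  shows "quarter_ext \<psi> differentiable at z"
proof -
  obtain D where "(\<psi> has_derivative D) (at z)" using assms(2) by (auto simp: differentiable_def)
  then have "(quarter_ext \<psi> has_derivative D) (at z)"
    by (rule has_derivative_transform_within_open[OF _ open_quarter_disc assms(1)]) (simp add: quarter_ext_def)
  then show ?thesis by (auto simp: differentiable_def)
qed

lemma odd_ext_eq_0:
  assumes "\<And>a b. \<bar>a\<bar> = 1 \<Longrightarrow> \<bar>b\<bar> = 1 \<Longrightarrow> f (axis_refl a b z) = 0"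
  shows "odd_ext f z = 0"
  using assms[of 1 1] assms[of 1 "- 1"] assms[of "- 1" 1] assms[of "- 1" "- 1"] by (simp add: odd_ext_def)

definition reflections :: "complex set \<Rightarrow> complex set" where
  "reflections K = (\<Union>a\<in>{1, - 1}. \<Union>b\<in>{1, - 1}. axis_refl a b ` K)"

lemma reflections_iff: "z \<in> reflections K \<longleftrightarrow> (\<exists>a b. \<bar>a\<bar> = 1 \<and> \<bar>b\<bar> = 1 \<and> axis_refl a b z \<in> K)"
proof
  assume "z \<in> reflections K"
  then obtain a b w where "a \<in> {1, - 1}" "b \<in> {1, - 1}" "w \<in> K" "z = axis_refl a b w"
    unfolding reflections_def by blast
  then show "\<exists>a b. \<bar>a\<bar> = 1 \<and> \<bar>b\<bar> = 1 \<and> axis_refl a b z \<in> K"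
    by (intro exI[of _ a] exI[of _ b]) (auto simp: axis_refl_refl)
next
  assume "\<exists>a b. \<bar>a\<bar> = 1 \<and> \<bar>b\<bar> = 1 \<and> axis_refl a b z \<in> K"
  then obtain a b where ab: "\<bar>a\<bar> = 1" "\<bar>b\<bar> = 1" "axis_refl a b z \<in> K" by blast
  have "a \<in> {1, - 1}" "b \<in> {1, - 1}" using ab(1,2) by (auto simp: abs_if split: if_splits)
  moreover have "z = axis_refl a b (axis_refl a b z)" using axis_refl_involution ab by simp
  ultimately show "z \<in> reflections K" unfolding reflections_def using ab(3) by blast
qed

lemma compact_reflections: "compact K \<Longrightarrow> compact (reflections K)"
  unfolding reflections_def
  by (intro compact_UN compact_continuous_image linear_continuous_on bounded_linear_axis_refl) auto

lemma reflections_subset_ball: "K \<subseteq> ball 0 1 \<Longrightarrow> reflections K \<subseteq> ball 0 1"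
  using cmod_axis_refl by (auto simp: reflections_iff subset_iff)

lemma odd_ext_support: "(\<And>z. z \<notin> K \<Longrightarrow> f z = 0) \<Longrightarrow> z \<notin> reflections K \<Longrightarrow> odd_ext f z = 0"
  by (rule odd_ext_eq_0) (auto simp: reflections_iff)

lemma odd_ext_axes: "Re z = 0 \<or> Im z = 0 \<Longrightarrow> odd_ext f z = 0"
proof -
  assume z: "Re z = 0 \<or> Im z = 0"
  have "axis_refl (- 1) c z = axis_refl 1 c z" if "Re z = 0" for c using that by (simp add: complex_eq_iff)
  moreover have "axis_refl c (- 1) z = axis_refl c 1 z" if "Im z = 0" for c using that by (simp add: complex_eq_iff)
  ultimately show "odd_ext f z = 0" using z by (auto simp: odd_ext_def)
qed

lemma weak_poisson_odd_ext:
  assumes st: "stream_function quarter_disc \<omega> \<psi>"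
    and \<omega>: "\<omega> \<in> borel_measurable lebesgue" "\<And>z. \<bar>\<omega> z\<bar> \<le> M"
    and K: "compact K" "K \<subseteq> quarter_disc" "\<And>z. z \<notin> K \<Longrightarrow> \<omega> z = 0"
    and \<phi>: "test_function (ball 0 1) \<phi>"
  shows "(LINT z|lebesgue. odd_ext (quarter_ext \<psi>) z * laplacian \<phi> z) = (LINT z|lebesgue. odd_ext \<omega> z * \<phi> z)"
proof -
  let ?g = "quarter_ext \<psi>"
  obtain K' where s\<phi>: "smooth \<phi>" and K': "compact K'" "K' \<subseteq> ball 0 1" "\<And>z. z \<notin> K' \<Longrightarrow> \<phi> z = 0"
    using \<phi> by (auto simp: test_function_def)
  have g: "continuous_on UNIV ?g"
    using st by (intro continuous_on_quarter_ext) (auto simp: stream_function_def)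
  have lap0: "laplacian \<phi> z = 0" if "z \<notin> K'" for z
    by (rule laplacian_eq_0[of "- K'"]) (use that K' in \<open>auto simp: compact_imp_closed\<close>)
  have "(LINT z|lebesgue. odd_ext ?g z * laplacian \<phi> z) = (LINT z|lebesgue. ?g z * odd_ext (laplacian \<phi>) z)"
  proof (rule integral_odd_ext)
    fix a b :: real
    have "continuous_on UNIV (\<lambda>z. ?g (axis_refl a b z) * laplacian \<phi> z)"
      by (intro continuous_on_mult continuous_on_compose2[OF g] linear_continuous_on bounded_linear_axis_refl
          smooth_continuous_on[OF smooth_laplacian[OF s\<phi>]]) auto
    then have "integrable lborel (\<lambda>z. ?g (axis_refl a b z) * laplacian \<phi> z)"
      by (rule integrable_compact_support[OF _ K'(1)]) (simp add: lap0)
    then show "integrable lebesgue (\<lambda>z. ?g (axis_refl a b z) * laplacian \<phi> z)"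
      by (simp add: integrable_completion)
  qed
  also have "\<dots> = (LINT z|lebesgue. ?g z * laplacian (odd_ext \<phi>) z)"
    by (simp only: laplacian_odd_ext[OF s\<phi>])
  also have "\<dots> = (LINT z|lebesgue. \<omega> z * odd_ext \<phi> z)"
  proof (rule quarter_disc_poisson_extends[OF g _ _ K smooth_odd_ext[OF s\<phi>] compact_reflections[OF K'(1)]
        reflections_subset_ball[OF K'(2)] odd_ext_support[OF K'(3)]])
    show "?g z = 0" if "z \<notin> quarter_disc" for z using that by (rule quarter_ext_simps)
    show "odd_ext \<phi> z = 0" if "Re z = 0 \<or> Im z = 0" for z using that by (rule odd_ext_axes)
    show "(LINT z|lebesgue. ?g z * laplacian f z) = (LINT z|lebesgue. \<omega> z * f z)" if f: "test_function quarter_disc f" for f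
    proof -
      obtain C where C: "compact C" "C \<subseteq> quarter_disc" "\<And>z. z \<notin> C \<Longrightarrow> f z = 0"
        using f by (auto simp: test_function_def)
      \<comment> \<open>The integral runs over the whole plane, where \<psi> may have arbitrary
        values outside the closure; since the Laplacian of \<open>f\<close> is supported in the
        quarter disc, replacing \<psi> by its extension changes nothing.\<close>
      have "laplacian f z = 0" if "z \<notin> quarter_disc" for z
        by (rule laplacian_eq_0[of "- C"]) (use that C in \<open>auto simp: compact_imp_closed\<close>)
      then have eq: "?g z * laplacian f z = \<psi> z * laplacian f z" for z
        by (cases "z \<in> quarter_disc") (simp_all add: quarter_ext_def)
      show ?thesis unfolding eq using st f by (simp add: stream_function_def)
    qed
  qed
  also have "\<dots> = (LINT z|lebesgue. odd_ext \<omega> z * \<phi> z)"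
  proof (rule integral_odd_ext[symmetric])
    fix a b :: real assume ab: "\<bar>a\<bar> = 1" "\<bar>b\<bar> = 1"
    have m\<phi>: "\<phi> \<in> borel_measurable lebesgue"
      by (intro measurable_completion) (simp add: borel_measurable_continuous_onI smooth_continuous_on[OF s\<phi>])
    have "integrable lborel (\<lambda>z. M * \<bar>\<phi> z\<bar>)"
      by (rule integrable_compact_support[OF _ K'(1)]) (auto intro!: continuous_intros smooth_continuous_on[OF s\<phi>] simp: K'(3))
    then have "integrable lebesgue (\<lambda>z. M * \<bar>\<phi> z\<bar>)"
      using integrable_completion[OF borel_measurable_integrable] by blast
    then show "integrable lebesgue (\<lambda>z. \<omega> (axis_refl a b z) * \<phi> z)"
    proof (rule Bochner_Integration.integrable_bound)
      show "(\<lambda>z. \<omega> (axis_refl a b z) * \<phi> z) \<in> borel_measurable lebesgue"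
        using measurable_compose[OF axis_refl_lebesgue(1)[OF ab] \<omega>(1)] m\<phi> by (rule borel_measurable_times)
      show "AE z in lebesgue. norm (\<omega> (axis_refl a b z) * \<phi> z) \<le> norm (M * \<bar>\<phi> z\<bar>)"
      proof (rule AE_I2)
        fix z
        have "\<bar>\<omega> (axis_refl a b z)\<bar> * \<bar>\<phi> z\<bar> \<le> \<bar>M\<bar> * \<bar>\<phi> z\<bar>"
          using \<omega>(2)[of "axis_refl a b z"] by (intro mult_right_mono) auto
        then show "norm (\<omega> (axis_refl a b z) * \<phi> z) \<le> norm (M * \<bar>\<phi> z\<bar>)" by (simp add: abs_mult)
      qed
    qed
  qed
  finally show ?thesis .
qed

lemma stream_function_odd_ext:
  assumes st: "stream_function quarter_disc \<omega> \<psi>"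
    and \<omega>: "\<omega> \<in> borel_measurable lebesgue" "\<And>z. \<bar>\<omega> z\<bar> \<le> M"
    and K: "compact K" "K \<subseteq> quarter_disc" "\<And>z. z \<notin> K \<Longrightarrow> \<omega> z = 0"
  shows "stream_function (ball 0 1) (odd_ext \<omega>) (odd_ext (quarter_ext \<psi>))"
proof -
  let ?g = "quarter_ext \<psi>"
  let ?G = "odd_ext ?g"
  have g: "continuous_on UNIV ?g"
    using st by (intro continuous_on_quarter_ext) (auto simp: stream_function_def)
  have G: "continuous_on UNIV ?G" unfolding odd_ext_def
    by (intro continuous_intros continuous_on_compose2[OF g] linear_continuous_on bounded_linear_axis_refl) auto
  have g0: "?g z = 0" if "z \<notin> quarter_disc" for z using that by (rule quarter_ext_simps)
  have poisson: "(LINT z|lebesgue. ?G z * laplacian \<phi> z) = (LINT z|lebesgue. odd_ext \<omega> z * \<phi> z)"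
    if "test_function (ball 0 1) \<phi>" for \<phi>
    using weak_poisson_odd_ext[OF st \<omega> K that] .
  define V where "V = ball 0 1 - reflections K"
  have V: "open V" unfolding V_def
    by (intro open_Diff open_ball compact_imp_closed compact_reflections K(1))
  have weak: "(LINT z|lebesgue. ?G z * laplacian \<phi> z) = 0" if \<phi>: "test_function V \<phi>" for \<phi>
  proof -
    obtain K' where K': "compact K'" "K' \<subseteq> V" "\<And>z. z \<notin> K' \<Longrightarrow> \<phi> z = 0"
      using \<phi> by (auto simp: test_function_def)
    have "test_function (ball 0 1) \<phi>" using \<phi> unfolding test_function_def V_def by blast
    then have *: "(LINT z|lebesgue. ?G z * laplacian \<phi> z) = (LINT z|lebesgue. odd_ext \<omega> z * \<phi> z)"
      by (rule poisson)
    have 0: "odd_ext \<omega> z * \<phi> z = 0" for z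
    proof (cases "z \<in> reflections K")
      case True
      then have "z \<notin> K'" using K'(2) by (auto simp: V_def)
      then show ?thesis by (simp add: K'(3))
    next
      case False
      then have "odd_ext \<omega> z = 0" using odd_ext_support[of K \<omega> z] K(3) by blast
      then show ?thesis by simp
    qed
    show ?thesis unfolding * 0 by simp
  qed
  have "?G differentiable at z \<and> isCont (grad ?G) z" if z: "z \<in> ball 0 1" for z
  proof (cases "z \<in> V")
    case True
    then show ?thesis
      using weakly_harmonic_imp_C1[OF G V weak] V by (auto simp: continuous_on_eq_continuous_at)
  next
    \<comment> \<open>The weak Laplacian may be nonzero here, but such a point lies inside an open
      reflected quadrant, where the extension is a reflected copy of \<psi> up to sign and inherits
      C^1 from it.\<close>
    case False
    then obtain a b where ab: "\<bar>a\<bar> = 1" "\<bar>b\<bar> = 1" "axis_refl a b z \<in> K"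
      using z by (auto simp: V_def reflections_iff)
    have zQ: "axis_refl a b z \<in> quarter_disc" using ab(3) K(2) by blast
    have dg: "?g differentiable at w" if "w \<in> quarter_disc" for w
      using st that by (intro differentiable_quarter_ext) (auto simp: stream_function_def)
    note d = odd_ext_deriv_quadrant[OF ab(1,2) _ g0 dg]
    have C: "isCont (\<lambda>w. Complex (b * Re (grad \<psi> (axis_refl a b w))) (a * Im (grad \<psi> (axis_refl a b w)))) z"
    proof -
      have "isCont (grad \<psi>) (axis_refl a b z)"
        using st zQ open_quarter_disc by (auto simp: stream_function_def continuous_on_eq_continuous_at)
      then have "isCont (\<lambda>w. grad \<psi> (axis_refl a b w)) z"
        by (rule isCont_o2[OF linear_continuous_at[OF bounded_linear_axis_refl]])
      from isCont_Re[OF this] isCont_Im[OF this] show ?thesis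
        unfolding Complex_eq by (intro continuous_intros)
    qed
    have ev: "\<forall>\<^sub>F w in nhds z. Complex (b * Re (grad \<psi> (axis_refl a b w))) (a * Im (grad \<psi> (axis_refl a b w))) = grad ?G w"
    proof (rule eventually_mono[OF eventually_nhds_in_open[OF open_reflected_quarter_disc]])
      show "z \<in> {z. axis_refl a b z \<in> quarter_disc}" using zQ by simp
      show "Complex (b * Re (grad \<psi> (axis_refl a b w))) (a * Im (grad \<psi> (axis_refl a b w))) = grad ?G w"
        if "w \<in> {z. axis_refl a b z \<in> quarter_disc}" for w
        using that d[of w] by (simp add: grad_def dir_deriv_quarter_ext)
    qed
    have "isCont (grad ?G) z" using C isCont_cong[OF ev] by simp
    moreover have "?G differentiable at z" by (rule d(1)[OF zQ _ zQ])
    ultimately show ?thesis by simp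
  qed
  then have "\<forall>z\<in>ball 0 1. ?G differentiable at z" "continuous_on (ball 0 1) (grad ?G)"
    by (auto simp: continuous_at_imp_continuous_on)
  moreover have "?G z = 0" if "z \<in> frontier (ball 0 1)" for z
  proof (rule odd_ext_eq_0, rule g0)
    show "axis_refl a b z \<notin> quarter_disc" if "\<bar>a\<bar> = 1" "\<bar>b\<bar> = 1" for a b
      using \<open>z \<in> frontier (ball 0 1)\<close> cmod_axis_refl[OF that, of z] by (auto simp: frontier_ball quarter_disc_def)
  qed
  ultimately show ?thesis
    unfolding stream_function_def using poisson continuous_on_subset[OF G] by auto
qed

section \<open>Weak solutions of the Euler equations\<close>

text \<open>Only the vorticity is split into its four reflected parts; the factor \<open>B\<close>,
  which will contain the velocity of the full extension, is common to them.\<close>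

lemma has_bochner_integral_odd_ext_pieces:
  fixes B :: "real \<Rightarrow> complex \<Rightarrow> real"
  assumes "\<And>a b. \<bar>a\<bar> = 1 \<Longrightarrow> \<bar>b\<bar> = 1 \<Longrightarrow>
      has_bochner_integral lebesgue (\<lambda>(t, z). \<omega> t (axis_refl a b z) * B t z) 0"
  shows "has_bochner_integral lebesgue (\<lambda>(t, z). odd_ext (\<omega> t) z * B t z) 0"
proof -
  have "has_bochner_integral lebesgue (\<lambda>p. (case p of (t, z) \<Rightarrow> \<omega> t (axis_refl 1 1 z) * B t z)
      - (case p of (t, z) \<Rightarrow> \<omega> t (axis_refl 1 (- 1) z) * B t z)
      - (case p of (t, z) \<Rightarrow> \<omega> t (axis_refl (- 1) 1 z) * B t z)
      + (case p of (t, z) \<Rightarrow> \<omega> t (axis_refl (- 1) (- 1) z) * B t z)) (0 - 0 - 0 + 0)"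
    by (intro has_bochner_integral_add has_bochner_integral_diff assms) auto
  then show ?thesis by (simp add: odd_ext_def case_prod_unfold left_diff_distrib distrib_right)
qed

lemma bounded_linear_time_axis_refl:
  "bounded_linear (\<lambda>p::real \<times> complex. (fst p, axis_refl a b (snd p)))"
  by (intro bounded_linear_Pair bounded_linear_fst bounded_linear_compose[OF bounded_linear_axis_refl bounded_linear_snd])

text \<open>With \<open>N = 4 / m\<close> the scaled coordinates are at least 4 on \<open>K\<close>,
  strictly beyond 2 where the step reaches 1. This room gives an open neighbourhood \<open>U\<close>
  of \<open>K\<close> on which the cutoff is 1, so that derivatives agree on \<open>K\<close> as
  well.\<close>

lemma quarter_disc_time_cutoff:
  fixes \<phi> :: "real \<times> complex \<Rightarrow> real"
  assumes K: "compact K" "K \<subseteq> quarter_disc" and \<phi>: "test_function (UNIV \<times> ball 0 1) \<phi>"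
    and ab: "\<bar>a\<bar> = 1" "\<bar>b\<bar> = 1"
  obtains U \<phi>' where "open U" "K \<subseteq> U" "test_function (UNIV \<times> quarter_disc) \<phi>'"
    "\<And>t w. w \<in> U \<Longrightarrow> \<phi>' (t, w) = \<phi> (t, axis_refl a b w)"
proof -
  obtain m where m: "m > 0" "\<And>z. z \<in> K \<Longrightarrow> m \<le> Re z \<and> m \<le> Im z"
    by (rule compact_subset_quarter_disc_margin[OF K]) blast
  define N where "N = 4 / m"
  have N: "N > 0" using m(1) by (simp add: N_def)
  obtain \<theta> :: "real \<Rightarrow> real" where \<theta>: "smooth \<theta>" "\<And>x. x \<le> 1 \<Longrightarrow> \<theta> x = 0" "\<And>x. x \<ge> 2 \<Longrightarrow> \<theta> x = 1"
    using smooth_step by metis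
  obtain K' where s\<phi>: "smooth \<phi>" and K': "compact K'" "K' \<subseteq> UNIV \<times> ball 0 1" "\<And>p. p \<notin> K' \<Longrightarrow> \<phi> p = 0"
    using \<phi> by (auto simp: test_function_def)
  define T where "T p = (fst p, axis_refl a b (snd p))" for p :: "real \<times> complex"
  have T: "bounded_linear T" unfolding T_def[abs_def] by (rule bounded_linear_time_axis_refl)
  have TT: "T (T p) = p" for p by (simp add: T_def axis_refl_involution[OF ab])
  define \<phi>' where "\<phi>' p = \<theta> (N * Re (snd p)) * \<theta> (N * Im (snd p)) * \<phi> (T p)" for p
  have l: "bounded_linear (\<lambda>p::real \<times> complex. N * Re (snd p))" "bounded_linear (\<lambda>p::real \<times> complex. N * Im (snd p))"
    by (intro bounded_linear_const_mult bounded_linear_compose[OF bounded_linear_Re bounded_linear_snd]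
        bounded_linear_compose[OF bounded_linear_Im bounded_linear_snd])+
  have s: "smooth \<phi>'"
    unfolding \<phi>'_def[abs_def]
    by (intro allI C_k_mult C_k_compose_linear[OF \<theta>(1)[rule_format] l(1)] C_k_compose_linear[OF \<theta>(1)[rule_format] l(2)]
        C_k_compose_linear[OF s\<phi>[rule_format] T])
  define C where "C = T ` K' \<inter> {p. 1 / N \<le> Re (snd p)} \<inter> {p. 1 / N \<le> Im (snd p)}"
  have "compact C" unfolding C_def
    by (intro compact_Int_closed compact_continuous_image linear_continuous_on T K'(1) closed_Collect_le continuous_intros)
  moreover have "C \<subseteq> UNIV \<times> quarter_disc"
  proof
    fix p assume "p \<in> C"
    then obtain k where k: "k \<in> K'" "p = T k" "1 / N \<le> Re (snd p)" "1 / N \<le> Im (snd p)" by (auto simp: C_def)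
    have "cmod (snd k) < 1" using k(1) K'(2) by auto
    then have "cmod (snd p) < 1" by (simp add: k(2) T_def cmod_axis_refl[OF ab])
    moreover have "1 / N > 0" using N by simp
    ultimately show "p \<in> UNIV \<times> quarter_disc" using k(3,4) by (cases p) (simp add: quarter_disc_def del: zero_less_divide_1_iff)
  qed
  moreover have "\<phi>' p = 0" if "p \<notin> C" for p
  proof (cases "p \<in> T ` K'")
    case True
    then have "N * Re (snd p) \<le> 1 \<or> N * Im (snd p) \<le> 1" using that N by (auto simp: C_def field_simps)
    then show ?thesis by (auto simp: \<phi>'_def \<theta>(2))
  next
    case False
    then have "T p \<notin> K'" using TT by (metis image_eqI)
    then show ?thesis by (simp add: \<phi>'_def K'(3))
  qed
  ultimately have tf: "test_function (UNIV \<times> quarter_disc) \<phi>'"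
    unfolding test_function_def using s by blast
  define U where "U = {w. 2 < N * Re w} \<inter> {w. 2 < N * Im w}"
  have "open U" unfolding U_def by (intro open_Int open_Collect_less continuous_intros)
  moreover have "K \<subseteq> U"
  proof
    fix z assume "z \<in> K"
    then have "N * m \<le> N * Re z" "N * m \<le> N * Im z" using m(2) N by (simp_all add: mult_left_mono)
    moreover have "N * m = 4" using m(1) by (simp add: N_def)
    ultimately show "z \<in> U" by (simp add: U_def)
  qed
  moreover have "\<phi>' (t, w) = \<phi> (t, axis_refl a b w)" if "w \<in> U" for t w
    using that by (simp add: U_def \<phi>'_def T_def \<theta>(3))
  ultimately show thesis using that tf by blast
qed

text \<open>On each reflected quadrant the integrand is that of the quarter disc, up to the reflection, for the
  reflected test function; cutting this function off outside the support of \<open>\<omega>\<close> makes it admissible.\<close>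

lemma euler_weak_solution_odd_ext:
  assumes E: "euler_weak_solution quarter_disc \<omega>"
  shows "euler_weak_solution (ball 0 1) (\<lambda>t. odd_ext (\<omega> t))"
proof -
  obtain \<psi> where st: "\<And>t. stream_function quarter_disc (\<omega> t) (\<psi> t)" and
    weak: "\<And>\<phi>. test_function (UNIV \<times> quarter_disc) \<phi> \<Longrightarrow>
           has_bochner_integral lebesgue
             (\<lambda>(t, z). \<omega> t z * (deriv (\<lambda>s. \<phi> (s, z)) t
                                + grad_perp (\<psi> t) z \<bullet> grad (\<lambda>w. \<phi> (t, w)) z)) 0"
    using E by (auto simp: euler_weak_solution_def)
  obtain M K where meas: "(\<lambda>(t, z). \<omega> t z) \<in> borel_measurable lebesgue" "\<And>t. \<omega> t \<in> borel_measurable lebesgue"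
    and M: "\<And>t z. \<bar>\<omega> t z\<bar> \<le> M"
    and K: "compact K" "K \<subseteq> quarter_disc" "\<And>t z. z \<notin> K \<Longrightarrow> \<omega> t z = 0"
    using E unfolding euler_weak_solution_def Linf_Linfc_def by blast
  let ?G = "\<lambda>t. odd_ext (quarter_ext (\<psi> t))"
  have L: "Linf_Linfc (ball 0 1) (\<lambda>t. odd_ext (\<omega> t))"
    unfolding Linf_Linfc_def
  proof (intro conjI allI exI[of _ "4 * M"] exI[of _ "reflections K"] impI)
    have 1: "(\<lambda>p. \<omega> (fst p) (axis_refl a b (snd p))) \<in> borel_measurable lebesgue" if "\<bar>a\<bar> = 1" "\<bar>b\<bar> = 1" for a b
      using measurable_compose[OF axis_refl_time_lebesgue(1)[OF that] meas(1)] by (simp add: case_prod_unfold)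
    show "(\<lambda>(t, z). odd_ext (\<omega> t) z) \<in> borel_measurable lebesgue"
      unfolding odd_ext_def case_prod_unfold
      by (intro borel_measurable_add borel_measurable_diff 1) auto
    show "odd_ext (\<omega> t) \<in> borel_measurable lebesgue" for t
      unfolding odd_ext_def[abs_def]
      by (intro borel_measurable_add borel_measurable_diff measurable_compose[OF axis_refl_lebesgue(1) meas(2)]) auto
    show "\<bar>odd_ext (\<omega> t) z\<bar> \<le> 4 * M" for t z
      unfolding odd_ext_def
      using M[of t "axis_refl 1 1 z"] M[of t "axis_refl 1 (- 1) z"] M[of t "axis_refl (- 1) 1 z"] M[of t "axis_refl (- 1) (- 1) z"]
      by linarith
    show "compact (reflections K)" by (rule compact_reflections[OF K(1)])
    show "reflections K \<subseteq> ball 0 1"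
      using K(2) by (intro reflections_subset_ball) (auto simp: quarter_disc_def)
    show "odd_ext (\<omega> t) z = 0" if "z \<notin> reflections K" for t z
      using odd_ext_support[of K "\<omega> t" z] K(3) that by blast
  qed
  have S: "stream_function (ball 0 1) (odd_ext (\<omega> t)) (?G t)" for t
    by (rule stream_function_odd_ext[OF st meas(2) M K])
  have W: "has_bochner_integral lebesgue
             (\<lambda>(t, z). odd_ext (\<omega> t) z * (deriv (\<lambda>s. \<phi> (s, z)) t
                                + grad_perp (?G t) z \<bullet> grad (\<lambda>w. \<phi> (t, w)) z)) 0"
    if \<phi>: "test_function (UNIV \<times> ball 0 1) \<phi>" for \<phi>
  proof (rule has_bochner_integral_odd_ext_pieces)
    fix a b :: real assume ab: "\<bar>a\<bar> = 1" "\<bar>b\<bar> = 1"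
    have s\<phi>: "smooth \<phi>" using \<phi> by (simp add: test_function_def)
    have d\<phi>: "(\<lambda>w. \<phi> (t, w)) differentiable at z" for t z
    proof -
      have "bounded_linear (\<lambda>w::complex. (0::real, w))"
        by (intro bounded_linear_Pair bounded_linear_zero bounded_linear_ident)
      then have "C_k k (\<lambda>w. \<phi> ((0, w) + (t, 0)))" for k
        by (rule C_k_compose_affine[OF s\<phi>[rule_format]])
      then have "smooth (\<lambda>w. \<phi> (t, w))" by simp
      then show ?thesis by (rule smooth_differentiable)
    qed
    obtain U \<phi>' where U: "open U" "K \<subseteq> U" and tf: "test_function (UNIV \<times> quarter_disc) \<phi>'"
      and \<phi>': "\<And>t w. w \<in> U \<Longrightarrow> \<phi>' (t, w) = \<phi> (t, axis_refl a b w)"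
      by (rule quarter_disc_time_cutoff[OF K(1,2) \<phi> ab]) blast
    define f where "f p = \<omega> (fst p) (snd p) * (deriv (\<lambda>s. \<phi>' (s, snd p)) (fst p)
        + grad_perp (\<psi> (fst p)) (snd p) \<bullet> grad (\<lambda>w. \<phi>' (fst p, w)) (snd p))" for p
    have "has_bochner_integral lebesgue f 0"
      using weak[OF tf] by (simp add: f_def[abs_def] case_prod_unfold)
    \<comment> \<open>The identity of the quarter disc is transported by reflecting the space
      variable at fixed time, which preserves the measure; it remains to identify the
      integrand.\<close>
    then have "has_bochner_integral lebesgue (\<lambda>p. f (fst p, axis_refl a b (snd p))) 0"
      by (rule has_bochner_integral_involution[OF axis_refl_time_lebesgue[OF ab], rotated])
        (simp add: axis_refl_involution[OF ab])
    moreover have "f (t, axis_refl a b z) = \<omega> t (axis_refl a b z) *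
        (deriv (\<lambda>s. \<phi> (s, z)) t + grad_perp (?G t) z \<bullet> grad (\<lambda>w. \<phi> (t, w)) z)" for t z
    proof (cases "axis_refl a b z \<in> K")
      case False
      then show ?thesis by (simp add: f_def K(3))
    next
      case True
      define w where "w = axis_refl a b z"
      have z: "axis_refl a b w = z" by (simp add: w_def axis_refl_involution[OF ab])
      have wU: "w \<in> U" and wQ: "w \<in> quarter_disc" using True U(2) K(2) by (auto simp: w_def)
      have 1: "(\<lambda>s. \<phi>' (s, w)) = (\<lambda>s. \<phi> (s, z))" using \<phi>'[OF wU] by (simp add: z)
      have "dir_deriv v (\<lambda>w. \<phi>' (t, w)) w = dir_deriv v (\<lambda>w. \<phi> (t, axis_refl a b w)) w" for v
        by (rule dir_deriv_cong[OF U(1) wU]) (rule \<phi>')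
      then have 2: "dir_deriv 1 (\<lambda>w. \<phi>' (t, w)) w = a * dir_deriv 1 (\<lambda>w. \<phi> (t, w)) z"
        "dir_deriv \<i> (\<lambda>w. \<phi>' (t, w)) w = b * dir_deriv \<i> (\<lambda>w. \<phi> (t, w)) z"
        using dir_deriv_axis_refl[of "\<lambda>w. \<phi> (t, w)" a b w] d\<phi> by (simp_all add: z)
      have "\<psi> t differentiable at w" using st[of t] wQ by (simp add: stream_function_def)
      then have d: "quarter_ext (\<psi> t) differentiable at (axis_refl a b z)"
        using differentiable_quarter_ext[OF wQ] by (simp add: w_def)
      \<comment> \<open>Comparison with \<open>2\<close> shows the signs exchanged. The rotated
        gradient pairs the x derivative of one function with the y derivative of the other, so the
        sign of the test function is just the one needed by the stream function and the integrands
        coincide.\<close>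
      have 3: "dir_deriv 1 (?G t) z = b * dir_deriv 1 (\<psi> t) w" "dir_deriv \<i> (?G t) z = a * dir_deriv \<i> (\<psi> t) w"
        using odd_ext_deriv_quadrant(2,3)[OF ab wQ[unfolded w_def] quarter_ext_simps(2) d]
        by (simp_all add: dir_deriv_quarter_ext[OF wQ] flip: w_def)
      show ?thesis
        unfolding f_def fst_conv snd_conv w_def[symmetric] 1
        by (simp add: grad_perp_def grad_def inner_complex_def 2 3)
    qed
    ultimately show "has_bochner_integral lebesgue
        (\<lambda>(t, z). \<omega> t (axis_refl a b z) * (deriv (\<lambda>s. \<phi> (s, z)) t + grad_perp (?G t) z \<bullet> grad (\<lambda>w. \<phi> (t, w)) z)) 0"
      by (simp add: case_prod_unfold)
  qed
  show ?thesis
    unfolding euler_weak_solution_def by (intro conjI exI[of _ ?G] allI impI L S W)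
qed

text \<open>Reflections are involutions, so the indicator of a reflected set is the indicator
  composed with the same reflection; the point reflection is the composite of the two axis
  reflections.\<close>

lemma indicator_reflections_eq_odd_ext:
  "indicat_real D z - indicat_real (refl_x ` D) z - indicat_real (refl_y ` D) z + indicat_real (uminus ` D) z
    = odd_ext (indicat_real D) z"
proof -
  have r: "refl_x = axis_refl 1 (- 1)" "refl_y = axis_refl (- 1) 1" "uminus = axis_refl (- 1) (- 1)"
    by (auto simp: refl_x_def refl_y_def axis_refl_def complex_eq_iff)
  have "indicat_real (axis_refl a b ` D) z = indicat_real D (axis_refl a b z)" if "\<bar>a\<bar> = 1" "\<bar>b\<bar> = 1" for a b
    using axis_refl_involution[OF that] by (auto simp: indicator_def) (metis image_eqI)
  then show ?thesis unfolding r odd_ext_def by simp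
qed

theorem proposition1p7:
  shows
   "(convex quarter_disc
     \<and> {z \<in> quarter_disc. (robin quarter_disc has_derivative (\<lambda>h. 0)) (at z)} = {\<xi>\<^sub>0}
     \<and> (\<exists>F. conformal_bijection F (ball 0 1) quarter_disc \<and> F 0 = \<xi>\<^sub>0)
     \<and> (\<forall>F. conformal_bijection F (ball 0 1) quarter_disc \<and> F 0 = \<xi>\<^sub>0 \<longrightarrow>
          cmod ((deriv ^^ 3) F 0 / deriv F 0)
            \<notin> {2 * sqrt (1 - 1 / (real n)\<^sup>2) | n::nat. n \<ge> 1} \<union> {2}))
    \<and>
    (\<forall>(lam::real) (\<E>::complex set) (\<epsilon>::real) (D :: real \<Rightarrow> complex set).
        point_vortex_periodic_orbit quarter_disc lam \<E> \<and>
        \<epsilon> > 0 \<and> concentrated_along quarter_disc \<E> \<epsilon> D \<and>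
        time_periodic D \<and>
        euler_weak_solution quarter_disc (\<lambda>t. indicat_real (D t))
        \<longrightarrow>
        (let \<omega> = (\<lambda>t z. indicat_real (D t) z - indicat_real (refl_x ` D t) z
                        - indicat_real (refl_y ` D t) z + indicat_real (uminus ` D t) z)
         in time_periodic \<omega> \<and> euler_weak_solution (ball 0 1) \<omega>))"
proof (rule conjI)
  show "convex quarter_disc
     \<and> {z \<in> quarter_disc. (robin quarter_disc has_derivative (\<lambda>h. 0)) (at z)} = {\<xi>\<^sub>0}
     \<and> (\<exists>F. conformal_bijection F (ball 0 1) quarter_disc \<and> F 0 = \<xi>\<^sub>0)
     \<and> (\<forall>F. conformal_bijection F (ball 0 1) quarter_disc \<and> F 0 = \<xi>\<^sub>0 \<longrightarrow>
          cmod ((deriv ^^ 3) F 0 / deriv F 0)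
            \<notin> {2 * sqrt (1 - 1 / (real n)\<^sup>2) | n::nat. n \<ge> 1} \<union> {2})"
    using convex_quarter_disc robin_quarter_disc_critical_points quarter_disc_conformal_bijection_exists
      quarter_disc_conformal_bijection_nondegenerate by blast
next
  \<comment> \<open>The extension acts at each time separately, so a period of \<open>D\<close> is
    also a period of the extended vorticity.\<close>
  have "time_periodic (\<lambda>t. odd_ext (indicat_real (D t))) \<and> euler_weak_solution (ball 0 1) (\<lambda>t. odd_ext (indicat_real (D t)))"
    if "time_periodic D" "euler_weak_solution quarter_disc (\<lambda>t. indicat_real (D t))" for D
    using that(1) euler_weak_solution_odd_ext[OF that(2)] by (auto simp: time_periodic_def)
  then show "\<forall>(lam::real) (\<E>::complex set) (\<epsilon>::real) (D :: real \<Rightarrow> complex set).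
        point_vortex_periodic_orbit quarter_disc lam \<E> \<and>
        \<epsilon> > 0 \<and> concentrated_along quarter_disc \<E> \<epsilon> D \<and>
        time_periodic D \<and>
        euler_weak_solution quarter_disc (\<lambda>t. indicat_real (D t))
        \<longrightarrow>
        (let \<omega> = (\<lambda>t z. indicat_real (D t) z - indicat_real (refl_x ` D t) z
                        - indicat_real (refl_y ` D t) z + indicat_real (uminus ` D t) z)
         in time_periodic \<omega> \<and> euler_weak_solution (ball 0 1) \<omega>)"
    unfolding Let_def indicator_reflections_eq_odd_ext by blast
qed

end
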